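(* Let $\tau>\frac{N}{2}$ and $\varphi\in L_2^{\tau}(\mathbb{R}^N)$, and let $\rho\in(0,1)$, $T>0$. Then the forward problem $$D_t^\rho u(x,t)+A(D)u(x,t)=0,\quad x\in\mathbb{R}^N,\ 0<t\le T,$$ $$\lim_{|x|\to\infty}D^\alpha u(x,t)=0,\quad |\alpha|\le l-1,\ 0<t\le T,$$ $$u(x,0)=\varphi(x),\quad x\in\mathbb{R}^N,$$ has a (classical) solution, given by $$u(x,t)=\int_{\mathbb{R}^N}E_\rho\big(-A(\xi)t^\rho\big)\,\hat\varphi(\xi)\,e^{ix\xi}\,d\xi ,$$ where the integral converges uniformly with respect to $x\in\mathbb{R}^N$ for each $t\in(0,T]$.
   Context: $A(D)=\sum_{|\alpha|=m}a_\alpha D^\alpha$ is a homogeneous symmetric elliptic differential expression of even order $m=2l$ with constant coefficients, where $\alpha=(\alpha_1,\dots,\alpha_N)$ is a multi-index, $D=(D_1,\dots,D_N)$, $D_j=\partial/\partial x_j$; its symbol $A(\xi)=\sum_{|\alpha|=m}a_\alpha\xi^\alpha$ satisfies $A(\xi)>0$ for all $\xi\neq0$. For $\rho<0$ the Riemann–Liouville fractional integral is $\partial_t^\rho h(t)=\frac{1}{\Gamma(-\rho)}\int_0^t\frac{h(s)}{(t-s)^{\rho+1}}ds$, and for $0<\rho<1$ the Caputo derivative is $D_t^\rho h(t)=\partial_t^{\rho-1}\frac{d}{dt}h(t)$. $E_\rho(z)=\sum_{k\ge0}\frac{z^k}{\Gamma(\rho k+1)}$ is the Mittag-Leffler function.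 The Fourier transform is $\hat f(\xi)=(2\pi)^{-N}\int_{\mathbb{R}^N}f(x)e^{-ix\xi}dx$. The Sobolev class $L_2^a(\mathbb{R}^N)$, $a>0$, consists of $f\in L_2(\mathbb{R}^N)$ with $\|f\|^2_{L_2^a}=\int_{\mathbb{R}^N}(1+|\xi|^2)^a|\hat f(\xi)|^2d\xi<\infty$. A (classical) solution of the forward problem is a function $u(x,t)$ with $D_t^\rho u$ and $A(D)u$ in $C(\mathbb{R}^N\times(0,T])$ satisfying the equation, the boundary condition at infinity, and the initial condition above.
   Formalization: D_j is taken as -i∂/∂x_j, so that A(D) has symbol A(ξ); with D_j=∂/∂x_j the claim fails for odd l (e.g. A(D)=d²/dx²) and is unchanged for even l. The initial condition u(x,0)=φ(x) is understood for almost every x, as φ is an L_2 class. *)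

theory Defs
  imports "HOL-Analysis.Analysis"
begin

definition mi_order :: "('n::finite \<Rightarrow> nat) \<Rightarrow> nat" where
  "mi_order \<alpha> = (\<Sum>i\<in>UNIV. \<alpha> i)"

definition dpart :: "'n::finite \<Rightarrow> (real^'n \<Rightarrow> complex) \<Rightarrow> real^'n \<Rightarrow> complex" where
  "dpart j f x = - \<i> * vector_derivative (\<lambda>s. f (x + s *\<^sub>R axis j 1)) (at 0)"

primrec mderiv :: "nat \<Rightarrow> ('n::finite \<Rightarrow> nat) \<Rightarrow> (real^'n \<Rightarrow> complex) \<Rightarrow> real^'n \<Rightarrow> complex" where
  "mderiv 0 \<alpha> f = f"
| "mderiv (Suc k) \<alpha> f =
     (let j = (SOME j. \<alpha> j \<noteq> 0) in dpart j (mderiv k (\<alpha>(j := \<alpha> j - 1)) f))"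

primrec mderiv_exists :: "nat \<Rightarrow> ('n::finite \<Rightarrow> nat) \<Rightarrow> (real^'n \<Rightarrow> complex) \<Rightarrow> real^'n \<Rightarrow> bool" where
  "mderiv_exists 0 \<alpha> f x = True"
| "mderiv_exists (Suc k) \<alpha> f x =
     (let j = (SOME j. \<alpha> j \<noteq> 0); \<beta> = \<alpha>(j := \<alpha> j - 1) in
        (\<forall>y. mderiv_exists k \<beta> f y) \<and>
        (\<lambda>s. mderiv k \<beta> f (x + s *\<^sub>R axis j 1)) differentiable (at 0))"

definition Dmi :: "('n::finite \<Rightarrow> nat) \<Rightarrow> (real^'n \<Rightarrow> complex) \<Rightarrow> real^'n \<Rightarrow> complex" where
  "Dmi \<alpha> f = mderiv (mi_order \<alpha>) \<alpha> f"

definition Dmi_exists :: "('n::finite \<Rightarrow> nat) \<Rightarrow> (real^'n \<Rightarrow> complex) \<Rightarrow> real^'n \<Rightarrow> bool" where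
  "Dmi_exists \<alpha> f x = mderiv_exists (mi_order \<alpha>) \<alpha> f x"

definition opA :: "(('n::finite \<Rightarrow> nat) \<Rightarrow> real) \<Rightarrow> nat \<Rightarrow> (real^'n \<Rightarrow> complex) \<Rightarrow> real^'n \<Rightarrow> complex" where
  "opA a m f x = (\<Sum>\<alpha>\<in>{\<alpha>. mi_order \<alpha> = m}. complex_of_real (a \<alpha>) * Dmi \<alpha> f x)"

definition symbA :: "(('n::finite \<Rightarrow> nat) \<Rightarrow> real) \<Rightarrow> nat \<Rightarrow> real^'n \<Rightarrow> real" where
  "symbA a m \<xi> = (\<Sum>\<alpha>\<in>{\<alpha>. mi_order \<alpha> = m}. a \<alpha> * (\<Prod>i\<in>UNIV. (\<xi> $ i) ^ \<alpha> i))"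

definition mittag_leffler :: "real \<Rightarrow> real \<Rightarrow> real" where
  "mittag_leffler \<rho> z = (\<Sum>k. z ^ k / Gamma (\<rho> * real k + 1))"

text \<open>Riemann--Liouville fractional integral of order sigma < 0.\<close>
definition rl_integral :: "real \<Rightarrow> (real \<Rightarrow> complex) \<Rightarrow> real \<Rightarrow> complex" where
  "rl_integral \<sigma> h t =
     (1 / Gamma (- \<sigma>)) *\<^sub>R (LINT s:{0<..<t}|lborel. ((t - s) powr (- \<sigma> - 1)) *\<^sub>R h s)"

definition rl_integral_exists :: "real \<Rightarrow> (real \<Rightarrow> complex) \<Rightarrow> real \<Rightarrow> bool" where
  "rl_integral_exists \<sigma> h t =
     set_integrable lborel {0<..<t} (\<lambda>s. ((t - s) powr (- \<sigma> - 1)) *\<^sub>R h s)"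

definition caputo :: "real \<Rightarrow> (real \<Rightarrow> complex) \<Rightarrow> real \<Rightarrow> complex" where
  "caputo \<rho> h t = rl_integral (\<rho> - 1) (\<lambda>s. vector_derivative h (at s)) t"

definition caputo_exists :: "real \<Rightarrow> (real \<Rightarrow> complex) \<Rightarrow> real \<Rightarrow> bool" where
  "caputo_exists \<rho> h t \<longleftrightarrow>
     (\<forall>s\<in>{0<..<t}. h differentiable (at s)) \<and>
     rl_integral_exists (\<rho> - 1) (\<lambda>s. vector_derivative h (at s)) t"

definition L2 :: "(real^'n::finite \<Rightarrow> complex) \<Rightarrow> bool" where
  "L2 f \<longleftrightarrow> f \<in> borel_measurable lborel \<and> integrable lborel (\<lambda>x. (cmod (f x))\<^sup>2)"

definition fourier_trunc :: "(real^'n::finite \<Rightarrow> complex) \<Rightarrow> real \<Rightarrow> real^'n \<Rightarrow> complex" where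
  "fourier_trunc f R \<xi> =
     ((2 * pi) powr (- real CARD('n))) *\<^sub>R (LINT x:cball 0 R|lborel. f x * cis (- (x \<bullet> \<xi>)))"

text \<open>g is (a representative of) the Fourier transform of f in the L_2 (Plancherel) sense.\<close>
definition is_fourier_L2 :: "(real^'n::finite \<Rightarrow> complex) \<Rightarrow> (real^'n \<Rightarrow> complex) \<Rightarrow> bool" where
  "is_fourier_L2 f g \<longleftrightarrow> L2 g \<and>
     ((\<lambda>R. LINT \<xi>|lborel. (cmod (g \<xi> - fourier_trunc f R \<xi>))\<^sup>2) \<longlongrightarrow> 0) at_top"

definition sobolev_L2 :: "real \<Rightarrow> (real^'n::finite \<Rightarrow> complex) \<Rightarrow> (real^'n \<Rightarrow> complex) \<Rightarrow> bool" where
  "sobolev_L2 a f g \<longleftrightarrow> L2 f \<and> is_fourier_L2 f g \<and>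
     integrable lborel (\<lambda>\<xi>. (1 + (norm \<xi>)\<^sup>2) powr a * (cmod (g \<xi>))\<^sup>2)"

definition classical_solution ::
  "real \<Rightarrow> (('n::finite \<Rightarrow> nat) \<Rightarrow> real) \<Rightarrow> nat \<Rightarrow> real \<Rightarrow> (real^'n \<Rightarrow> complex)
    \<Rightarrow> (real^'n \<Rightarrow> real \<Rightarrow> complex) \<Rightarrow> bool" where
  "classical_solution \<rho> a l T \<phi> u \<longleftrightarrow>
     \<comment> \<open>u(x,.) continuous on [0,T] (so that the initial condition is meaningful)\<close>
     (\<forall>x. continuous_on {0..T} (\<lambda>t. u x t)) \<and>
     \<comment> \<open>classical x-derivatives up to order m = 2l exist\<close>
     (\<forall>t\<in>{0<..T}. \<forall>\<alpha>. mi_order \<alpha> \<le> 2 * l \<longrightarrow> (\<forall>x. Dmi_exists \<alpha> (\<lambda>y. u y t) x)) \<and>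
     \<comment> \<open>Caputo derivative exists\<close>
     (\<forall>x. \<forall>t\<in>{0<..T}. caputo_exists \<rho> (\<lambda>s. u x s) t) \<and>
     \<comment> \<open>D_t^rho u and A(D)u continuous on R^N x (0,T]\<close>
     continuous_on (UNIV \<times> {0<..T}) (\<lambda>(x, t). caputo \<rho> (\<lambda>s. u x s) t) \<and>
     continuous_on (UNIV \<times> {0<..T}) (\<lambda>(x, t). opA a (2 * l) (\<lambda>y. u y t) x) \<and>
     \<comment> \<open>the equation\<close>
     (\<forall>x. \<forall>t\<in>{0<..T}. caputo \<rho> (\<lambda>s. u x s) t + opA a (2 * l) (\<lambda>y. u y t) x = 0) \<and>
     \<comment> \<open>boundary condition at infinity, |alpha| <= l - 1\<close>
     (\<forall>t\<in>{0<..T}. \<forall>\<alpha>. mi_order \<alpha> + 1 \<le> l \<longrightarrow>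
        ((\<lambda>x. Dmi \<alpha> (\<lambda>y. u y t) x) \<longlongrightarrow> 0) at_infinity) \<and>
     \<comment> \<open>initial condition (equality of L_2 functions, i.e. almost everywhere)\<close>
     (AE x in lborel. u x 0 = \<phi> x)"

end

theory Submission
  imports Defs "HOL-Probability.Probability"
begin

text \<open>
  The function \<open>F(t) = E_\<rho>(- \<lambda> t^\<rho>)\<close> solves \<open>D_t^\<rho> F = - \<lambda> F\<close>, \<open>F(0) = 1\<close>, so formally the
  Fourier integral solves the problem; what is needed are bounds uniform in \<open>\<lambda> = A(\<xi>)\<close>.
  The resolvent kernel \<open>t^(\<rho> - 1) E_{\<rho>,\<rho>}(- t^\<rho>)\<close> satisfies a Volterra equation with the log-convex
  kernel \<open>t^(\<rho> - 1)\<close>, and a comparison at its first zero shows that it is positive. The same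
  argument applied to its derivative in the spectral parameter shows that \<open>z \<mapsto> E_{\<rho>,\<rho>}(- z)\<close> is
  decreasing. Positivity and monotonicity turn the Volterra equations into
  \<open>0 \<le> E_\<rho>(- z) \<le> 1\<close> and boundedness of \<open>z E_\<rho>(- z)\<close> and \<open>z E_{\<rho>,\<rho>}(- z)\<close>.

  Since \<open>\<tau> > N/2\<close>, the transform of \<open>\<phi>\<close> is integrable, and ellipticity gives \<open>|\<xi>|^(2l) \<le> C A(\<xi>)\<close>;
  hence all derivatives may be taken under the integral, the Caputo derivative is computed by
  Fubini's theorem, the conditions at infinity follow from the Riemann--Lebesgue lemma, and the
  initial condition is Fourier inversion in \<open>L_2\<close>, obtained by testing against Gaussians.
\<close>

section \<open>Mittag-Leffler functions on the negative half-line\<close>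

text \<open>The alternating series of E_\<rho>(- z) shows neither its sign nor its decay, which is
  why the work is done in the time variable. Scaling z = t^\<rho> fixes the spectral parameter at
  -1, so a single Volterra equation covers all \<lambda> and the bounds are automatically uniform in
  \<xi>. Its forcing term t^(\<rho> - 1) / Gamma \<rho> is borderline for the comparison: multiplied
  by t^(1 - \<rho>) it is constant. For the parameter derivative the corresponding product is known
  to increase only as far as the derivative is known to have its sign; hence the comparison lets
  positivity before the first zero be assumed when the forcing term is examined. On the Fourier side
  everything rests on Fubini's theorem for bounded kernels and on the Gaussian being an
  eigenfunction. Square integrability of a transform, proved from these two alone, serves twice: for
  the decay at infinity, and to give content to the L_2 limit that defines the transform of \<phi>,
  since the integral of a non-integrable function is 0 by convention.\<close>

lemma Gamma_real_nonzero [simp]: "x > 0 \<Longrightarrow> Gamma x \<noteq> (0::real)"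
  using Gamma_real_pos[of x] by linarith

text \<open>Gautschi's inequality. The point \<open>x + 1\<close> divides the segment from
  \<open>x + r\<close> to \<open>x + r + 1\<close> with weights r and 1 - r, and log-convexity there
  compares \<open>Gamma (x + 1)\<close> with \<open>Gamma (x + r) * (x + r) powr (1 - r)\<close>. It
  serves the ratio test, where consecutive arguments differ by r.\<close>

lemma Gamma_ratio_le:
  fixes x r :: real
  assumes "x > 0" "0 < r" "r < 1"
  shows "Gamma x / Gamma (x + r) \<le> (x + r) powr (1 - r) / x"
proof -
  have pos: "Gamma x > 0" "Gamma (x + r) > 0" "Gamma (x + r + 1) > 0" "Gamma (x + 1) > 0"
    using assms by (auto intro!: Gamma_real_pos)
  have "(ln \<circ> Gamma) ((1 - (1 - r)) *\<^sub>R (x + r) + (1 - r) *\<^sub>R (x + r + 1))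
      \<le> (1 - (1 - r)) * (ln \<circ> Gamma) (x + r) + (1 - r) * (ln \<circ> Gamma) (x + r + 1)"
    using assms by (intro convex_onD[OF log_convex_Gamma_real]) auto
  moreover have "(1 - (1 - r)) *\<^sub>R (x + r) + (1 - r) *\<^sub>R (x + r + 1) = x + 1"
    by (simp add: algebra_simps)
  moreover have "Gamma (x + r + 1) = (x + r) * Gamma (x + r)"
    using Gamma_plus1[of "x + r"] assms nonpos_Ints_nonpos[of "x + r"] by force
  ultimately have "ln (Gamma (x + 1)) \<le> ln (Gamma (x + r)) + (1 - r) * ln (x + r)"
    using pos assms by (simp add: ln_mult distrib_left left_diff_distrib)
  also have "\<dots> = ln (Gamma (x + r) * (x + r) powr (1 - r))"
    using pos(2) assms by (subst ln_mult_pos) (auto simp: ln_powr)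
  finally have "Gamma (x + 1) \<le> Gamma (x + r) * (x + r) powr (1 - r)"
    using pos assms by (subst (asm) ln_le_cancel_iff) auto
  moreover have "Gamma (x + 1) = x * Gamma x"
    using Gamma_plus1[of x] assms nonpos_Ints_nonpos[of x] by force
  ultimately show ?thesis
    using pos assms by (simp add: field_simps)
qed

lemma summable_power_over_Gamma:
  fixes r b z :: real
  assumes r: "0 < r" "r < 1" and b: "b > 0"
  shows "summable (\<lambda>k. z ^ k / Gamma (r * real k + b))"
proof -
  define x where "x k = r * real k + b" for k
  have x: "x k > 0" for k using assms by (simp add: x_def add_nonneg_pos)
  have Gpos: "Gamma (x k) > 0" for k using x by (auto intro!: Gamma_real_pos)
  have lim: "(\<lambda>k. \<bar>z\<bar> * ((x k + r) powr (1 - r) / x k)) \<longlonglongrightarrow> 0"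
    unfolding x_def using r b by real_asymp
  then have "eventually (\<lambda>k. \<bar>z\<bar> * ((x k + r) powr (1 - r) / x k) < 1/2) sequentially"
    by (rule order_tendstoD) simp
  then obtain N where N: "\<And>k. k \<ge> N \<Longrightarrow> \<bar>z\<bar> * ((x k + r) powr (1 - r) / x k) < 1/2"
    by (auto simp: eventually_sequentially)
  show ?thesis
    unfolding x_def[symmetric]
  proof (rule summable_ratio_test[where c="1/2" and N=N])
    fix k assume "k \<ge> N"
    have xs: "x (Suc k) = x k + r" by (simp add: x_def algebra_simps)
    have "norm (z ^ Suc k / Gamma (x (Suc k))) =
        (\<bar>z\<bar> * (Gamma (x k) / Gamma (x k + r))) * norm (z ^ k / Gamma (x k))"
      using Gpos[of k] Gpos[of "Suc k"] by (simp add: xs power_abs abs_mult)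
    also have "\<dots> \<le> (\<bar>z\<bar> * ((x k + r) powr (1 - r) / x k)) * norm (z ^ k / Gamma (x k))"
      using Gamma_ratio_le[OF x r, of k] by (intro mult_right_mono mult_left_mono) auto
    also have "\<dots> \<le> 1/2 * norm (z ^ k / Gamma (x k))"
      using N[OF \<open>k \<ge> N\<close>] by (intro mult_right_mono) auto
    finally show "norm (z ^ Suc k / Gamma (x (Suc k))) \<le> 1/2 * norm (z ^ k / Gamma (x k))" .
  qed simp
qed

section \<open>Fractional integration of power series in t^r\<close>

lemma has_bochner_integral_Beta_interval:
  fixes a b t :: real
  assumes "a > 0" "b > 0" "t > 0"
  shows "has_bochner_integral lborel
    (\<lambda>s. indicator {0<..<t} s * ((t - s) powr (b - 1) * s powr (a - 1)))
    (Gamma b * (t powr (a + b - 1) * Gamma a / Gamma (a + b)))"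
proof -
  let ?f = "\<lambda>s. indicator {0<..<t} s * ((t - s) powr (b - 1) * s powr (a - 1))"
  let ?B = "\<lambda>x::real. indicator {0..1} x *\<^sub>R (x powr (a - 1) * (1 - x) powr (b - 1))"
  have I: "integrable lborel ?B"
    using integrable_Beta[OF assms(1,2)] by (simp add: set_integrable_def)
  have V: "integral\<^sup>L lborel ?B = Beta a b"
    using set_borel_integral_eq_integral(2)[OF integrable_Beta[OF assms(1,2)]]
      has_integral_Beta_real[OF assms(1,2)]
    by (simp add: set_lebesgue_integral_def integral_unique)
  have eq: "?f (0 + t * x) = t powr (a + b - 2) * ?B x" for x
  proof (cases "x \<in> {0<..<1}")
    case True
    have "t - t * x = t * (1 - x)" by (simp add: algebra_simps)
    then have "(t - t * x) powr (b - 1) * (t * x) powr (a - 1) =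
        (t powr (b - 1) * t powr (a - 1)) * (x powr (a - 1) * (1 - x) powr (b - 1))"
      using True assms by (simp add: powr_mult)
    also have "t powr (b - 1) * t powr (a - 1) = t powr (a + b - 2)"
      by (simp add: powr_add[symmetric] add.commute)
    finally show ?thesis using True assms by (simp add: indicator_def mult_less_cancel_left1)
  next
    case False
    then have "x \<le> 0 \<or> x \<ge> 1" by auto
    then have "t * x \<le> 0 \<or> t * x \<ge> t" using assms
      by (simp add: mult_le_0_iff mult_le_cancel_left1)
    then have 1: "indicator {0<..<t} (0 + t * x) = (0::real)" by (auto simp: indicator_def)
    \<comment> \<open>The endpoints are harmless because \<open>0 powr y = 0\<close> for every y,
      including y = 0; so the open and the closed interval give the same integrand.\<close>
    have 2: "?B x = 0" using \<open>x \<le> 0 \<or> x \<ge> 1\<close> by (auto simp: indicator_def)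
    show ?thesis unfolding 1 2 by simp
  qed
  have "integrable lborel (\<lambda>x. ?f (0 + t * x))"
    unfolding eq using I by (intro integrable_mult_right) auto
  then have 1: "integrable lborel ?f"
    using lborel_integrable_real_affine_iff[of t ?f 0] assms by simp
  have "integral\<^sup>L lborel ?f = \<bar>t\<bar> *\<^sub>R (LINT x|lborel. ?f (0 + t * x))"
    using assms by (intro lborel_integral_real_affine) auto
  also have "\<dots> = t * (t powr (a + b - 2) * Beta a b)"
    unfolding eq V[symmetric] using assms by simp
  also have "t * (t powr (a + b - 2) * Beta a b) = (t powr 1 * t powr (a + b - 2)) * Beta a b"
    using assms by simp
  also have "t powr 1 * t powr (a + b - 2) = t powr (a + b - 1)"
    unfolding powr_add[symmetric] by simp
  also have "t powr (a + b - 1) * Beta a b = Gamma b * (t powr (a + b - 1) * Gamma a / Gamma (a + b))"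
    by (simp add: Beta_def)
  finally show ?thesis using 1 by (simp add: has_bochner_integral_iff)
qed

text \<open>For \<open>c k = x ^ k\<close> this is t^(b - 1) E_{r,b}(x t^r). The terms are
  normalised so that the Riemann-Liouville integral of order d only replaces b by
  \<open>b + d\<close> and leaves the coefficients alone.\<close>

definition frac_series :: "real \<Rightarrow> (nat \<Rightarrow> real) \<Rightarrow> real \<Rightarrow> real \<Rightarrow> real" where
  "frac_series r c b t = (\<Sum>k. c k * t powr (r * real k + b - 1) / Gamma (r * real k + b))"

text \<open>Convergence is required for all b at once, so that the class is stable under the shifts
  of b caused by fractional integration.\<close>

definition entire_coeffs :: "real \<Rightarrow> (nat \<Rightarrow> real) \<Rightarrow> bool" where
  "entire_coeffs r c \<longleftrightarrow> (\<forall>b>0. \<forall>z. summable (\<lambda>k. \<bar>c k\<bar> * z ^ k / Gamma (r * real k + b)))"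

lemma frac_series_term:
  assumes "t > 0"
  shows "t powr (r * real k + b - 1) = t powr (b - 1) * (t powr r) ^ k"
proof -
  have "(t powr r) ^ k = t powr (r * real k)"
    using assms by (simp add: powr_powr flip: powr_realpow)
  then show ?thesis by (simp add: algebra_simps flip: powr_add)
qed

lemma entire_coeffs_summable:
  assumes "entire_coeffs r c" "b > 0" "r > 0"
  shows "summable (\<lambda>k. c k / Gamma (r * real k + b) * z ^ k)"
proof (rule summable_comparison_test')
  show "summable (\<lambda>k. \<bar>c k\<bar> * \<bar>z\<bar> ^ k / Gamma (r * real k + b))"
    using assms by (auto simp: entire_coeffs_def)
  show "norm (c k / Gamma (r * real k + b) * z ^ k) \<le> \<bar>c k\<bar> * \<bar>z\<bar> ^ k / Gamma (r * real k + b)" for k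
    using assms Gamma_real_pos[of "r * real k + b"] by (simp add: abs_mult power_abs add_nonneg_pos)
qed

lemma frac_series_eq_power_series:
  assumes "t > 0" "entire_coeffs r c" "b > 0" "r > 0"
  shows "frac_series r c b t = t powr (b - 1) * (\<Sum>k. c k / Gamma (r * real k + b) * (t powr r) ^ k)"
  unfolding frac_series_def frac_series_term[OF assms(1)]
  using suminf_mult[OF entire_coeffs_summable[OF assms(2-4)], of "t powr (b - 1)" "t powr r"]
  by (simp add: algebra_simps)

lemma summable_frac_series:
  assumes "t > 0" "entire_coeffs r c" "b > 0" "r > 0"
  shows "summable (\<lambda>k. c k * t powr (r * real k + b - 1) / Gamma (r * real k + b))"
proof -
  have "summable (\<lambda>k. t powr (b - 1) * (c k / Gamma (r * real k + b) * (t powr r) ^ k))"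
    using entire_coeffs_summable[OF assms(2-4)] by (rule summable_mult)
  then show ?thesis unfolding frac_series_term[OF assms(1)] by (simp add: mult_ac)
qed

text \<open>Every term is a Beta integral of constant sign, so the integrals of the absolute values
  form the same series with \<bar>c k\<bar> in place of c k. Its convergence is what
  \<open>entire_coeffs\<close> grants at \<open>b + d\<close>, and it allows the exchange of sum and
  integral.\<close>

lemma has_bochner_integral_frac_series:
  assumes r: "0 < r" and c: "entire_coeffs r c" and b: "b > 0" and d: "d > 0" and t: "t > 0"
  shows "has_bochner_integral lborel
    (\<lambda>s. indicator {0<..<t} s * ((t - s) powr (d - 1) * frac_series r c b s))
    (Gamma d * frac_series r c (b + d) t)"
proof -
  define f where "f k s = c k / Gamma (r * real k + b) *
      (indicator {0<..<t} s * ((t - s) powr (d - 1) * s powr (r * real k + b - 1)))" for k s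
  have p: "r * real k + b > 0" for k using r b by (simp add: add_nonneg_pos)
  have p': "r * real k + (b + d) > 0" for k using p[of k] d by (simp add: add.assoc[symmetric])
  have Gp: "Gamma (r * real k + b) > 0" "Gamma (r * real k + (b + d)) > 0" for k
    using p p' by (auto intro!: Gamma_real_pos)
  have Gd: "Gamma d > 0" using d by (rule Gamma_real_pos)
  have base: "has_bochner_integral lborel
      (\<lambda>s. indicator {0<..<t} s * ((t - s) powr (d - 1) * s powr (r * real k + b - 1)))
      (Gamma d * (t powr (r * real k + (b + d) - 1) * Gamma (r * real k + b) / Gamma (r * real k + (b + d))))" for k
    using has_bochner_integral_Beta_interval[OF p d t, of k] by (simp add: add.assoc)
  have hb: "has_bochner_integral lborel (f k)
      (Gamma d * (c k * t powr (r * real k + (b + d) - 1) / Gamma (r * real k + (b + d))))" for k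
    unfolding f_def using has_bochner_integral_mult_right[OF base[of k], of "c k / Gamma (r * real k + b)"] Gp[of k]
    by (simp add: field_simps)
  have hbn: "integral\<^sup>L lborel (\<lambda>s. norm (f k s)) =
      Gamma d * (\<bar>c k\<bar> * t powr (r * real k + (b + d) - 1) / Gamma (r * real k + (b + d)))" for k
  proof -
    have "(\<lambda>s. norm (f k s)) = (\<lambda>s. \<bar>c k\<bar> / Gamma (r * real k + b) *
      (indicator {0<..<t} s * ((t - s) powr (d - 1) * s powr (r * real k + b - 1))))"
      using Gp[of k] by (auto simp: f_def abs_mult)
    then show ?thesis
      using has_bochner_integral_mult_right[OF base[of k], of "\<bar>c k\<bar> / Gamma (r * real k + b)"] Gp[of k]
      by (simp add: has_bochner_integral_iff field_simps)
  qed
  have sn: "summable (\<lambda>k. norm (f k s))" for s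
  proof (cases "s \<in> {0<..<t}")
    case True
    have "summable (\<lambda>k. (t - s) powr (d - 1) * s powr (b - 1) *
        (\<bar>c k\<bar> * (s powr r) ^ k / Gamma (r * real k + b)))"
      using c b by (intro summable_mult) (auto simp: entire_coeffs_def)
    moreover have "norm (f k s) = (t - s) powr (d - 1) * s powr (b - 1) *
        (\<bar>c k\<bar> * (s powr r) ^ k / Gamma (r * real k + b))" for k
      using True Gp[of k] by (simp add: f_def abs_mult frac_series_term)
    ultimately show ?thesis by simp
  qed (simp add: f_def)
  have si: "summable (\<lambda>k. \<integral>s. norm (f k s) \<partial>lborel)"
  proof -
    have "summable (\<lambda>k. Gamma d * t powr (b + d - 1) *
        (\<bar>c k\<bar> * (t powr r) ^ k / Gamma (r * real k + (b + d))))"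
      using c b d by (intro summable_mult) (auto simp: entire_coeffs_def)
    then show ?thesis unfolding hbn frac_series_term[OF t] by (simp add: algebra_simps)
  qed
  have fi: "integrable lborel (f k)" for k using hb by (simp add: has_bochner_integral_iff)
  have sum_eq: "(\<Sum>k. f k s) = indicator {0<..<t} s * ((t - s) powr (d - 1) * frac_series r c b s)" for s
  proof (cases "s \<in> {0<..<t}")
    case True
    have "summable (\<lambda>k. c k * s powr (r * real k + b - 1) / Gamma (r * real k + b))"
      using True by (intro summable_frac_series c b r) auto
    from suminf_mult[OF this, of "(t - s) powr (d - 1)"] True
    show ?thesis by (simp add: f_def frac_series_def algebra_simps)
  qed (simp add: f_def)
  have i: "integrable lborel (\<lambda>s. \<Sum>k. f k s)"
    by (rule integrable_suminf[OF fi _ si]) (rule AE_I2, rule sn)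
  have "(\<lambda>k. integral\<^sup>L lborel (f k)) sums (\<integral>s. (\<Sum>k. f k s) \<partial>lborel)"
    by (rule sums_integral[OF fi _ si]) (rule AE_I2, rule sn)
  then have "(\<integral>s. (\<Sum>k. f k s) \<partial>lborel) =
      (\<Sum>k. Gamma d * (c k * t powr (r * real k + (b + d) - 1) / Gamma (r * real k + (b + d))))"
    using hb by (simp add: has_bochner_integral_iff sums_iff)
  also have "\<dots> = Gamma d * frac_series r c (b + d) t"
  proof -
    have "summable (\<lambda>k. c k * t powr (r * real k + (b + d) - 1) / Gamma (r * real k + (b + d)))"
      using b d by (intro summable_frac_series c t r) auto
    from suminf_mult[OF this, of "Gamma d"] show ?thesis by (simp add: frac_series_def)
  qed
  finally show ?thesis using i unfolding sum_eq by (simp add: has_bochner_integral_iff)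
qed


section \<open>Comparison for Volterra equations with a weakly singular kernel\<close>

lemma kernel_integral_le:
  fixes f :: "real \<Rightarrow> real"
  assumes r: "0 < r" and ab: "0 \<le> a" "a < b"
    and int: "integrable lborel (\<lambda>s. indicator {a<..<b} s * ((b - s) powr (r - 1) * f s))"
    and le: "\<And>s. a < s \<Longrightarrow> s < b \<Longrightarrow> f s \<le> M"
  shows "(LINT s|lborel. indicator {a<..<b} s * ((b - s) powr (r - 1) * f s)) \<le> M * (b - a) powr r / r"
proof -
  let ?k = "\<lambda>s. indicator {a<..<b} s * (b - s) powr (r - 1)"
  have B: "has_bochner_integral lborel (\<lambda>s. indicator {0<..<b - a} s * (b - a - s) powr (r - 1))
    ((b - a) powr r / r)"
  proof -
    have "Gamma (1 + r) = r * Gamma r"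
      using Gamma_plus1[of r] r nonpos_Ints_nonpos[of r] by (force simp: add.commute)
    moreover have "Gamma r > 0" using r by (rule Gamma_real_pos)
    moreover have "indicator {0<..<b - a} s * ((b - a - s) powr (r - 1) * s powr (1 - 1))
       = indicator {0<..<b - a} s * (b - a - s) powr (r - 1)" for s :: real
      by (auto simp: indicator_def)
    moreover have "Gamma r * ((b - a) powr (1 + r - 1) * Gamma 1 / Gamma (1 + r)) = (b - a) powr r / r"
      using calculation(1) Gamma_real_pos[of r] r by simp
    ultimately show ?thesis
      using has_bochner_integral_Beta_interval[of 1 r "b - a"] r ab by (simp only: diff_gt_0_iff_gt zero_less_one)
  qed
  have eq: "?k (a + 1 * x) = indicator {0<..<b - a} x * (b - a - x) powr (r - 1)" for x
    by (auto simp: indicator_def algebra_simps)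
  have "integrable lborel (\<lambda>x. ?k (a + 1 * x))" unfolding eq using B by (simp add: has_bochner_integral_iff)
  then have ki: "integrable lborel ?k" using lborel_integrable_real_affine_iff[of 1 ?k a] by simp
  have kv: "integral\<^sup>L lborel ?k = (b - a) powr r / r"
    using lborel_integral_real_affine[of 1 ?k a] B unfolding eq by (simp add: has_bochner_integral_iff)
  have "(LINT s|lborel. indicator {a<..<b} s * ((b - s) powr (r - 1) * f s)) \<le> (LINT s|lborel. M * ?k s)"
  proof (rule integral_mono)
    show "indicator {a<..<b} s * ((b - s) powr (r - 1) * f s) \<le> M * ?k s" for s
      using le[of s] by (auto simp: indicator_def mult.commute intro: mult_left_mono)
  qed (use int ki in auto)
  then show ?thesis using kv by simp
qed

text \<open>Let \<open>t0\<close> be the first zero of \<open>f\<close> and \<open>t1\<close> a maximum point of \<open>f\<close> on a short interval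
  ending at \<open>t0\<close>. Since \<open>(t1 - s) powr (r - 1) \<ge> q * (t0 - s) powr (r - 1)\<close> with
  \<open>q = (t0 / t1) powr (1 - r)\<close>, comparing the two integral equations bounds \<open>f t1\<close> by the
  integral over \<open>{t1..t0}\<close> alone, hence by a small multiple of \<open>f t1\<close>.\<close>
lemma Volterra_solution_positive:
  fixes f p :: "real \<Rightarrow> real"
  assumes r: "0 < r" "r < 1"
    and cont: "continuous_on {0<..} f"
    and pos0: "eventually (\<lambda>t. f t > 0) (at_right 0)"
    and int: "\<And>t. t > 0 \<Longrightarrow> integrable lborel (\<lambda>s. indicator {0<..<t} s * ((t - s) powr (r - 1) * f s))"
    and eq: "\<And>t. t > 0 \<Longrightarrow>
       f t = p t - (LINT s|lborel. indicator {0<..<t} s * ((t - s) powr (r - 1) * f s)) / Gamma r"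
    and p: "\<And>t0 t1. 0 < t1 \<Longrightarrow> t1 < t0 \<Longrightarrow> (\<And>s. 0 < s \<Longrightarrow> s < t0 \<Longrightarrow> f s > 0)
       \<Longrightarrow> t1 powr (1 - r) * p t1 \<le> t0 powr (1 - r) * p t0"
    and t: "t > 0"
  shows "f t > 0"
proof (rule ccontr)
  assume neg: "\<not> f t > 0"
  from pos0 obtain e where e: "e > 0" "\<And>s. 0 < s \<Longrightarrow> s < e \<Longrightarrow> f s > 0"
    by (auto simp: eventually_at_right_field)
  have "e \<le> t" using e(2)[of t] neg t by force
  \<comment> \<open>Starting at e / 2 makes the set compact and keeps it away from the origin, where
    f need not be continuous; f is positive before e, so no zero is lost.\<close>
  define S where "S = {x \<in> {e/2..t}. f x \<le> 0}"
  have cS: "continuous_on {e/2..t} f"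
    by (rule continuous_on_subset[OF cont]) (use e in auto)
  have "S = {e/2..t} \<inter> f -` {..0}" by (auto simp: S_def)
  then have "closed S" using continuous_closed_preimage[OF cS, of "{..0}"] by simp
  moreover have "bounded S" by (rule bounded_subset[of "{e/2..t}"]) (auto simp: S_def)
  ultimately have "compact S" by (simp add: compact_eq_bounded_closed)
  moreover have "t \<in> S" using neg \<open>e \<le> t\<close> e by (auto simp: S_def)
  ultimately obtain t0 where t0: "t0 \<in> S" "\<And>x. x \<in> S \<Longrightarrow> t0 \<le> x"
    using compact_attains_inf[of S] by blast
  have t0p: "t0 > 0" and ft0: "f t0 \<le> 0" using t0(1) e by (auto simp: S_def)
  have fpos: "f s > 0" if "0 < s" "s < t0" for s
  proof (rule ccontr)
    assume "\<not> f s > 0"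
    then have "s \<in> S" using e(2)[of s] that t0(1) e(1) by (force simp: S_def)
    then show False using t0(2)[of s] that by simp
  qed
  have Gr: "Gamma r > 0" using r by (auto intro: Gamma_real_pos)
  \<comment> \<open>The bound t0 / 2 gives \<open>t0 \<le> 2 * t1\<close> and hence q \<le> 2; the
    other bound makes the integral over the last interval at most \<open>f t1 * Gamma r / 4\<close>.
    Together they end in \<open>f t1 \<le> f t1 / 2\<close>.\<close>
  define \<delta> where "\<delta> = min (t0 / 2) ((r * Gamma r / 4) powr (1 / r))"
  have dp: "\<delta> > 0" and d2: "\<delta> \<le> t0 / 2" using t0p r Gr by (auto simp: \<delta>_def)
  have "\<delta> powr r \<le> ((r * Gamma r / 4) powr (1 / r)) powr r"
    using dp r by (intro powr_mono2) (auto simp: \<delta>_def)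
  also have "\<dots> = r * Gamma r / 4" using r Gr by (simp add: powr_powr)
  finally have dr: "\<delta> powr r \<le> r * Gamma r / 4" .
  have "continuous_on {t0 - \<delta>..t0} f"
    by (rule continuous_on_subset[OF cont]) (use d2 t0p in auto)
  then obtain t1 where t1: "t1 \<in> {t0 - \<delta>..t0}" "\<And>s. s \<in> {t0 - \<delta>..t0} \<Longrightarrow> f s \<le> f t1"
    using continuous_attains_sup[of "{t0 - \<delta>..t0}" f] dp by auto
  have "f (t0 - \<delta>) > 0" using d2 dp t0p by (intro fpos) auto
  then have ft1: "f t1 > 0" using t1(2)[of "t0 - \<delta>"] dp by auto
  then have t1l: "t1 < t0" using t1(1) ft0 by (cases "t1 = t0") auto
  have t1p: "t1 > 0" "t0 \<le> 2 * t1" using t1(1) d2 t0p by auto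
  define q where "q = (t0 / t1) powr (1 - r)"
  have qp: "q > 0" using t0p t1p by (simp add: q_def)
  have "q \<le> 2 powr (1 - r)"
    unfolding q_def using t1p t0p r by (intro powr_mono2) (auto simp: field_simps)
  also have "\<dots> \<le> 2 powr 1" using r by (intro powr_mono) auto
  finally have q2: "q \<le> 2" by simp
  \<comment> \<open>The quotient \<open>(t0 - s) / (t1 - s)\<close> increases with s, so it is at
    least its value t0 / t1 at s = 0.\<close>
  have kern: "q * (t0 - s) powr (r - 1) \<le> (t1 - s) powr (r - 1)" if s: "0 < s" "s < t1" for s
  proof -
    have "q \<le> ((t0 - s) / (t1 - s)) powr (1 - r)"
      unfolding q_def
    proof (rule powr_mono2)
      show "t0 / t1 \<le> (t0 - s) / (t1 - s)"
        using s t1p t1l mult_right_mono[of t1 t0 s] by (simp add: field_simps)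
    qed (use r t1p t0p in auto)
    also have "\<dots> = (t0 - s) powr (1 - r) / (t1 - s) powr (1 - r)"
      using s t1l by (simp add: powr_divide)
    finally have "q * (t0 - s) powr (r - 1) \<le>
       (t0 - s) powr (1 - r) / (t1 - s) powr (1 - r) * (t0 - s) powr (r - 1)"
      by (intro mult_right_mono) auto
    also have "\<dots> = ((t0 - s) powr (1 - r) * (t0 - s) powr (r - 1)) * (1 / (t1 - s) powr (1 - r))"
      by simp
    also have "(t0 - s) powr (1 - r) * (t0 - s) powr (r - 1) = 1"
      using s t1l by (simp flip: powr_add)
    also have "1 / (t1 - s) powr (1 - r) = (t1 - s) powr (r - 1)"
      using powr_minus_divide[of "t1 - s" "1 - r"] by simp
    finally show ?thesis by simp
  qed
  let ?F0 = "\<lambda>s. indicator {0<..<t0} s * ((t0 - s) powr (r - 1) * f s)"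
  let ?F1 = "\<lambda>s. indicator {0<..<t1} s * ((t1 - s) powr (r - 1) * f s)"
  let ?J = "\<lambda>s. indicator {0<..<t1} s * ((t0 - s) powr (r - 1) * f s)"
  let ?K = "\<lambda>s. indicator {t1<..<t0} s * ((t0 - s) powr (r - 1) * f s)"
  have F0: "integrable lborel ?F0" and F1: "integrable lborel ?F1"
    using int t0p t1p by auto
  have Jeq: "?J = (\<lambda>s. indicator {0<..<t1} s *\<^sub>R ?F0 s)"
    using t1l by (auto simp: fun_eq_iff indicator_def)
  have Keq: "?K = (\<lambda>s. indicator {t1<..<t0} s *\<^sub>R ?F0 s)"
    using t1p by (auto simp: fun_eq_iff indicator_def)
  have J: "integrable lborel ?J" unfolding Jeq by (rule integrable_mult_indicator[OF _ F0]) auto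
  have K: "integrable lborel ?K" unfolding Keq by (rule integrable_mult_indicator[OF _ F0]) auto
  have "integral\<^sup>L lborel ?F0 = (LINT s|lborel. ?J s + ?K s)"
  proof (rule integral_cong_AE)
    show "AE s in lborel. ?F0 s = ?J s + ?K s"
      using AE_lborel_singleton[of t1] by eventually_elim (use t1l t1p in \<open>auto simp: indicator_def\<close>)
  qed (use F0 J K in auto)
  then have split: "integral\<^sup>L lborel ?F0 = integral\<^sup>L lborel ?J + integral\<^sup>L lborel ?K"
    using J K by simp
  have JF: "q * integral\<^sup>L lborel ?J \<le> integral\<^sup>L lborel ?F1"
  proof -
    have "(LINT s|lborel. q * ?J s) \<le> integral\<^sup>L lborel ?F1"
    proof (rule integral_mono)
      fix s show "q * ?J s \<le> ?F1 s"
      proof (cases "s \<in> {0<..<t1}")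
        case True
        then have "q * (t0 - s) powr (r - 1) * f s \<le> (t1 - s) powr (r - 1) * f s"
          using kern[of s] fpos[of s] t1l by (intro mult_right_mono) auto
        then show ?thesis using True by (simp add: mult_ac)
      qed auto
    qed (use J F1 in auto)
    then show ?thesis by simp
  qed
  have KF: "integral\<^sup>L lborel ?K \<le> f t1 * (t0 - t1) powr r / r"
    using t1 t1l t1p r by (intro kernel_integral_le K) auto
  also have "\<dots> \<le> f t1 * (r * Gamma r / 4) / r"
  proof -
    have "(t0 - t1) powr r \<le> \<delta> powr r" using t1 t1l r by (intro powr_mono2) auto
    then show ?thesis using dr ft1 r by (intro divide_right_mono mult_left_mono) auto
  qed
  finally have KF: "integral\<^sup>L lborel ?K \<le> f t1 * Gamma r / 4" using r by simp
  \<comment> \<open>The same factor q as for the kernel: the hypothesis on p is scaled so that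
    forcing term and integral term are compared with one constant.\<close>
  have pq: "p t1 \<le> q * p t0"
    using p[OF t1p(1) t1l fpos] t1p t0p by (simp add: q_def powr_divide field_simps)
  have "f t1 = p t1 - integral\<^sup>L lborel ?F1 / Gamma r" using eq t1p by blast
  also have "\<dots> \<le> q * p t0 - (q * integral\<^sup>L lborel ?J) / Gamma r"
    using pq JF Gr by (intro diff_mono divide_right_mono) auto
  \<comment> \<open>The integral equation at t0 absorbs \<open>p t0\<close> and the integral up to
    t1; what remains is f t0, which is not positive, and the short integral.\<close>
  also have "\<dots> = q * (f t0 + integral\<^sup>L lborel ?K / Gamma r)"
    using eq[OF t0p] unfolding split by (simp add: right_diff_distrib distrib_left add_divide_distrib)
  also have "\<dots> \<le> q * (f t1 / 4)"
  proof (rule mult_left_mono)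
    have "integral\<^sup>L lborel ?K / Gamma r \<le> f t1 / 4" using KF Gr by (simp add: field_simps)
    then show "f t0 + integral\<^sup>L lborel ?K / Gamma r \<le> f t1 / 4" using ft0 by simp
  qed (use qp in auto)
  also have "\<dots> \<le> 2 * (f t1 / 4)" using q2 ft1 by (intro mult_right_mono) auto
  finally show False using ft1 by simp
qed


section \<open>Mittag-Leffler functions as entire power series\<close>

lemma entire_coeffs_power:
  assumes "0 < r" "r < 1"
  shows "entire_coeffs r (\<lambda>k. x ^ k)"
  using summable_power_over_Gamma[OF assms]
  by (auto simp: entire_coeffs_def power_abs simp flip: power_mult_distrib)

lemma entire_coeffs_Suc_times_power:
  assumes r: "0 < r" "r < 1"
  shows "entire_coeffs r (\<lambda>k. real (Suc k) * x ^ k)"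
  unfolding entire_coeffs_def
proof safe
  fix b z :: real assume b: "b > 0"
  have G: "Gamma (r * real k + b) > 0" for k using r b by (auto intro!: Gamma_real_pos simp: add_nonneg_pos)
  show "summable (\<lambda>k. \<bar>real (Suc k) * x ^ k\<bar> * z ^ k / Gamma (r * real k + b))"
  proof (rule summable_comparison_test')
    show "summable (\<lambda>k. (2 * (\<bar>x\<bar> * \<bar>z\<bar>)) ^ k / Gamma (r * real k + b))"
      by (rule summable_power_over_Gamma[OF r b])
    fix k :: nat
    have "real (Suc k) \<le> 2 ^ k" using less_exp[of k] by (metis Suc_leI of_nat_le_iff of_nat_numeral of_nat_power)
    then have "real (Suc k) * (\<bar>x\<bar> ^ k * \<bar>z\<bar> ^ k) / Gamma (r * real k + b)
        \<le> 2 ^ k * (\<bar>x\<bar> ^ k * \<bar>z\<bar> ^ k) / Gamma (r * real k + b)"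
      using G[of k] by (intro divide_right_mono mult_right_mono) auto
    then show "norm (\<bar>real (Suc k) * x ^ k\<bar> * z ^ k / Gamma (r * real k + b))
        \<le> (2 * (\<bar>x\<bar> * \<bar>z\<bar>)) ^ k / Gamma (r * real k + b)"
      using G[of k] by (simp add: abs_mult power_abs power_mult_distrib mult_ac del: of_nat_Suc)
  qed
qed

lemma frac_series_split_head:
  assumes "t > 0" "entire_coeffs r c" "b > 0" "r > 0"
  shows "frac_series r c b t = c 0 * t powr (b - 1) / Gamma b + frac_series r (\<lambda>k. c (Suc k)) (b + r) t"
  using suminf_split_head[OF summable_frac_series[OF assms]]
  by (simp add: frac_series_def algebra_simps)

text \<open>The two-parameter function E_{r,b}. The value b = 1 gives E_r, and b = r belongs both to
  the resolvent kernel and to the derivative of E_r.\<close>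

definition mittag_leffler2 :: "real \<Rightarrow> real \<Rightarrow> real \<Rightarrow> real" where
  "mittag_leffler2 r b z = (\<Sum>k. z ^ k / Gamma (r * real k + b))"

lemma mittag_leffler2_1: "mittag_leffler2 r 1 = mittag_leffler r"
  by (simp add: mittag_leffler2_def mittag_leffler_def fun_eq_iff)

lemma mittag_leffler2_0: "mittag_leffler2 r b 0 = 1 / Gamma b"
  unfolding mittag_leffler2_def using powser_zero[of "\<lambda>k. 1 / Gamma (r * real k + b)"] by simp

lemma frac_series_power_eq:
  assumes "t > 0" "b > 0" "0 < r" "r < 1"
  shows "frac_series r (\<lambda>k. x ^ k) b t = t powr (b - 1) * mittag_leffler2 r b (x * t powr r)"
  using frac_series_eq_power_series[OF assms(1) entire_coeffs_power[OF assms(3,4), of x] assms(2,3)]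
  by (simp add: mittag_leffler2_def power_mult_distrib)

lemma mittag_leffler2_has_real_derivative:
  assumes "b > 0" "0 < r" "r < 1"
  shows "(mittag_leffler2 r b has_real_derivative
     (\<Sum>k. real (Suc k) / Gamma (r * real k + (r + b)) * z ^ k)) (at z)"
proof -
  have "((\<lambda>z. \<Sum>k. 1 / Gamma (r * real k + b) * z ^ k) has_real_derivative
     (\<Sum>k. diffs (\<lambda>k. 1 / Gamma (r * real k + b)) k * z ^ k)) (at z)"
    using summable_power_over_Gamma[OF assms(2,3,1)]
    by (intro termdiffs_strong_converges_everywhere) simp
  then show ?thesis
    by (simp add: mittag_leffler2_def[abs_def] diffs_def algebra_simps)
qed

lemma continuous_on_mittag_leffler2:
  assumes "b > 0" "0 < r" "r < 1"
  shows "continuous_on S (mittag_leffler2 r b)"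
  using mittag_leffler2_has_real_derivative[OF assms] DERIV_isCont
  by (intro continuous_at_imp_continuous_on) blast

text \<open>Since \<open>Gamma (r * (k + 1) + 1) = r * (k + 1) * Gamma (r * (k + 1))\<close>, the
  factor k + 1 from termwise differentiation cancels. Positivity of E_{r,r} thus becomes
  monotonicity of E_r.\<close>

lemma mittag_leffler_has_real_derivative:
  assumes r: "0 < r" "r < 1"
  shows "(mittag_leffler r has_real_derivative mittag_leffler2 r r z / r) (at z)"
proof -
  have *: "real (Suc k) / Gamma (r * real k + (r + 1)) * z ^ k = z ^ k / Gamma (r * real k + r) / r" for k
  proof -
    have p: "r * real k + r > 0" using r by (simp add: add_nonneg_pos)
    then have "Gamma (r * real k + r + 1) = (r * real k + r) * Gamma (r * real k + r)"
      using Gamma_plus1[of "r * real k + r"] nonpos_Ints_nonpos[of "r * real k + r"] by force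
    moreover have "r * real k + r = r * real (Suc k)" by (simp add: algebra_simps)
    ultimately have "Gamma (r * real k + (r + 1)) = r * real (Suc k) * Gamma (r * real k + r)"
      by (metis add.assoc)
    then show ?thesis using r by (simp del: of_nat_Suc)
  qed
  have "(\<Sum>k. z ^ k / Gamma (r * real k + r) / r) = mittag_leffler2 r r z / r"
    unfolding mittag_leffler2_def
    using suminf_divide[OF summable_power_over_Gamma[OF r r(1), of z], of r] by simp
  with mittag_leffler2_has_real_derivative[of 1 r z] r show ?thesis
    unfolding * mittag_leffler2_1 by simp
qed

lemma frac_series_continuous_on:
  assumes "entire_coeffs r c" "b > 0" "r > 0"
  shows "continuous_on {0<..} (frac_series r c b)"
proof -
  have "continuous_on UNIV (\<lambda>z. \<Sum>k. c k / Gamma (r * real k + b) * z ^ k)"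
    using termdiffs_strong_converges_everywhere[OF entire_coeffs_summable[OF assms]] DERIV_isCont
    by (intro continuous_at_imp_continuous_on) blast
  moreover have "continuous_on {0<..} (\<lambda>t::real. t powr r)" by (auto intro!: continuous_intros)
  ultimately have "continuous_on {0<..} (\<lambda>t. \<Sum>k. c k / Gamma (r * real k + b) * (t powr r) ^ k)"
    by (rule continuous_on_compose2) auto
  then have "continuous_on {0<..} (\<lambda>t. t powr (b - 1) * (\<Sum>k. c k / Gamma (r * real k + b) * (t powr r) ^ k))"
    by (intro continuous_on_mult) (auto intro!: continuous_intros)
  then show ?thesis
    by (rule continuous_on_eq) (use frac_series_eq_power_series[OF _ assms] in auto)
qed

text \<open>Factoring out \<open>t powr (b - 1)\<close>, which may be unbounded at 0, leaves a power
  series in t^r that is continuous with value \<open>c 0 / Gamma b\<close> at 0. This keeps the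
  first zero in the comparison argument away from the origin.\<close>

lemma frac_series_eventually_pos:
  assumes "entire_coeffs r c" "b > 0" "r > 0" "c 0 > 0"
  shows "eventually (\<lambda>t. frac_series r c b t > 0) (at_right 0)"
proof -
  let ?P = "\<lambda>z. \<Sum>k. c k / Gamma (r * real k + b) * z ^ k"
  have "isCont ?P 0"
    using termdiffs_strong_converges_everywhere[OF entire_coeffs_summable[OF assms(1-3)]] DERIV_isCont by blast
  then have "(?P \<longlongrightarrow> ?P 0) (nhds 0)" by (simp add: isCont_def tendsto_nhds_iff)
  moreover have "((\<lambda>t. t powr r) \<longlongrightarrow> 0) (at_right 0)"
    using assms(3) by real_asymp
  ultimately have "((\<lambda>t. ?P (t powr r)) \<longlongrightarrow> ?P 0) (at_right 0)"
    by (rule filterlim_compose)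
  moreover have "?P 0 > 0"
    using assms Gamma_real_pos[of b] powser_zero[of "\<lambda>k. c k / Gamma (r * real k + b)"] by simp
  ultimately have "eventually (\<lambda>t. ?P (t powr r) > 0) (at_right 0)"
    by (rule order_tendstoD)
  moreover have "eventually (\<lambda>t::real. t > 0) (at_right 0)" by (rule eventually_at_right_less)
  ultimately show ?thesis
    by eventually_elim (use assms frac_series_eq_power_series in auto)
qed

section \<open>Positivity, monotonicity and decay on the negative half-line\<close>

context
  fixes r :: real
  assumes r: "0 < r" "r < 1"
begin

text \<open>\<open>alt\<close> belongs to the parameter -1, and \<open>alt'\<close> at
  \<open>b = 2 * r\<close> to the derivative with respect to that parameter of the series with b =
  r. No generality is lost: the argument - z is reached at
  \<open>t = z powr (1 / r)\<close>.\<close>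

private abbreviation (input) "alt \<equiv> \<lambda>k. (- 1 :: real) ^ k"
private abbreviation (input) "alt' \<equiv> \<lambda>k. real (Suc k) * (- 1 :: real) ^ k"

private lemma alt: "entire_coeffs r alt" and alt': "entire_coeffs r alt'"
  using entire_coeffs_power[OF r] entire_coeffs_Suc_times_power[OF r] by auto

private lemma frac_series_alt_uminus:
  assumes "t > 0" "b > 0"
  shows "frac_series r (\<lambda>k. - alt k) b t = - frac_series r alt b t"
  unfolding frac_series_def using suminf_minus[OF summable_frac_series[OF assms(1) alt assms(2) r(1)]]
  by simp

private lemma frac_series_alt_rec:
  assumes "t > 0" "b > 0"
  shows "frac_series r alt b t = t powr (b - 1) / Gamma b - frac_series r alt (b + r) t"
  using frac_series_split_head[OF assms(1) alt assms(2) r(1)]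
    frac_series_alt_uminus[of t "b + r"] assms r by simp

text \<open>The parameter derivative of the preceding recursion, read off from k + 2 = 1 + (k + 1).
  At \<open>b = 2 * r\<close> it is a Volterra equation whose forcing term is the undifferentiated
  series.\<close>

private lemma frac_series_alt'_rec:
  assumes "t > 0" "b > 0"
  shows "frac_series r alt' b t = frac_series r alt b t - frac_series r alt' (b + r) t"
proof -
  have br: "b + r > 0" using assms r by simp
  note s = summable_frac_series[OF assms(1) alt br r(1)] summable_frac_series[OF assms(1) alt' br r(1)]
  have "frac_series r (\<lambda>k. alt' (Suc k)) (b + r) t =
      - (frac_series r alt (b + r) t + frac_series r alt' (b + r) t)"
    unfolding frac_series_def suminf_add[OF s] suminf_minus[OF summable_add[OF s], symmetric]
    by (intro arg_cong[where f=suminf] ext) (simp add: algebra_simps add_divide_distrib diff_divide_distrib)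
  then show ?thesis
    using frac_series_split_head[OF assms(1) alt' assms(2) r(1)] frac_series_alt_rec[OF assms] by simp
qed

text \<open>The forcing term is \<open>t powr (r - 1) / Gamma r\<close>, for which
  \<open>t powr (1 - r) * p t\<close> is constant; the comparison applies with equality in its
  hypothesis on p.\<close>

private lemma frac_series_alt_pos:
  assumes "t > 0"
  shows "frac_series r alt r t > 0"
proof (rule Volterra_solution_positive[where r=r and f="frac_series r alt r" and p="\<lambda>t. t powr (r - 1) / Gamma r"])
  show "continuous_on {0<..} (frac_series r alt r)"
    by (rule frac_series_continuous_on[OF alt r(1) r(1)])
  show "eventually (\<lambda>t. frac_series r alt r t > 0) (at_right 0)"
    by (rule frac_series_eventually_pos[OF alt r(1) r(1)]) simp
  have hb: "has_bochner_integral lborel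
    (\<lambda>s. indicator {0<..<t} s * ((t - s) powr (r - 1) * frac_series r alt r s))
    (Gamma r * frac_series r alt (r + r) t)" if "t > 0" for t
    using has_bochner_integral_frac_series[OF r(1) alt r(1) r(1) that] .
  show "integrable lborel (\<lambda>s. indicator {0<..<t} s * ((t - s) powr (r - 1) * frac_series r alt r s))"
    if "t > 0" for t using hb[OF that] by (simp add: has_bochner_integral_iff)
  show "frac_series r alt r t = t powr (r - 1) / Gamma r -
      (LINT s|lborel. indicator {0<..<t} s * ((t - s) powr (r - 1) * frac_series r alt r s)) / Gamma r"
    if "t > 0" for t
    using hb[OF that] frac_series_alt_rec[OF that r(1)] Gamma_real_pos[OF r(1)]
    by (simp add: has_bochner_integral_iff)
  show "t1 powr (1 - r) * (t1 powr (r - 1) / Gamma r) \<le> t0 powr (1 - r) * (t0 powr (r - 1) / Gamma r)"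
    if "0 < t1" "t1 < t0" for t0 t1
    using that by (simp flip: powr_add)
qed (use r assms in auto)

lemma mittag_leffler2_neg_pos:
  assumes "z \<ge> 0"
  shows "mittag_leffler2 r r (- z) > 0"
proof (cases "z = 0")
  case True
  then show ?thesis using Gamma_real_pos[OF r(1)] by (simp add: mittag_leffler2_0)
next
  case False
  then have z: "z > 0" using assms by simp
  define t where "t = z powr (1 / r)"
  have t: "t > 0" "t powr r = z" using z r by (auto simp: t_def powr_powr)
  show ?thesis
    using frac_series_alt_pos[OF t(1)] frac_series_power_eq[OF t(1) r(1) r, of "-1"] t
    by (simp add: zero_less_mult_iff)
qed

text \<open>Up to a positive power of t, the \<open>alt'\<close> series at \<open>2 * r\<close> is
  minus the derivative of E_{r,r}(- z), so its sign decides monotonicity.\<close>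

private lemma mittag_leffler2_neg_deriv:
  assumes "z > 0"
  shows "((\<lambda>z. mittag_leffler2 r r (- z)) has_real_derivative
     - ((z powr (1/r)) powr (1 - 2 * r) * frac_series r alt' (2 * r) (z powr (1/r)))) (at z)"
proof -
  define t where "t = z powr (1 / r)"
  have t: "t > 0" "t powr r = z" using assms r by (auto simp: t_def powr_powr)
  have "frac_series r alt' (2 * r) t =
      t powr (2 * r - 1) * (\<Sum>k. real (Suc k) * (-1) ^ k / Gamma (r * real k + 2 * r) * z ^ k)"
    using frac_series_eq_power_series[OF t(1) alt', of "2 * r"] r t by simp
  moreover have "t powr (1 - 2 * r) * t powr (2 * r - 1) = 1" using t by (simp flip: powr_add)
  ultimately have "t powr (1 - 2 * r) * frac_series r alt' (2 * r) t =
      (\<Sum>k. real (Suc k) * (-1) ^ k / Gamma (r * real k + 2 * r) * z ^ k)"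
    by (simp add: mult.assoc[symmetric])
  also have "\<dots> = (\<Sum>k. real (Suc k) / Gamma (r * real k + (r + r)) * (- z) ^ k)"
    by (intro arg_cong[where f=suminf] ext) (simp add: power_minus[of z])
  finally have eq: "t powr (1 - 2 * r) * frac_series r alt' (2 * r) t =
      (\<Sum>k. real (Suc k) / Gamma (r * real k + (r + r)) * (- z) ^ k)" .
  show ?thesis
    unfolding t_def[symmetric] eq
    using DERIV_chain'[OF DERIV_minus[OF DERIV_ident] mittag_leffler2_has_real_derivative[OF r(1) r, of "- z"]]
    by simp
qed

text \<open>Positivity is assumed only up to t0, because this is applied inside the comparison
  argument, before positivity is known everywhere.\<close>

private lemma mittag_leffler2_neg_antimono_aux:
  assumes h: "\<And>s. 0 < s \<Longrightarrow> s < t0 \<Longrightarrow> frac_series r alt' (2 * r) s > 0"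
    and t: "0 < t1" "t1 < t0"
  shows "mittag_leffler2 r r (- (t0 powr r)) \<le> mittag_leffler2 r r (- (t1 powr r))"
proof -
  have lt: "t1 powr r < t0 powr r" using t r by (intro powr_less_mono2) auto
  show ?thesis
  proof (rule DERIV_nonpos_imp_decreasing_open[OF less_imp_le[OF lt]])
    show "continuous_on {t1 powr r..t0 powr r} (\<lambda>z. mittag_leffler2 r r (- z))"
      by (intro continuous_on_compose2[OF continuous_on_mittag_leffler2[OF r(1) r, of UNIV]] continuous_intros) auto
    fix z assume z: "t1 powr r < z" "z < t0 powr r"
    have zp: "z > 0" using z(1) t by (metis less_trans powr_gt_zero less_irrefl)
    have "z powr (1/r) < (t0 powr r) powr (1/r)" using z zp r by (intro powr_less_mono2) auto
    then have "z powr (1/r) < t0" using r t by (simp add: powr_powr)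
    then have "frac_series r alt' (2 * r) (z powr (1/r)) > 0" using zp by (intro h) auto
    then show "\<exists>y. ((\<lambda>z. mittag_leffler2 r r (- z)) has_real_derivative y) (at z) \<and> y \<le> 0"
      using mittag_leffler2_neg_deriv[OF zp] by (intro exI conjI) auto
  qed
qed

private lemma frac_series_alt_2r:
  assumes "t > 0"
  shows "frac_series r alt (r + r) t = t powr (r - 1) * (1 / Gamma r - mittag_leffler2 r r (- (t powr r)))"
  using frac_series_alt_rec[OF assms r(1)] frac_series_power_eq[OF assms r(1) r, of "-1"]
  by (simp add: algebra_simps)

text \<open>The conditional hypothesis on p closes the circle: positivity up to t0 makes E_{r,r}(-
  t^r) decrease up to t0, and therefore \<open>t powr (1 - r) * p t\<close>, which is
  \<open>1 / Gamma r\<close> minus that value, increases there.\<close>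

private lemma frac_series_alt'_pos:
  assumes "t > 0"
  shows "frac_series r alt' (2 * r) t > 0"
proof (rule Volterra_solution_positive[where r=r and f="frac_series r alt' (2 * r)" and p="frac_series r alt (r + r)"])
  have r2: "2 * r > 0" using r by simp
  show "continuous_on {0<..} (frac_series r alt' (2 * r))"
    by (rule frac_series_continuous_on[OF alt' r2 r(1)])
  show "eventually (\<lambda>t. frac_series r alt' (2 * r) t > 0) (at_right 0)"
    by (rule frac_series_eventually_pos[OF alt' r2 r(1)]) simp
  have hb: "has_bochner_integral lborel
    (\<lambda>s. indicator {0<..<t} s * ((t - s) powr (r - 1) * frac_series r alt' (2 * r) s))
    (Gamma r * frac_series r alt' (2 * r + r) t)" if "t > 0" for t
    using has_bochner_integral_frac_series[OF r(1) alt' r2 r(1) that] .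
  show "integrable lborel (\<lambda>s. indicator {0<..<t} s * ((t - s) powr (r - 1) * frac_series r alt' (2 * r) s))"
    if "t > 0" for t using hb[OF that] by (simp add: has_bochner_integral_iff)
  show "frac_series r alt' (2 * r) t = frac_series r alt (r + r) t -
      (LINT s|lborel. indicator {0<..<t} s * ((t - s) powr (r - 1) * frac_series r alt' (2 * r) s)) / Gamma r"
    if "t > 0" for t
  proof -
    have "frac_series r alt' (2 * r) t = frac_series r alt (r + r) t - frac_series r alt' (2 * r + r) t"
      using frac_series_alt'_rec[OF that r2] by (simp only: mult_2)
    moreover have "Gamma r * frac_series r alt' (2 * r + r) t / Gamma r = frac_series r alt' (2 * r + r) t"
      using r by simp
    ultimately show ?thesis unfolding has_bochner_integral_integral_eq[OF hb[OF that]] by (simp only:)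
  qed
  show "t1 powr (1 - r) * frac_series r alt (r + r) t1 \<le> t0 powr (1 - r) * frac_series r alt (r + r) t0"
    if "0 < t1" "t1 < t0" "\<And>s. 0 < s \<Longrightarrow> s < t0 \<Longrightarrow> frac_series r alt' (2 * r) s > 0" for t0 t1
  proof -
    have "t powr (1 - r) * frac_series r alt (r + r) t = 1 / Gamma r - mittag_leffler2 r r (- (t powr r))"
      if "t > 0" for t
    proof -
      have "t powr (1 - r) * t powr (r - 1) = 1" using that by (simp flip: powr_add)
      then show ?thesis unfolding frac_series_alt_2r[OF that] mult.assoc[symmetric] by simp
    qed
    moreover have "t0 > 0" using that(1,2) by simp
    ultimately show ?thesis using mittag_leffler2_neg_antimono_aux[OF that(3,1,2)] that(1)
      by (simp only: diff_left_mono)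
  qed
qed (use r assms in auto)

lemma mittag_leffler2_neg_antimono:
  assumes "0 < x" "x \<le> y"
  shows "mittag_leffler2 r r (- y) \<le> mittag_leffler2 r r (- x)"
proof (cases "x = y")
  case False
  then have "x powr (1/r) < y powr (1/r)" using assms r by (intro powr_less_mono2) auto
  then have "mittag_leffler2 r r (- ((y powr (1/r)) powr r)) \<le> mittag_leffler2 r r (- ((x powr (1/r)) powr r))"
    using assms frac_series_alt'_pos by (intro mittag_leffler2_neg_antimono_aux) auto
  then show ?thesis using assms r by (simp add: powr_powr)
qed simp

lemma has_bochner_integral_mittag_leffler2:
  assumes t: "t > 0" and b: "b > 0" and d: "d > 0"
  shows "has_bochner_integral lborel
    (\<lambda>s. indicator {0<..<t} s * ((t - s) powr (d - 1) * (s powr (b - 1) * mittag_leffler2 r b (x * s powr r))))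
    (Gamma d * (t powr (b + d - 1) * mittag_leffler2 r (b + d) (x * t powr r)))"
proof -
  have "indicator {0<..<t} s * ((t - s) powr (d - 1) * (s powr (b - 1) * mittag_leffler2 r b (x * s powr r)))
     = indicator {0<..<t} s * ((t - s) powr (d - 1) * frac_series r (\<lambda>k. x ^ k) b s)" for s
    using frac_series_power_eq[OF _ b r, of s x] by (auto simp: indicator_def)
  moreover have "frac_series r (\<lambda>k. x ^ k) (b + d) t = t powr (b + d - 1) * mittag_leffler2 r (b + d) (x * t powr r)"
    using b d by (intro frac_series_power_eq t r) auto
  ultimately show ?thesis
    using has_bochner_integral_frac_series[OF r(1) entire_coeffs_power[OF r, of x] b d t]
    by (simp only:)
qed

text \<open>The exponents r and 1 - r add up to 1: the fractional integral of order 1 - r of the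
  resolvent kernel is E_r itself. This yields the sign of E_r and, with x = - A(\<xi>), the Caputo
  derivative of the solution.\<close>

lemma has_bochner_integral_mittag_leffler:
  assumes t: "t > 0"
  shows "has_bochner_integral lborel
    (\<lambda>s. indicator {0<..<t} s * ((t - s) powr (- r) * (s powr (r - 1) * mittag_leffler2 r r (x * s powr r))))
    (Gamma (1 - r) * mittag_leffler r (x * t powr r))"
  using has_bochner_integral_mittag_leffler2[OF t r(1), of "1 - r" x] r t by (simp add: mittag_leffler2_1)

lemma mittag_leffler_neg_nonneg:
  assumes "z \<ge> 0"
  shows "mittag_leffler r (- z) \<ge> 0"
proof -
  have hb: "has_bochner_integral lborel
    (\<lambda>s. indicator {0<..<1} s * ((1 - s) powr (- r) * (s powr (r - 1) * mittag_leffler2 r r (- z * s powr r))))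
    (Gamma (1 - r) * mittag_leffler r (- z))"
    using has_bochner_integral_mittag_leffler[of 1 "- z"] by simp
  have "0 \<le> Gamma (1 - r) * mittag_leffler r (- z)"
    unfolding has_bochner_integral_integral_eq[OF hb, symmetric]
  proof (rule Bochner_Integration.integral_nonneg)
    fix s :: real
    show "0 \<le> indicator {0<..<1} s * ((1 - s) powr (- r) * (s powr (r - 1) * mittag_leffler2 r r (- z * s powr r)))"
      using assms mittag_leffler2_neg_pos[of "z * s powr r"]
      by (intro mult_nonneg_nonneg) (auto intro: less_imp_le)
  qed
  moreover have "Gamma (1 - r) > 0" using r by (auto intro: Gamma_real_pos)
  ultimately show ?thesis by (simp add: zero_le_mult_iff)
qed

lemma mittag_leffler_neg_antimono:
  assumes "0 \<le> x" "x \<le> y"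
  shows "mittag_leffler r (- y) \<le> mittag_leffler r (- x)"
proof (rule DERIV_nonpos_imp_nonincreasing[OF assms(2)])
  fix z assume "x \<le> z"
  then have "mittag_leffler2 r r (- z) > 0" using assms by (intro mittag_leffler2_neg_pos) auto
  moreover have "((\<lambda>z. mittag_leffler r (- z)) has_real_derivative - (mittag_leffler2 r r (- z) / r)) (at z)"
    using DERIV_chain'[OF DERIV_minus[OF DERIV_ident] mittag_leffler_has_real_derivative[OF r, of "- z"]]
    by simp
  ultimately show "\<exists>y. ((\<lambda>z. mittag_leffler r (- z)) has_real_derivative y) (at z) \<and> y \<le> 0"
    using r by (intro exI conjI) auto
qed

lemma mittag_leffler_0: "mittag_leffler r 0 = 1"
  using mittag_leffler2_0[of r 1] by (simp add: mittag_leffler2_1)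

lemma mittag_leffler_neg_le_1:
  assumes "z \<ge> 0"
  shows "mittag_leffler r (- z) \<le> 1"
  using mittag_leffler_neg_antimono[of 0 z] assms mittag_leffler_0 by simp

lemma kernel_integral_ge:
  fixes f :: "real \<Rightarrow> real"
  assumes "integrable lborel (\<lambda>s. indicator {0<..<1} s * ((1 - s) powr (r - 1) * f s))"
    and "\<And>s. 0 < s \<Longrightarrow> s < 1 \<Longrightarrow> M \<le> f s"
  shows "M / r \<le> (LINT s|lborel. indicator {0<..<1} s * ((1 - s) powr (r - 1) * f s))"
  using kernel_integral_le[OF r(1), of 0 1 "\<lambda>s. - f s" "- M"] assms by simp

text \<open>The recursion E_r(- z) = 1 - z E_{r,1+r}(- z) and E_r \<ge> 0 bound z E_{r,1+r}(- z) by
  1. On the other hand Gamma(r) E_{r,1+r}(- z) is the integral of (1 - s)^(r - 1) E_r(- z s^r) over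
  the unit interval, where monotonicity bounds the second factor below by E_r(- z).\<close>

lemma times_mittag_leffler_neg_le:
  assumes z: "z \<ge> 0"
  shows "z * mittag_leffler r (- z) \<le> Gamma (r + 1)"
proof -
  have Gr: "Gamma r > 0" "Gamma (r + 1) = r * Gamma r"
    using r Gamma_real_pos[of r] Gamma_plus1[of r] nonpos_Ints_nonpos[of r] by force+
  have hb: "has_bochner_integral lborel
    (\<lambda>s. indicator {0<..<1} s * ((1 - s) powr (r - 1) * (s powr (1 - 1) * mittag_leffler2 r 1 (- z * s powr r))))
    (Gamma r * (mittag_leffler2 r (1 + r) (- z)))"
    using has_bochner_integral_mittag_leffler2[of 1 1 r "- z"] r by simp
  have "mittag_leffler r (- z) / r \<le> (LINT s|lborel. indicator {0<..<1} s *
      ((1 - s) powr (r - 1) * (s powr (1 - 1) * mittag_leffler2 r 1 (- z * s powr r))))"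
  proof (rule kernel_integral_ge)
    fix s :: real assume s: "0 < s" "s < 1"
    have "s powr r \<le> 1 powr r" using s r by (intro powr_mono2) auto
    then have "z * s powr r \<le> z" using z by (simp add: mult_left_le)
    then show "mittag_leffler r (- z) \<le> s powr (1 - 1) * mittag_leffler2 r 1 (- z * s powr r)"
      using s z mittag_leffler_neg_antimono[of "z * s powr r" z] by (simp add: mittag_leffler2_1)
  qed (use hb in \<open>simp add: has_bochner_integral_iff\<close>)
  then have 1: "mittag_leffler r (- z) / r \<le> Gamma r * mittag_leffler2 r (1 + r) (- z)"
    using hb by (simp add: has_bochner_integral_iff)
  have "mittag_leffler2 r 1 (- z) = 1 - z * mittag_leffler2 r (1 + r) (- z)"
  proof -
    have "summable (\<lambda>k. (- z) ^ k / Gamma (r * real k + (1 + r)))"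
      using r by (intro summable_power_over_Gamma) auto
    from suminf_mult[OF this, of "- z"]
    show ?thesis
      using suminf_split_head[OF summable_power_over_Gamma[OF r, of 1 "- z"]]
      by (simp add: mittag_leffler2_def algebra_simps)
  qed
  then have "z * mittag_leffler2 r (1 + r) (- z) \<le> 1"
    using mittag_leffler_neg_nonneg[OF z] by (simp add: mittag_leffler2_1)
  have "z * (mittag_leffler r (- z) / r) \<le> Gamma r * (z * mittag_leffler2 r (1 + r) (- z))"
    using mult_left_mono[OF 1 z] by (simp add: mult_ac)
  also have "\<dots> \<le> Gamma r * 1" using Gr \<open>_ \<le> 1\<close> by (intro mult_left_mono) auto
  finally show ?thesis using r Gr by (simp add: field_simps)
qed

text \<open>As for E_r, but the integrand has the extra factor \<open>s powr (r - 1)\<close>, which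
  is at least 1 on the unit interval. The case z = 0 is separate since monotonicity of E_{r,r} is
  stated for positive arguments.\<close>

lemma times_mittag_leffler2_neg_le:
  assumes z: "z \<ge> 0"
  shows "z * mittag_leffler2 r r (- z) \<le> r"
proof (cases "z = 0")
  case False
  have Gr: "Gamma r > 0" using r Gamma_real_pos[of r] by simp
  have hb: "has_bochner_integral lborel
    (\<lambda>s. indicator {0<..<1} s * ((1 - s) powr (r - 1) * (s powr (r - 1) * mittag_leffler2 r r (- z * s powr r))))
    (Gamma r * (mittag_leffler2 r (r + r) (- z)))"
    using has_bochner_integral_mittag_leffler2[of 1 r r "- z"] r by simp
  have "mittag_leffler2 r r (- z) / r \<le> (LINT s|lborel. indicator {0<..<1} s *
      ((1 - s) powr (r - 1) * (s powr (r - 1) * mittag_leffler2 r r (- z * s powr r))))"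
  proof (rule kernel_integral_ge)
    fix s :: real assume s: "0 < s" "s < 1"
    have "s powr r \<le> 1 powr r" using s r by (intro powr_mono2) auto
    then have "z * s powr r \<le> z" using z by (simp add: mult_left_le)
    then have 1: "mittag_leffler2 r r (- z) \<le> mittag_leffler2 r r (- (z * s powr r))"
      using s z False by (intro mittag_leffler2_neg_antimono) auto
    have "1 \<le> s powr (r - 1)"
      using s r powr_mono'[of "r - 1" 0 s] by simp
    then have "1 * mittag_leffler2 r r (- (z * s powr r)) \<le> s powr (r - 1) * mittag_leffler2 r r (- (z * s powr r))"
      using mittag_leffler2_neg_pos[of "z * s powr r"] z by (intro mult_right_mono) auto
    with 1 show "mittag_leffler2 r r (- z) \<le> s powr (r - 1) * mittag_leffler2 r r (- z * s powr r)"
      by simp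
  qed (use hb in \<open>simp add: has_bochner_integral_iff\<close>)
  then have 1: "mittag_leffler2 r r (- z) / r \<le> Gamma r * mittag_leffler2 r (r + r) (- z)"
    using hb by (simp add: has_bochner_integral_iff)
  have "mittag_leffler2 r r (- z) = 1 / Gamma r - z * mittag_leffler2 r (r + r) (- z)"
  proof -
    have "summable (\<lambda>k. (- z) ^ k / Gamma (r * real k + (r + r)))"
      using r by (intro summable_power_over_Gamma) auto
    from suminf_mult[OF this, of "- z"]
    show ?thesis
      using suminf_split_head[OF summable_power_over_Gamma[OF r r(1), of "- z"]]
      by (simp add: mittag_leffler2_def algebra_simps)
  qed
  then have "z * mittag_leffler2 r (r + r) (- z) \<le> 1 / Gamma r"
    using mittag_leffler2_neg_pos[OF z] by simp
  then have 2: "Gamma r * (z * mittag_leffler2 r (r + r) (- z)) \<le> 1"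
    using Gr by (simp add: field_simps)
  have "z * (mittag_leffler2 r r (- z) / r) \<le> Gamma r * (z * mittag_leffler2 r (r + r) (- z))"
    using mult_left_mono[OF 1 z] by (simp add: mult_ac)
  with 2 have "z * mittag_leffler2 r r (- z) / r \<le> 1" by simp
  then show ?thesis using r by (simp add: field_simps)
qed (use r in simp)

end

section \<open>Fourier integrals\<close>

text \<open>\<open>lborel\<close> is the image of the product of one-dimensional Lebesgue measures.
  This reduces Gaussians and the weight (1 + |x|^2)^(- \<tau>) to one dimension.\<close>

lemma
  fixes f :: "'a::euclidean_space \<Rightarrow> real \<Rightarrow> 'b::{real_normed_field,banach,second_countable_topology}"
  assumes f: "\<And>b. b \<in> Basis \<Longrightarrow> integrable lborel (f b)"
  shows integrable_lborel_prod_Basis: "integrable lborel (\<lambda>x::'a. \<Prod>b\<in>Basis. f b (x \<bullet> b))"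
    and integral_lborel_prod_Basis:
      "(LINT x|lborel. (\<Prod>b\<in>Basis. f b ((x::'a) \<bullet> b))) = (\<Prod>b\<in>Basis. integral\<^sup>L lborel (f b))"
proof -
  interpret product_sigma_finite "\<lambda>_::'a. lborel :: real measure" by standard
  have [measurable]: "f b \<in> borel_measurable borel" if "b \<in> Basis" for b
    using borel_measurable_integrable[OF f[OF that]] by simp
  have m: "(\<lambda>x::'a. \<Prod>b\<in>Basis. f b (x \<bullet> b)) \<in> borel_measurable borel"
    by (intro borel_measurable_prod) measurable
  have T: "(\<lambda>g. \<Sum>b\<in>Basis. g b *\<^sub>R b) \<in> (\<Pi>\<^sub>M b\<in>Basis. lborel) \<rightarrow>\<^sub>M (borel :: 'a measure)"
    by measurable
  have eq: "(\<Prod>b\<in>Basis. f b ((\<Sum>c\<in>Basis. g c *\<^sub>R c) \<bullet> b)) = (\<Prod>b\<in>Basis. f b (g b))" for g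
    by (intro prod.cong refl) (simp add: inner_sum_left_Basis)
  show "integrable lborel (\<lambda>x::'a. \<Prod>b\<in>Basis. f b (x \<bullet> b))"
    by (subst lborel_eq, subst integrable_distr_eq[OF T m], subst eq)
       (intro product_integrable_prod f finite_Basis)
  show "(LINT x|lborel. (\<Prod>b\<in>Basis. f b ((x::'a) \<bullet> b))) = (\<Prod>b\<in>Basis. integral\<^sup>L lborel (f b))"
    by (subst lborel_eq, subst integral_distr[OF T m], subst eq)
       (intro product_integral_prod f finite_Basis)
qed

lemma integrable_lborel_affine:
  fixes f :: "'a::euclidean_space \<Rightarrow> 'b::{banach, second_countable_topology}"
  assumes f: "integrable lborel f" and c: "c \<noteq> 0"
  shows "integrable lborel (\<lambda>x. f (t + c *\<^sub>R x))"
proof -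
  have [measurable]: "f \<in> borel_measurable borel" using borel_measurable_integrable[OF f] by simp
  have "integrable (density (distr lborel borel (\<lambda>x. t + c *\<^sub>R x)) (\<lambda>_. \<bar>c\<bar> ^ DIM('a))) f"
    using f lborel_affine[OF c, of t] by simp
  then have "integrable lborel (\<lambda>x. \<bar>c\<bar> ^ DIM('a) *\<^sub>R f (t + c *\<^sub>R x))"
    by (simp add: integrable_density integrable_distr_eq)
  from integrable_scaleR_right[OF this, of "inverse (\<bar>c\<bar> ^ DIM('a))"] show ?thesis using c by simp
qed

lemma integral_lborel_affine:
  fixes f :: "'a::euclidean_space \<Rightarrow> 'b::{banach, second_countable_topology}"
  assumes f: "integrable lborel f" and c: "c \<noteq> 0"
  shows "(LINT x|lborel. f x) = \<bar>c\<bar> ^ DIM('a) *\<^sub>R (LINT x|lborel. f (t + c *\<^sub>R x))"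
proof -
  have [measurable]: "f \<in> borel_measurable borel" using borel_measurable_integrable[OF f] by simp
  show ?thesis
    using c by (subst lborel_affine[OF c, of t]) (simp add: integral_density integral_distr)
qed

lemma cis_measurable [measurable]: "cis \<in> borel_measurable borel"
  by (intro borel_measurable_continuous_onI continuous_intros)

lemma integrable_mult_bounded:
  fixes f g :: "'a \<Rightarrow> 'b::{real_normed_field, banach, second_countable_topology}"
  assumes "integrable M f" "g \<in> borel_measurable M" "\<And>x. norm (g x) \<le> C"
  shows "integrable M (\<lambda>x. f x * g x)"
proof (rule Bochner_Integration.integrable_bound)
  show "integrable M (\<lambda>x. C * norm (f x))" using assms by auto
  show "(\<lambda>x. f x * g x) \<in> borel_measurable M" using assms by measurable
  show "AE x in M. norm (f x * g x) \<le> norm (C * norm (f x))"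
  proof (rule AE_I2)
    fix x
    have "norm (f x) * norm (g x) \<le> norm (f x) * \<bar>C\<bar>"
      using assms(3)[of x] by (intro mult_left_mono) auto
    then show "norm (f x * g x) \<le> norm (C * norm (f x))" by (simp add: norm_mult abs_mult mult.commute)
  qed
qed

text \<open>The product f(x) h(y) is integrable on the product space, and a bounded kernel does no
  harm. With the kernel cis or a Gaussian this justifies the interchanges in the Fourier
  arguments.\<close>

lemma integrable_pair_bounded_kernel:
  fixes f :: "'a::euclidean_space \<Rightarrow> complex" and h :: "'b::euclidean_space \<Rightarrow> complex"
  assumes f: "integrable lborel f" and h: "integrable lborel h"
    and k: "case_prod k \<in> borel_measurable (borel \<Otimes>\<^sub>M borel)" "\<And>x y. norm (k x y) \<le> C"
  shows "integrable (lborel \<Otimes>\<^sub>M lborel) (\<lambda>(x, y). f x * h y * k x y)"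
proof -
  have [measurable]: "f \<in> borel_measurable borel" "h \<in> borel_measurable borel"
    using f h borel_measurable_integrable by force+
  have "integrable (lborel \<Otimes>\<^sub>M lborel) (\<lambda>p. f (fst p) * h (snd p))"
  proof (rule lborel_pair.Fubini_integrable)
    show "integrable lborel (\<lambda>x. LINT y|lborel. norm (f (fst (x, y)) * h (snd (x, y))))"
      using f by (simp add: norm_mult)
    show "AE x in lborel. integrable lborel (\<lambda>y. f (fst (x, y)) * h (snd (x, y)))"
      using h by simp
  qed measurable
  moreover have "(\<lambda>p. case_prod k p) \<in> borel_measurable (lborel \<Otimes>\<^sub>M lborel)" using k(1) by simp
  ultimately show ?thesis
    using integrable_mult_bounded[of "lborel \<Otimes>\<^sub>M lborel" "\<lambda>p. f (fst p) * h (snd p)" "case_prod k" C] k(2)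
    by (simp add: case_prod_beta')
qed

lemma Fubini_bounded_kernel:
  fixes f :: "'a::euclidean_space \<Rightarrow> complex" and h :: "'b::euclidean_space \<Rightarrow> complex"
  assumes "integrable lborel f" "integrable lborel h"
    and "case_prod k \<in> borel_measurable (borel \<Otimes>\<^sub>M borel)" "\<And>x y. norm (k x y) \<le> C"
  shows "(LINT x|lborel. f x * (LINT y|lborel. h y * k x y)) =
         (LINT y|lborel. h y * (LINT x|lborel. f x * k x y))"
proof -
  have "(LINT y|lborel. LINT x|lborel. f x * h y * k x y) = (LINT x|lborel. LINT y|lborel. f x * h y * k x y)"
    by (rule lborel_pair.Fubini_integral[OF integrable_pair_bounded_kernel[OF assms]])
  moreover have "(LINT x|lborel. f x * h y * k x y) = h y * (LINT x|lborel. f x * k x y)" for y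
    by (simp add: mult_ac flip: integral_mult_right_zero)
  moreover have "(LINT y|lborel. f x * h y * k x y) = f x * (LINT y|lborel. h y * k x y)" for x
    by (simp add: mult_ac flip: integral_mult_right_zero)
  ultimately show ?thesis by simp
qed

text \<open>No constant and a positive sign: the forward transform carries the whole factor (2
  pi)^(- N), so this is the inverse transform as it occurs in the solution formula.\<close>

definition fourier_int :: "('a::euclidean_space \<Rightarrow> complex) \<Rightarrow> 'a \<Rightarrow> complex" where
  "fourier_int f x = (LINT \<xi>|lborel. f \<xi> * cis (x \<bullet> \<xi>))"

lemma integrable_mult_cis:
  fixes f :: "'a::euclidean_space \<Rightarrow> complex"
  assumes "integrable lborel f"
  shows "integrable lborel (\<lambda>\<xi>. f \<xi> * cis (x \<bullet> \<xi>))"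
  using assms by (rule integrable_mult_bounded[where C=1]) auto

lemma norm_fourier_int_le:
  shows "norm (fourier_int f x) \<le> (LINT \<xi>|lborel. norm (f \<xi>))"
  unfolding fourier_int_def
  using integral_norm_bound[of lborel "\<lambda>\<xi>. f \<xi> * cis (x \<bullet> \<xi>)"] by (simp add: norm_mult)

lemma continuous_on_fourier_int:
  fixes f :: "'a::euclidean_space \<Rightarrow> complex"
  assumes f: "integrable lborel f"
  shows "continuous_on UNIV (fourier_int f)"
  unfolding continuous_on_sequentially comp_def
proof safe
  fix X :: "nat \<Rightarrow> 'a" and x assume X: "X \<longlonglongrightarrow> x"
  show "(\<lambda>n. fourier_int f (X n)) \<longlonglongrightarrow> fourier_int f x"
    unfolding fourier_int_def
  proof (rule integral_dominated_convergence[where w="\<lambda>\<xi>. norm (f \<xi>)"])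
    show "AE \<xi> in lborel. (\<lambda>n. f \<xi> * cis (X n \<bullet> \<xi>)) \<longlonglongrightarrow> f \<xi> * cis (x \<bullet> \<xi>)"
      using X by (intro AE_I2 tendsto_intros)
  qed (use f in \<open>auto simp: norm_mult\<close>)
qed

lemma fourier_int_measurable:
  assumes "integrable lborel f"
  shows "fourier_int f \<in> borel_measurable borel"
  using continuous_on_fourier_int[OF assms] by (rule borel_measurable_continuous_onI)

text \<open>Fubini's theorem with a symmetric kernel. Taking h to be a Gaussian turns information
  about the transform of f into information about f.\<close>

lemma fourier_int_multiplication:
  fixes f h :: "'a::euclidean_space \<Rightarrow> complex"
  assumes "integrable lborel f" "integrable lborel h"
  shows "(LINT x|lborel. f x * fourier_int h x) = (LINT x|lborel. h x * fourier_int f x)"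
  unfolding fourier_int_def
  by (subst Fubini_bounded_kernel[OF assms, where C=1]) (auto simp: inner_commute)

section \<open>Gaussians and their transforms\<close>

definition gauss :: "'a::euclidean_space \<Rightarrow> real" where
  "gauss x = exp (- (norm x)\<^sup>2 / 2)"

lemma isCont_gauss: "isCont gauss x"
  unfolding gauss_def by (intro continuous_intros) auto

lemma gauss_measurable [measurable]: "gauss \<in> borel_measurable borel"
  unfolding gauss_def[abs_def] by measurable

lemma gauss_pos: "gauss x > 0" and gauss_le_1: "gauss x \<le> 1" and gauss_minus: "gauss (- x) = gauss x"
  by (auto simp: gauss_def)

lemma gauss_eq_prod: "gauss x = (\<Prod>b\<in>Basis. exp (- (x \<bullet> b)\<^sup>2 / 2))"
proof -
  have "(norm x)\<^sup>2 = (\<Sum>b\<in>Basis. (x \<bullet> b)\<^sup>2)"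
    unfolding power2_norm_eq_inner by (subst euclidean_inner) (simp add: power2_eq_square)
  then show ?thesis
    by (simp add: gauss_def exp_sum[symmetric] sum_negf sum_divide_distrib)
qed

lemma cis_inner_eq_prod: "cis (x \<bullet> y) = (\<Prod>b\<in>Basis. cis ((x \<bullet> b) * (y \<bullet> b)))"
proof -
  have "cis (\<Sum>b\<in>A. g b) = (\<Prod>b\<in>A. cis (g b))" if "finite A" for g :: "'a \<Rightarrow> real" and A
    using that by (induction A) (auto simp flip: cis_mult)
  then show ?thesis by (subst euclidean_inner) simp
qed

text \<open>The value comes from the characteristic function of the standard normal
  distribution.\<close>

lemma has_bochner_integral_gauss_cis_real:
  "has_bochner_integral lborel (\<lambda>x. complex_of_real (exp (- x\<^sup>2 / 2)) * cis (y * x))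
     (complex_of_real (sqrt (2 * pi) * exp (- y\<^sup>2 / 2)))"
proof -
  have i0: "integrable lborel std_normal_density" by (rule integrable_normal_density) simp
  have e: "exp (- x\<^sup>2 / 2) = sqrt (2 * pi) * std_normal_density x" for x
    by (simp add: std_normal_density_def)
  have "integrable lborel (\<lambda>x. complex_of_real (exp (- x\<^sup>2 / 2)))"
    unfolding e using i0 by (intro integrable_of_real integrable_mult_right) auto
  then have i: "integrable lborel (\<lambda>x. complex_of_real (exp (- x\<^sup>2 / 2)) * cis (y * x))"
    by (rule integrable_mult_bounded[where C=1]) auto
  have "complex_of_real (exp (- y\<^sup>2 / 2)) = char std_normal_distribution y"
    by (simp add: char_std_normal_distribution)
  also have "\<dots> = (LINT x|lborel. std_normal_density x *\<^sub>R cis (y * x))"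
    unfolding char_def by (subst integral_density) (auto simp: normal_density_nonneg cis_conv_exp)
  finally have "(LINT x|lborel. sqrt (2 * pi) *\<^sub>R (std_normal_density x *\<^sub>R cis (y * x))) =
      complex_of_real (sqrt (2 * pi)) * complex_of_real (exp (- y\<^sup>2 / 2))"
    by (simp add: scaleR_conv_of_real)
  moreover have "sqrt (2 * pi) *\<^sub>R (std_normal_density x *\<^sub>R cis (y * x)) =
      complex_of_real (exp (- x\<^sup>2 / 2)) * cis (y * x)" for x
    unfolding e by (simp add: scaleR_conv_of_real)
  ultimately show ?thesis using i by (simp add: has_bochner_integral_iff)
qed

text \<open>The unit variance makes the Gaussian an eigenfunction: the integrand factors over the
  basis, and each coordinate contributes sqrt(2 pi).\<close>

lemma
  fixes y :: "'a::euclidean_space"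
  shows integrable_gauss_cis: "integrable lborel (\<lambda>x::'a. complex_of_real (gauss x) * cis (y \<bullet> x))"
    and fourier_int_gauss:
      "fourier_int (\<lambda>x. complex_of_real (gauss x)) y = complex_of_real (sqrt (2 * pi) ^ DIM('a) * gauss y)"
proof -
  have eq: "complex_of_real (gauss x) * cis (y \<bullet> x) =
      (\<Prod>b\<in>Basis. complex_of_real (exp (- (x \<bullet> b)\<^sup>2 / 2)) * cis ((y \<bullet> b) * (x \<bullet> b)))" for x
    by (simp only: gauss_eq_prod cis_inner_eq_prod of_real_prod prod.distrib)
  show "integrable lborel (\<lambda>x::'a. complex_of_real (gauss x) * cis (y \<bullet> x))"
    unfolding eq using has_bochner_integral_gauss_cis_real
    by (intro integrable_lborel_prod_Basis) (auto simp: has_bochner_integral_iff)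
  have "fourier_int (\<lambda>x. complex_of_real (gauss x)) y =
      (\<Prod>b\<in>Basis. complex_of_real (sqrt (2 * pi) * exp (- (y \<bullet> b)\<^sup>2 / 2)))"
    unfolding fourier_int_def eq using has_bochner_integral_gauss_cis_real
    by (subst integral_lborel_prod_Basis) (auto simp: has_bochner_integral_iff)
  then show "fourier_int (\<lambda>x. complex_of_real (gauss x)) y = complex_of_real (sqrt (2 * pi) ^ DIM('a) * gauss y)"
    by (simp add: gauss_eq_prod prod.distrib)
qed

lemma integrable_gauss: "integrable lborel (gauss :: 'a::euclidean_space \<Rightarrow> real)"
  using integrable_Re[OF integrable_gauss_cis[of 0]] by simp

lemma integral_gauss: "(LINT x|lborel. gauss (x::'a::euclidean_space)) = sqrt (2 * pi) ^ DIM('a)"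
proof -
  have "complex_of_real (LINT x|lborel. gauss (x::'a)) = fourier_int (\<lambda>x::'a. complex_of_real (gauss x)) 0"
    unfolding fourier_int_def by simp
  also have "\<dots> = complex_of_real (sqrt (2 * pi) ^ DIM('a))"
    unfolding fourier_int_gauss by (simp add: gauss_def)
  finally show ?thesis by (simp only: of_real_eq_iff)
qed

lemma
  fixes y :: "'a::euclidean_space"
  assumes s: "s > 0"
  shows integrable_gauss_scaled: "integrable lborel (\<lambda>x::'a. gauss (s *\<^sub>R x))"
    and fourier_int_gauss_scaled: "fourier_int (\<lambda>x. complex_of_real (gauss (s *\<^sub>R x))) y =
       complex_of_real ((sqrt (2 * pi) / s) ^ DIM('a) * gauss (y /\<^sub>R s))"
proof -
  show "integrable lborel (\<lambda>x::'a. gauss (s *\<^sub>R x))"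
    using integrable_lborel_affine[OF integrable_gauss, of s 0] s by simp
  have "fourier_int (\<lambda>x. complex_of_real (gauss x)) (y /\<^sub>R s) =
     \<bar>s\<bar> ^ DIM('a) *\<^sub>R (LINT x|lborel. complex_of_real (gauss (0 + s *\<^sub>R x)) * cis ((y /\<^sub>R s) \<bullet> (0 + s *\<^sub>R x)))"
    unfolding fourier_int_def by (rule integral_lborel_affine[OF integrable_gauss_cis]) (use s in auto)
  also have "\<dots> = s ^ DIM('a) *\<^sub>R fourier_int (\<lambda>x. complex_of_real (gauss (s *\<^sub>R x))) y"
    unfolding fourier_int_def using s by (simp add: mult.assoc[symmetric])
  finally show "fourier_int (\<lambda>x. complex_of_real (gauss (s *\<^sub>R x))) y =
       complex_of_real ((sqrt (2 * pi) / s) ^ DIM('a) * gauss (y /\<^sub>R s))"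
    unfolding fourier_int_gauss using s by (simp add: scaleR_conv_of_real power_divide field_simps)
qed

lemma integral_gauss_scaled:
  assumes "s > 0"
  shows "(LINT x|lborel. gauss (s *\<^sub>R (x::'a::euclidean_space))) = (sqrt (2 * pi) / s) ^ DIM('a)"
proof -
  have "complex_of_real (LINT x|lborel. gauss (s *\<^sub>R (x::'a))) = fourier_int (\<lambda>x::'a. complex_of_real (gauss (s *\<^sub>R x))) 0"
    unfolding fourier_int_def by simp
  also have "\<dots> = complex_of_real ((sqrt (2 * pi) / s) ^ DIM('a))"
    unfolding fourier_int_gauss_scaled[OF assms] by (simp add: gauss_def)
  finally show ?thesis by (simp only: of_real_eq_iff)
qed


section \<open>Square integrability of the transform\<close>

lemma nn_integral_lborel_shift:
  fixes f :: "'a::euclidean_space \<Rightarrow> ennreal"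
  assumes [measurable]: "f \<in> borel_measurable borel"
  shows "(\<integral>\<^sup>+x. f (t + x) \<partial>lborel) = (\<integral>\<^sup>+x. f x \<partial>lborel)"
    "(\<integral>\<^sup>+x. f (t - x) \<partial>lborel) = (\<integral>\<^sup>+x. f x \<partial>lborel)"
proof -
  show "(\<integral>\<^sup>+x. f (t + x) \<partial>lborel) = (\<integral>\<^sup>+x. f x \<partial>lborel)"
    by (subst (2) lborel_affine[of 1 t]) (simp_all add: nn_integral_density nn_integral_distr)
  show "(\<integral>\<^sup>+x. f (t - x) \<partial>lborel) = (\<integral>\<^sup>+x. f x \<partial>lborel)"
    by (subst (2) lborel_affine[of "-1" t]) (simp_all add: nn_integral_density nn_integral_distr)
qed

text \<open>A non-integrable function has integral 0 by convention, which makes the bound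
  unconditional.\<close>

lemma integral_norm_bound_ennreal':
  fixes f :: "'a \<Rightarrow> 'b::{banach, second_countable_topology}"
  shows "ennreal (norm (integral\<^sup>L M f)) \<le> (\<integral>\<^sup>+x. norm (f x) \<partial>M)"
  by (cases "integrable M f") (auto simp: integral_norm_bound_ennreal not_integrable_integral_eq)

lemma cnj_fourier_int:
  "cnj (fourier_int f x) = (LINT \<xi>|lborel. cnj (f \<xi>) * cis (- (x \<bullet> \<xi>)))"
  unfolding fourier_int_def by (subst Bochner_Integration.integral_cnj[symmetric]) (simp add: cis_cnj)

text \<open>The Gaussian weight makes the left-hand side converge although f is merely integrable.
  One of the two factors in the square is then moved back to f by the multiplication formula; the
  other becomes a convolution with K, the transform of the weight.\<close>

lemma gauss_weighted_L2_norm: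
  fixes f :: "'a::euclidean_space \<Rightarrow> complex"
  assumes f: "integrable lborel f" and s: "s > 0"
  defines "K \<equiv> \<lambda>z::'a. (sqrt (2 * pi) / s) ^ DIM('a) * gauss (z /\<^sub>R s)"
  shows "complex_of_real (LINT \<xi>|lborel. (cmod (fourier_int f \<xi>))\<^sup>2 * gauss (s *\<^sub>R \<xi>)) =
     (LINT x|lborel. f x * (LINT y|lborel. cnj (f y) * complex_of_real (K (x - y))))"
proof -
  have [measurable]: "fourier_int f \<in> borel_measurable borel" by (rule fourier_int_measurable[OF f])
  let ?g = "\<lambda>\<xi>::'a. complex_of_real (gauss (s *\<^sub>R \<xi>))"
  let ?H = "\<lambda>\<xi>. ?g \<xi> * cnj (fourier_int f \<xi>)"
  have g: "integrable lborel ?g"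
    using integrable_gauss_scaled[OF s] by (rule integrable_of_real)
  have H: "integrable lborel ?H"
    using g
  proof (rule integrable_mult_bounded)
    show "(\<lambda>\<xi>. cnj (fourier_int f \<xi>)) \<in> borel_measurable lborel"
      using continuous_on_cnj[OF continuous_on_fourier_int[OF f]] by (simp add: borel_measurable_continuous_onI)
    show "norm (cnj (fourier_int f \<xi>)) \<le> (LINT \<xi>|lborel. norm (f \<xi>))" for \<xi>
      by (simp add: norm_fourier_int_le)
  qed
  have cf: "integrable lborel (\<lambda>x. cnj (f x))" using f by simp
  have FH: "fourier_int ?H x = (LINT y|lborel. cnj (f y) * complex_of_real (K (x - y)))" for x
  proof -
    have "fourier_int ?H x = (LINT \<xi>|lborel. (?g \<xi> * cis (x \<bullet> \<xi>)) * (LINT y|lborel. cnj (f y) * cis (- (\<xi> \<bullet> y))))"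
      by (subst fourier_int_def) (simp only: cnj_fourier_int mult_ac)
    also have "\<dots> = (LINT y|lborel. cnj (f y) * (LINT \<xi>|lborel. (?g \<xi> * cis (x \<bullet> \<xi>)) * cis (- (\<xi> \<bullet> y))))"
      by (rule Fubini_bounded_kernel[OF integrable_mult_cis[OF g] cf, where C=1]) auto
    also have "\<dots> = (LINT y|lborel. cnj (f y) * fourier_int ?g (x - y))"
    proof -
      have "cis (x \<bullet> \<xi>) * cis (- (\<xi> \<bullet> y)) = cis ((x - y) \<bullet> \<xi>)" for \<xi> y
        by (simp add: cis_mult inner_diff_left inner_commute[of \<xi> y])
      then show ?thesis unfolding fourier_int_def by (simp only: mult.assoc)
    qed
    finally show ?thesis unfolding fourier_int_gauss_scaled[OF s] K_def .
  qed
  have "complex_of_real (LINT \<xi>|lborel. (cmod (fourier_int f \<xi>))\<^sup>2 * gauss (s *\<^sub>R \<xi>)) =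
     (LINT \<xi>|lborel. ?H \<xi> * fourier_int f \<xi>)"
    unfolding integral_complex_of_real[symmetric] of_real_mult complex_norm_square by (simp only: mult_ac)
  also have "\<dots> = (LINT x|lborel. f x * fourier_int ?H x)"
    by (rule fourier_int_multiplication[OF f H, symmetric])
  finally show ?thesis unfolding FH .
qed

text \<open>Schur's test: |f(x)| |f(y)| is at most half the sum of the squares, and each square
  meets the full mass of K. In that mass the powers of s cancel, so the bound is the same for every
  s.\<close>

lemma gauss_weighted_L2_bound:
  fixes f :: "'a::euclidean_space \<Rightarrow> complex"
  assumes f: "integrable lborel f" and f2: "integrable lborel (\<lambda>x. (cmod (f x))\<^sup>2)" and s: "s > 0"
  shows "(LINT \<xi>|lborel. (cmod (fourier_int f \<xi>))\<^sup>2 * gauss (s *\<^sub>R \<xi>))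
     \<le> (2 * pi) ^ DIM('a) * (LINT x|lborel. (cmod (f x))\<^sup>2)"
proof -
  define K where "K = (\<lambda>z::'a. (sqrt (2 * pi) / s) ^ DIM('a) * gauss (z /\<^sub>R s))"
  have [measurable]: "f \<in> borel_measurable borel" using borel_measurable_integrable[OF f] by simp
  have [measurable]: "K \<in> borel_measurable borel" unfolding K_def by measurable
  have K0: "K z \<ge> 0" for z using s gauss_pos[of "z /\<^sub>R s"] by (simp add: K_def)
  let ?c = "(2 * pi) ^ DIM('a)"
  have Ki: "integrable lborel K"
    unfolding K_def using integrable_gauss_scaled[of "inverse s"] s by (intro integrable_mult_right) auto
  have "integral\<^sup>L lborel K = (sqrt (2 * pi) / s) ^ DIM('a) * (LINT x|lborel. gauss (inverse s *\<^sub>R (x::'a)))"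
    unfolding K_def by simp
  also have "\<dots> = ?c"
  proof -
    have "(sqrt (2 * pi) / s) ^ DIM('a) * (sqrt (2 * pi) / inverse s) ^ DIM('a) =
        (sqrt (2 * pi) / s * (sqrt (2 * pi) / inverse s)) ^ DIM('a)"
      by (rule power_mult_distrib[symmetric])
    also have "sqrt (2 * pi) / s * (sqrt (2 * pi) / inverse s) = 2 * pi" using s by (simp add: divide_simps)
    finally show ?thesis using s integral_gauss_scaled[of "inverse s", where 'a='a] by simp
  qed
  finally have Kv: "integral\<^sup>L lborel K = ?c" .
  have nK: "(\<integral>\<^sup>+z. ennreal (K z) \<partial>lborel) = ennreal ?c"
    using nn_integral_eq_integral[OF Ki] K0 Kv by simp
  have nK1: "(\<integral>\<^sup>+y. ennreal (K (x - y)) \<partial>lborel) = ennreal ?c" for x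
    using nn_integral_lborel_shift(2)[of "\<lambda>z. ennreal (K z)" x] nK by simp
  have nK2: "(\<integral>\<^sup>+x. ennreal (K (x - y)) \<partial>lborel) = ennreal ?c" for y
    using nn_integral_lborel_shift(1)[of "\<lambda>z. ennreal (K z)" "- y"] nK by simp
  let ?n = "\<integral>\<^sup>+x. ennreal ((cmod (f x))\<^sup>2) \<partial>lborel"
  let ?I = "LINT \<xi>|lborel. (cmod (fourier_int f \<xi>))\<^sup>2 * gauss (s *\<^sub>R \<xi>)"
  have I0: "?I \<ge> 0" using gauss_pos by (intro Bochner_Integration.integral_nonneg mult_nonneg_nonneg) (auto intro: less_imp_le)
  have "?I = norm (LINT x|lborel. f x * (LINT y|lborel. cnj (f y) * complex_of_real (K (x - y))))"
    unfolding K_def gauss_weighted_L2_norm[OF f s, symmetric] using I0 by simp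
  then have "ennreal ?I \<le> (\<integral>\<^sup>+x. ennreal (norm (f x * (LINT y|lborel. cnj (f y) * complex_of_real (K (x - y))))) \<partial>lborel)"
    by (simp add: integral_norm_bound_ennreal')
  also have "\<dots> \<le> (\<integral>\<^sup>+x. (\<integral>\<^sup>+y. ennreal (cmod (f x)) * ennreal (cmod (f y) * K (x - y)) \<partial>lborel) \<partial>lborel)"
  proof (rule nn_integral_mono)
    fix x
    have "ennreal (norm (LINT y|lborel. cnj (f y) * complex_of_real (K (x - y)))) \<le>
        (\<integral>\<^sup>+y. ennreal (norm (cnj (f y) * complex_of_real (K (x - y)))) \<partial>lborel)"
      by (rule integral_norm_bound_ennreal')
    also have "\<dots> = (\<integral>\<^sup>+y. ennreal (cmod (f y) * K (x - y)) \<partial>lborel)"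
      using K0 by (simp add: norm_mult)
    finally show "ennreal (norm (f x * (LINT y|lborel. cnj (f y) * complex_of_real (K (x - y))))) \<le>
      (\<integral>\<^sup>+y. ennreal (cmod (f x)) * ennreal (cmod (f y) * K (x - y)) \<partial>lborel)"
      by (subst nn_integral_cmult) (auto simp: norm_mult ennreal_mult intro!: mult_left_mono)
  qed
  also have "\<dots> \<le> (\<integral>\<^sup>+x. (\<integral>\<^sup>+y. ennreal ((cmod (f x))\<^sup>2 / 2) * ennreal (K (x - y)) +
      ennreal ((cmod (f y))\<^sup>2 / 2) * ennreal (K (x - y)) \<partial>lborel) \<partial>lborel)"
  proof (intro nn_integral_mono)
    fix x y
    have "cmod (f x) * cmod (f y) \<le> (cmod (f x))\<^sup>2 / 2 + (cmod (f y))\<^sup>2 / 2"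
      using sum_squares_bound[of "cmod (f x)" "cmod (f y)"] by simp
    then have "cmod (f x) * cmod (f y) * K (x - y) \<le> ((cmod (f x))\<^sup>2 / 2 + (cmod (f y))\<^sup>2 / 2) * K (x - y)"
      using K0 by (rule mult_right_mono)
    then show "ennreal (cmod (f x)) * ennreal (cmod (f y) * K (x - y)) \<le> ennreal ((cmod (f x))\<^sup>2 / 2) * ennreal (K (x - y)) +
      ennreal ((cmod (f y))\<^sup>2 / 2) * ennreal (K (x - y))"
      using K0 by (simp add: distrib_right mult.assoc flip: ennreal_mult ennreal_plus)
  qed
  also have "\<dots> = (\<integral>\<^sup>+x. ennreal ((cmod (f x))\<^sup>2 / 2) * ennreal ?c \<partial>lborel) +
     (\<integral>\<^sup>+x. (\<integral>\<^sup>+y. ennreal ((cmod (f y))\<^sup>2 / 2) * ennreal (K (x - y)) \<partial>lborel) \<partial>lborel)"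
    by (simp add: nn_integral_add nn_integral_cmult nK1)
  also have "(\<integral>\<^sup>+x. (\<integral>\<^sup>+y. ennreal ((cmod (f y))\<^sup>2 / 2) * ennreal (K (x - y)) \<partial>lborel) \<partial>lborel)
     = (\<integral>\<^sup>+y. (\<integral>\<^sup>+x. ennreal ((cmod (f y))\<^sup>2 / 2) * ennreal (K (x - y)) \<partial>lborel) \<partial>lborel)"
    by (rule lborel_pair.Fubini'[symmetric]) measurable
  also have "\<dots> = (\<integral>\<^sup>+y. ennreal ((cmod (f y))\<^sup>2 / 2) * ennreal ?c \<partial>lborel)"
    by (simp add: nn_integral_cmult nK2)
  also have "(\<integral>\<^sup>+x. ennreal ((cmod (f x))\<^sup>2 / 2) * ennreal ?c \<partial>lborel) =
      ennreal (LINT x|lborel. (cmod (f x))\<^sup>2 / 2 * ?c)"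
    using f2 by (subst nn_integral_eq_integral[symmetric]) (auto simp flip: ennreal_mult)
  also have "ennreal (LINT x|lborel. (cmod (f x))\<^sup>2 / 2 * ?c) + ennreal (LINT x|lborel. (cmod (f x))\<^sup>2 / 2 * ?c)
     = ennreal (?c * (LINT x|lborel. (cmod (f x))\<^sup>2))"
    by (subst ennreal_plus[symmetric]) (auto intro!: arg_cong[where f=ennreal] mult_nonneg_nonneg)
  finally show ?thesis
    by (subst (asm) ennreal_le_iff) (auto intro!: mult_nonneg_nonneg)
qed

text \<open>The bound with the weight \<open>gauss (s *\<^sub>R \<xi>)\<close> is uniform in s, so
  Fatou's lemma along s = 1 / (n + 1) removes the weight.\<close>

lemma fourier_int_square_integrable:
  fixes f :: "'a::euclidean_space \<Rightarrow> complex"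
  assumes f: "integrable lborel f" and f2: "integrable lborel (\<lambda>x. (cmod (f x))\<^sup>2)"
  shows "integrable lborel (\<lambda>\<xi>. (cmod (fourier_int f \<xi>))\<^sup>2)"
proof (rule integrableI_nonneg)
  have [measurable]: "fourier_int f \<in> borel_measurable borel" by (rule fourier_int_measurable[OF f])
  show "(\<lambda>\<xi>. (cmod (fourier_int f \<xi>))\<^sup>2) \<in> borel_measurable lborel" by measurable
  let ?C = "(2 * pi) ^ DIM('a) * (LINT x|lborel. (cmod (f x))\<^sup>2)"
  let ?u = "\<lambda>n \<xi>. (cmod (fourier_int f \<xi>))\<^sup>2 * gauss ((1 / real (Suc n)) *\<^sub>R \<xi>)"
  have u0: "?u n \<xi> \<ge> 0" for n \<xi> using gauss_pos less_imp_le by (intro mult_nonneg_nonneg) auto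
  have i: "integrable lborel (?u n)" for n
    using integrable_mult_bounded[OF integrable_gauss_scaled[of "1 / real (Suc n)"], of "\<lambda>\<xi>. (cmod (fourier_int f \<xi>))\<^sup>2"
        "(LINT \<xi>|lborel. norm (f \<xi>))\<^sup>2"] norm_fourier_int_le[of f]
    by (simp add: mult.commute power_mono)
  have le: "(\<integral>\<^sup>+\<xi>. ennreal (?u n \<xi>) \<partial>lborel) \<le> ennreal ?C" for n
    using gauss_weighted_L2_bound[OF f f2, of "1 / real (Suc n)"] nn_integral_eq_integral[OF i[of n]] u0
    by (simp add: ennreal_leI)
  have lim: "liminf (\<lambda>n. ennreal (?u n \<xi>)) = ennreal ((cmod (fourier_int f \<xi>))\<^sup>2)" for \<xi>
  proof -
    have "(\<lambda>n. (1 / real (Suc n)) *\<^sub>R \<xi>) \<longlonglongrightarrow> 0 *\<^sub>R \<xi>"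
      by (intro tendsto_intros LIMSEQ_inverse_real_of_nat[unfolded inverse_eq_divide])
    then have "(\<lambda>n. gauss ((1 / real (Suc n)) *\<^sub>R \<xi>)) \<longlonglongrightarrow> gauss (0 *\<^sub>R \<xi>)"
      by (rule isCont_tendsto_compose[OF isCont_gauss])
    moreover have "gauss (0 *\<^sub>R \<xi>) = 1" by (simp add: gauss_def)
    ultimately have "(\<lambda>n. ?u n \<xi>) \<longlonglongrightarrow> (cmod (fourier_int f \<xi>))\<^sup>2 * 1"
      by (intro tendsto_mult tendsto_const) simp
    then show ?thesis by (intro lim_imp_Liminf) (auto intro: tendsto_ennrealI)
  qed
  have "(\<integral>\<^sup>+\<xi>. ennreal ((cmod (fourier_int f \<xi>))\<^sup>2) \<partial>lborel) =
      (\<integral>\<^sup>+\<xi>. liminf (\<lambda>n. ennreal (?u n \<xi>)) \<partial>lborel)" unfolding lim ..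
  also have "\<dots> \<le> liminf (\<lambda>n. \<integral>\<^sup>+\<xi>. ennreal (?u n \<xi>) \<partial>lborel)"
    by (rule nn_integral_liminf) measurable
  also have "\<dots> \<le> limsup (\<lambda>n. \<integral>\<^sup>+\<xi>. ennreal (?u n \<xi>) \<partial>lborel)"
    by (rule Liminf_le_Limsup) simp
  also have "\<dots> \<le> ennreal ?C"
    by (rule Limsup_bounded) (use le in simp)
  finally show "(\<integral>\<^sup>+\<xi>. ennreal ((cmod (fourier_int f \<xi>))\<^sup>2) \<partial>lborel) < \<infinity>"
    by (simp add: le_less_trans)
qed auto


section \<open>Injectivity of the transform on integrable functions\<close>

lemma gauss_convolution_eq_0:
  fixes f :: "'a::euclidean_space \<Rightarrow> complex"
  assumes f: "integrable lborel f" and z: "\<And>x. fourier_int f x = 0" and s: "s > 0"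
  shows "(LINT x|lborel. f x * complex_of_real (gauss ((y - x) /\<^sub>R s))) = 0"
proof -
  let ?g = "\<lambda>\<zeta>::'a. complex_of_real (gauss (s *\<^sub>R \<zeta>))"
  let ?h = "\<lambda>\<zeta>::'a. ?g \<zeta> * cis ((- y) \<bullet> \<zeta>)"
  have h: "integrable lborel ?h"
    by (intro integrable_mult_cis integrable_of_real integrable_gauss_scaled s)
  have "fourier_int ?h x = fourier_int ?g (x - y)" for x
  proof -
    have "cis ((- y) \<bullet> \<zeta>) * cis (x \<bullet> \<zeta>) = cis ((x - y) \<bullet> \<zeta>)" for \<zeta>
      by (simp add: cis_mult inner_diff_left)
    then show ?thesis unfolding fourier_int_def by (simp only: mult.assoc)
  qed
  then have eq: "fourier_int ?h x = complex_of_real ((sqrt (2 * pi) / s) ^ DIM('a)) * complex_of_real (gauss ((y - x) /\<^sub>R s))" for x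
    unfolding fourier_int_gauss_scaled[OF s] using gauss_minus[of "(x - y) /\<^sub>R s"]
    by (simp flip: scaleR_minus_right)
  \<comment> \<open>The modulated Gaussian is chosen so that its transform is a Gaussian centred at
    y. The multiplication formula moves the transform to f, where it vanishes.\<close>
  have "(LINT x|lborel. f x * fourier_int ?h x) = 0"
    using fourier_int_multiplication[OF f h] by (simp add: z)
  then have "(LINT x|lborel. complex_of_real ((sqrt (2 * pi) / s) ^ DIM('a)) * (f x * complex_of_real (gauss ((y - x) /\<^sub>R s)))) = 0"
    unfolding eq by (simp only: mult.left_commute)
  then have "complex_of_real ((sqrt (2 * pi) / s) ^ DIM('a)) * (LINT x|lborel. f x * complex_of_real (gauss ((y - x) /\<^sub>R s))) = 0"
    by (simp only: integral_mult_right_zero)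
  then show ?thesis using s by simp
qed

text \<open>The indicator of the box is smoothed by Gaussians of width 1 / (n + 1). Each smoothed
  indicator integrates to 0 against f, and off the boundary of the box the smoothing converges to a
  multiple of the indicator.\<close>

lemma fourier_int_eq_0_imp_integral_box_eq_0:
  fixes f :: "'a::euclidean_space \<Rightarrow> complex"
  assumes f: "integrable lborel f" and z: "\<And>x. fourier_int f x = 0"
  shows "(LINT x|lborel. indicator (box a b) x *\<^sub>R f x) = 0"
proof -
  have [measurable]: "f \<in> borel_measurable borel" using borel_measurable_integrable[OF f] by simp
  let ?\<psi> = "\<lambda>x. complex_of_real (indicator (box a b) x)"
  let ?s = "\<lambda>n. 1 / real (Suc n)"
  let ?k = "\<lambda>n x y. complex_of_real (gauss ((y - x) /\<^sub>R ?s n))"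
  \<comment> \<open>The smoothing after the substitution y = x + z / (n + 1): the Gaussian stays
    fixed and dominates, and only the argument of the indicator moves with n.\<close>
  define S where "S n x = (LINT z|lborel. complex_of_real (gauss z) * ?\<psi> (x + ?s n *\<^sub>R z))" for n x
  let ?c = "complex_of_real (sqrt (2 * pi) ^ DIM('a))"
  have \<psi>: "integrable lborel ?\<psi>"
    by (intro integrable_of_real integrable_real_indicator) (auto simp: emeasure_lborel_box_eq)
  have g: "integrable lborel (\<lambda>z::'a. complex_of_real (gauss z))"
    by (intro integrable_of_real integrable_gauss)
  have Seq: "?s n ^ DIM('a) *\<^sub>R S n x = (LINT y|lborel. ?\<psi> y * ?k n x y)" for n x
  proof -
    have i: "integrable lborel (\<lambda>y. ?\<psi> y * ?k n x y)"
      using \<psi> by (rule integrable_mult_bounded[where C=1]) (auto simp: gauss_le_1 less_imp_le[OF gauss_pos])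
    show ?thesis
      using integral_lborel_affine[OF i, of "?s n" x] by (simp add: S_def mult.commute)
  qed
  have "(LINT x|lborel. f x * S n x) = 0" for n
  proof -
    have "(LINT x|lborel. f x * (LINT y|lborel. ?\<psi> y * ?k n x y)) = (LINT y|lborel. ?\<psi> y * (LINT x|lborel. f x * ?k n x y))"
      by (rule Fubini_bounded_kernel[OF f \<psi>, where C=1]) (auto simp: gauss_le_1 less_imp_le[OF gauss_pos])
    also have "\<dots> = 0" using gauss_convolution_eq_0[OF f z, of "?s n"] by simp
    finally show ?thesis unfolding Seq[symmetric] by simp
  qed
  moreover have "(\<lambda>n. LINT x|lborel. f x * S n x) \<longlonglongrightarrow> (LINT x|lborel. f x * (?c * ?\<psi> x))"
  proof (rule integral_dominated_convergence)
    show "integrable lborel (\<lambda>x. norm (f x) * sqrt (2 * pi) ^ DIM('a))" using f by auto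
    have "S n \<in> borel_measurable borel" for n
      unfolding S_def by measurable
    then show "(\<lambda>x. f x * S n x) \<in> borel_measurable lborel" for n by simp
    show "(\<lambda>x. f x * (?c * ?\<psi> x)) \<in> borel_measurable lborel" by simp
    show "AE x in lborel. norm (f x * S n x) \<le> norm (f x) * sqrt (2 * pi) ^ DIM('a)" for n
    proof (rule AE_I2)
      fix x
      have "norm (S n x) \<le> (LINT z|lborel. norm (complex_of_real (gauss z) * ?\<psi> (x + ?s n *\<^sub>R z)))"
        unfolding S_def by (rule integral_norm_bound)
      also have "\<dots> \<le> (LINT z|lborel. gauss (z::'a))"
      proof (rule integral_mono')
        fix z :: 'a
        show "norm (complex_of_real (gauss z) * ?\<psi> (x + ?s n *\<^sub>R z)) \<le> gauss z"
          using gauss_pos[of z] by (simp add: norm_mult indicator_def)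
      qed (auto intro: integrable_gauss less_imp_le[OF gauss_pos])
      finally show "norm (f x * S n x) \<le> norm (f x) * sqrt (2 * pi) ^ DIM('a)"
        unfolding integral_gauss norm_mult by (intro mult_left_mono) auto
    qed
    \<comment> \<open>The indicator is continuous off the boundary of the box, which is a null
      set.\<close>
    have "cbox a b - box a b \<in> null_sets lborel"
      using negligible_frontier_interval[of a b] by (simp add: negligible_iff_null_sets null_sets_completion_iff)
    from AE_not_in[OF this]
    show "AE x in lborel. (\<lambda>n. f x * S n x) \<longlonglongrightarrow> f x * (?c * ?\<psi> x)"
    proof eventually_elim
      fix x assume "x \<notin> cbox a b - box a b"
      then have "x \<notin> frontier (box a b)" by (auto simp: frontier_box split: if_splits)
      then have c: "isCont (indicator (box a b) :: 'a \<Rightarrow> real) x" by (simp add: isCont_indicator)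
      have "(\<lambda>n. S n x) \<longlonglongrightarrow> (LINT z|lborel. complex_of_real (gauss (z::'a)) * ?\<psi> x)"
        unfolding S_def
      proof (rule integral_dominated_convergence)
        show "integrable lborel (\<lambda>z::'a. gauss z)" by (rule integrable_gauss)
        show "AE z in lborel. norm (complex_of_real (gauss z) * ?\<psi> (x + ?s n *\<^sub>R z)) \<le> gauss z" for n
          using less_imp_le[OF gauss_pos] by (intro AE_I2) (simp add: norm_mult indicator_def)
        show "AE z in lborel. (\<lambda>n. complex_of_real (gauss z) * ?\<psi> (x + ?s n *\<^sub>R z)) \<longlonglongrightarrow> complex_of_real (gauss z) * ?\<psi> x"
        proof (rule AE_I2)
          fix z
          have "(\<lambda>n. x + ?s n *\<^sub>R z) \<longlonglongrightarrow> x + 0 *\<^sub>R z"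
            by (intro tendsto_intros LIMSEQ_inverse_real_of_nat[unfolded inverse_eq_divide])
          then have "(\<lambda>n. x + ?s n *\<^sub>R z) \<longlonglongrightarrow> x" by simp
          from isCont_tendsto_compose[OF c this]
          show "(\<lambda>n. complex_of_real (gauss z) * ?\<psi> (x + ?s n *\<^sub>R z)) \<longlonglongrightarrow> complex_of_real (gauss z) * ?\<psi> x"
            by (intro tendsto_mult tendsto_const tendsto_of_real)
        qed
      qed measurable
      also have "(LINT z|lborel. complex_of_real (gauss (z::'a)) * ?\<psi> x) = ?c * ?\<psi> x"
        using integral_gauss[where 'a='a] by simp
      finally show "(\<lambda>n. f x * S n x) \<longlonglongrightarrow> f x * (?c * ?\<psi> x)" by (intro tendsto_mult tendsto_const)
    qed
  qed
  ultimately have "(LINT x|lborel. f x * (?c * ?\<psi> x)) = 0" by (simp add: LIMSEQ_const_iff)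
  moreover have "(LINT x|lborel. f x * (?c * ?\<psi> x)) = (LINT x|lborel. ?c * (indicator (box a b) x *\<^sub>R f x))"
    by (simp only: scaleR_conv_of_real mult_ac)
  ultimately have "?c * (LINT x|lborel. indicator (box a b) x *\<^sub>R f x) = 0"
    by (simp only: integral_mult_right_zero)
  then show ?thesis by simp
qed

text \<open>Open boxes generate the Borel sets and are stable under intersection, so vanishing
  integrals over boxes extend to all Borel sets. The complement step uses that the total integral is
  the transform at 0.\<close>

lemma fourier_int_eq_0_imp_AE_eq_0:
  fixes f :: "'a::euclidean_space \<Rightarrow> complex"
  assumes f: "integrable lborel f" and z: "\<And>x. fourier_int f x = 0"
  shows "AE x in lborel. f x = 0"
proof (rule sigma_finite_measure.density_zero[OF sigma_finite_lborel f])
  fix A :: "'a set" assume "A \<in> sets lborel"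
  then have A: "A \<in> sigma_sets UNIV (range (\<lambda>(a, b). box a b))"
    by (simp add: borel_eq_box)
  have set: "B \<in> sets borel" if "B \<in> sigma_sets UNIV (range (\<lambda>(a, b). box a b))" for B :: "'a set"
    using that by (simp add: borel_eq_box)
  have int: "set_integrable lborel B f" if "B \<in> sets borel" for B
    unfolding set_integrable_def using that f by (intro integrable_mult_indicator) auto
  have tot: "(LINT x|lborel. f x) = 0" using z[of 0] by (simp add: fourier_int_def)
  have stable: "Int_stable (range (\<lambda>(a, b). box a b :: 'a set))"
    by (auto simp: Int_stable_def box_Int_box)
  show "(LINT x:A|lborel. f x) = 0"
    using stable _ A
  proof (rule sigma_sets_induct_disjoint)
    fix B assume "B \<in> range (\<lambda>(a, b). box a b :: 'a set)"
    then show "(LINT x:B|lborel. f x) = 0"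
      using fourier_int_eq_0_imp_integral_box_eq_0[OF f z] by (auto simp: set_lebesgue_integral_def)
  next
    fix B assume B: "B \<in> sigma_sets UNIV (range (\<lambda>(a, b). box a b))" "(LINT x:B|lborel. f x) = 0"
    have "(LINT x:B \<union> (UNIV - B)|lborel. f x) = (LINT x:B|lborel. f x) + (LINT x:UNIV - B|lborel. f x)"
      using set[OF B(1)] by (intro set_integral_Un int) auto
    moreover have "B \<union> (UNIV - B) = UNIV" by auto
    ultimately show "(LINT x:UNIV - B|lborel. f x) = 0" using B(2) tot by (simp add: set_lebesgue_integral_def)
  next
    fix F :: "nat \<Rightarrow> 'a set"
    assume F: "disjoint_family F" "range F \<subseteq> sigma_sets UNIV (range (\<lambda>(a, b). box a b))"
      "\<And>i. (LINT x:F i|lborel. f x) = 0"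
    have Fs: "F i \<in> sets borel" for i using F(2) set by blast
    have "(LINT x:(\<Union>i. F i)|lborel. f x) = (\<Sum>i. (LINT x:F i|lborel. f x))"
      using F(1) Fs by (intro lebesgue_integral_countable_add int) (auto simp: disjoint_family_on_def)
    then show "(LINT x:(\<Union>i. F i)|lborel. f x) = 0" using F(3) by simp
  qed (auto simp: set_lebesgue_integral_def)
qed


section \<open>Decay of Fourier integrals at infinity\<close>

lemma norm_cis_diff_le: "cmod (cis a - cis b) \<le> \<bar>a - b\<bar>"
proof -
  have "cis a - cis b = cis b * (cis (a - b) - 1)"
    by (simp add: right_diff_distrib cis_mult)
  then have "cmod (cis a - cis b) = 2 * \<bar>sin ((a - b) / 2)\<bar>"
    using dist_exp_i_1[of "a - b"] by (simp add: norm_mult cis_conv_exp)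
  also have "\<dots> \<le> 2 * \<bar>(a - b) / 2\<bar>"
    by (intro mult_left_mono abs_sin_x_le_abs_x) auto
  finally show ?thesis by simp
qed

lemma fourier_int_lipschitz:
  fixes f :: "'a::euclidean_space \<Rightarrow> complex"
  assumes f: "integrable lborel f" and f1: "integrable lborel (\<lambda>\<xi>. norm \<xi> * cmod (f \<xi>))"
  shows "cmod (fourier_int f x - fourier_int f y) \<le> (LINT \<xi>|lborel. norm \<xi> * cmod (f \<xi>)) * norm (x - y)"
proof -
  have [measurable]: "f \<in> borel_measurable borel" using borel_measurable_integrable[OF f] by simp
  have "fourier_int f x - fourier_int f y = (LINT \<xi>|lborel. f \<xi> * (cis (x \<bullet> \<xi>) - cis (y \<bullet> \<xi>)))"
    unfolding fourier_int_def right_diff_distrib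
    by (intro Bochner_Integration.integral_diff[symmetric] integrable_mult_cis f)
  also have "cmod \<dots> \<le> (LINT \<xi>|lborel. cmod (f \<xi> * (cis (x \<bullet> \<xi>) - cis (y \<bullet> \<xi>))))"
    by (rule integral_norm_bound)
  also have "\<dots> \<le> (LINT \<xi>|lborel. (norm \<xi> * cmod (f \<xi>)) * norm (x - y))"
  proof (rule integral_mono')
    fix \<xi> :: 'a
    have "cmod (cis (x \<bullet> \<xi>) - cis (y \<bullet> \<xi>)) \<le> \<bar>(x - y) \<bullet> \<xi>\<bar>"
      using norm_cis_diff_le[of "x \<bullet> \<xi>" "y \<bullet> \<xi>"] by (simp add: inner_diff_left)
    also have "\<dots> \<le> norm (x - y) * norm \<xi>" by (rule Cauchy_Schwarz_ineq2)
    finally have "cmod (f \<xi>) * cmod (cis (x \<bullet> \<xi>) - cis (y \<bullet> \<xi>)) \<le> cmod (f \<xi>) * (norm (x - y) * norm \<xi>)"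
      by (intro mult_left_mono) auto
    then show "cmod (f \<xi> * (cis (x \<bullet> \<xi>) - cis (y \<bullet> \<xi>))) \<le> (norm \<xi> * cmod (f \<xi>)) * norm (x - y)"
      by (simp add: norm_mult mult_ac)
  qed (use f1 in auto)
  finally show ?thesis by simp
qed

lemma integral_outside_ball_tendsto_0:
  fixes f :: "'a::euclidean_space \<Rightarrow> real"
  assumes f: "integrable lborel f"
  shows "((\<lambda>R. LINT x|lborel. indicator (- cball 0 R) x * f x) \<longlongrightarrow> 0) at_top"
proof -
  have [measurable]: "f \<in> borel_measurable borel" using borel_measurable_integrable[OF f] by simp
  have "((\<lambda>R. LINT x|lborel. indicator (- cball 0 R) x * f x) \<longlongrightarrow> (LINT x|lborel. 0 * f x)) at_top"
  proof (rule integral_dominated_convergence_at_top[where w="\<lambda>x. \<bar>f x\<bar>"])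
    show "AE x in lborel. ((\<lambda>R. indicator (- cball 0 R) x * f x) \<longlongrightarrow> 0 * f x) at_top"
    proof (rule AE_I2)
      fix x :: 'a
      have "eventually (\<lambda>R. indicator (- cball 0 R) x * f x = 0 * f x) at_top"
        using eventually_ge_at_top[of "norm x"] by eventually_elim auto
      then show "((\<lambda>R. indicator (- cball 0 R) x * f x) \<longlongrightarrow> 0 * f x) at_top"
        by (rule tendsto_eventually)
    qed
    show "\<forall>\<^sub>F R in at_top. AE x in lborel. norm (indicator (- cball 0 R) x * f x) \<le> \<bar>f x\<bar>"
      by (intro always_eventually allI AE_I2) (simp add: indicator_def)
  qed (use f in auto)
  then show ?thesis by simp
qed

text \<open>Where |F| is at least e, the Lipschitz bound keeps it above e / 2 on a ball of fixed
  radius. Far from the origin such a ball would contribute the fixed amount c to a tail of the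
  integral of |F|^2, but the tails tend to 0.\<close>

lemma L2_lipschitz_tendsto_0:
  fixes F :: "'a::euclidean_space \<Rightarrow> complex"
  assumes F2: "integrable lborel (\<lambda>x. (cmod (F x))\<^sup>2)"
    and lip: "\<And>x y. cmod (F x - F y) \<le> L * norm (x - y)"
  shows "(F \<longlongrightarrow> 0) at_infinity"
proof (rule tendstoI)
  fix e :: real assume e: "e > 0"
  \<comment> \<open>The modulus and the summand 1 keep the radius positive whatever the sign of L,
    and also for L = 0.\<close>
  define r where "r = e / (2 * (\<bar>L\<bar> + 1))"
  have r: "r > 0" using e by (simp add: r_def)
  define c where "c = (e / 2)\<^sup>2 * measure lborel (ball (0::'a) r)"
  have c: "c > 0" using e r by (simp add: c_def)
  have "eventually (\<lambda>R. (LINT x|lborel. indicator (- cball 0 R) x * (cmod (F x))\<^sup>2) < c) at_top"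
    using order_tendstoD(2)[OF integral_outside_ball_tendsto_0[OF F2] c] .
  then obtain R where R: "(LINT x|lborel. indicator (- cball 0 R) x * (cmod (F x))\<^sup>2) < c"
    by (auto simp: eventually_at_top_linorder)
  have "cmod (F x) < e" if x: "norm x > R + r" for x
  proof (rule ccontr)
    assume "\<not> cmod (F x) < e"
    have low: "(e / 2)\<^sup>2 \<le> (cmod (F y))\<^sup>2" if "y \<in> ball x r" for y
    proof (rule power_mono)
      have "cmod (F x - F y) \<le> L * norm (x - y)" by (rule lip)
      also have "\<dots> \<le> (\<bar>L\<bar> + 1) * r" using that r by (intro mult_mono) (auto simp: dist_norm)
      also have "\<dots> = e / 2" by (simp add: r_def field_simps)
      finally show "e / 2 \<le> cmod (F y)" using \<open>\<not> cmod (F x) < e\<close> norm_triangle_ineq2[of "F x" "F y"] by linarith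
    qed (use e in auto)
    have "c = (LINT y|lborel. indicator (ball x r) y * (e / 2)\<^sup>2)"
      using r by (simp add: c_def content_ball)
    also have "\<dots> \<le> (LINT y|lborel. indicator (- cball 0 R) y * (cmod (F y))\<^sup>2)"
    proof (rule integral_mono')
      have "integrable lborel (\<lambda>y. indicator (- cball 0 R) y *\<^sub>R (cmod (F y))\<^sup>2)"
        using F2 by (intro integrable_mult_indicator) auto
      then show "integrable lborel (\<lambda>y. indicator (- cball 0 R) y * (cmod (F y))\<^sup>2)" by simp
      fix y
      show "indicator (ball x r) y * (e / 2)\<^sup>2 \<le> indicator (- cball 0 R) y * (cmod (F y))\<^sup>2"
      proof (cases "y \<in> ball x r")
        case True
        then have "norm y > R" using x norm_triangle_ineq2[of x y] by (simp add: dist_norm)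
        then show ?thesis using low[OF True] True by simp
      qed (auto simp: indicator_def)
    qed auto
    finally show False using R by simp
  qed
  then show "eventually (\<lambda>x. dist (F x) 0 < e) at_infinity"
    unfolding eventually_at_infinity by (intro exI[of _ "R + r + 1"]) auto
qed

text \<open>Truncating \<open>f\<close> makes its transform Lipschitz and square integrable.\<close>
lemma Riemann_Lebesgue:
  fixes f :: "'a::euclidean_space \<Rightarrow> complex"
  assumes f: "integrable lborel f"
  shows "(fourier_int f \<longlongrightarrow> 0) at_infinity"
proof (rule tendstoI)
  fix e :: real assume e: "e > 0"
  have [measurable]: "f \<in> borel_measurable borel" using borel_measurable_integrable[OF f] by simp
  \<comment> \<open>Cutting off \<xi> makes the first moment finite, which gives the Lipschitz
    constant; cutting off the values gives |g|^2 \<le> n |f| and hence square integrability.\<close>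
  define A where "A n = {\<xi>. norm \<xi> \<le> real n \<and> cmod (f \<xi>) \<le> real n}" for n :: nat
  have [measurable]: "A n \<in> sets borel" for n unfolding A_def by measurable
  define g where "g n \<xi> = indicator (A n) \<xi> *\<^sub>R f \<xi>" for n \<xi>
  have [measurable]: "g n \<in> borel_measurable borel" for n unfolding g_def by measurable
  have g: "integrable lborel (g n)" for n
    unfolding g_def using f by (intro integrable_mult_indicator) auto
  have g1: "integrable lborel (\<lambda>\<xi>. norm \<xi> * cmod (g n \<xi>))" for n
  proof (rule Bochner_Integration.integrable_bound)
    show "integrable lborel (\<lambda>\<xi>. real n * cmod (f \<xi>))" using f by auto
    show "AE \<xi> in lborel. norm (norm \<xi> * cmod (g n \<xi>)) \<le> norm (real n * cmod (f \<xi>))"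
      by (intro AE_I2) (auto simp: g_def A_def indicator_def intro: mult_right_mono)
  qed measurable
  have g2: "integrable lborel (\<lambda>\<xi>. (cmod (g n \<xi>))\<^sup>2)" for n
  proof (rule Bochner_Integration.integrable_bound)
    show "integrable lborel (\<lambda>\<xi>. real n * cmod (f \<xi>))" using f by auto
    show "AE \<xi> in lborel. norm ((cmod (g n \<xi>))\<^sup>2) \<le> norm (real n * cmod (f \<xi>))"
      by (intro AE_I2) (auto simp: g_def A_def indicator_def power2_eq_square intro: mult_right_mono)
  qed measurable
  have "(\<lambda>n. LINT \<xi>|lborel. cmod (f \<xi> - g n \<xi>)) \<longlonglongrightarrow> (LINT \<xi>|(lborel :: 'a measure). 0)"
  proof (rule integral_dominated_convergence[where w="\<lambda>\<xi>. cmod (f \<xi>)"])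
    show "AE \<xi> in lborel. (\<lambda>n. cmod (f \<xi> - g n \<xi>)) \<longlonglongrightarrow> 0"
    proof (rule AE_I2)
      fix \<xi> :: 'a
      obtain N :: nat where "max (norm \<xi>) (cmod (f \<xi>)) \<le> real N" using real_arch_simple by blast
      then have "cmod (f \<xi> - g n \<xi>) = 0" if "n \<ge> N" for n
        using that by (auto simp: g_def A_def indicator_def)
      then show "(\<lambda>n. cmod (f \<xi> - g n \<xi>)) \<longlonglongrightarrow> 0"
        by (intro tendsto_eventually eventually_sequentiallyI[of N]) auto
    qed
    show "AE \<xi> in lborel. norm (cmod (f \<xi> - g n \<xi>)) \<le> cmod (f \<xi>)" for n
      by (intro AE_I2) (auto simp: g_def indicator_def)
  qed (use f in auto)
  then have "eventually (\<lambda>n. (LINT \<xi>|lborel. cmod (f \<xi> - g n \<xi>)) < e / 2) sequentially"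
    using e by (intro order_tendstoD(2)) auto
  then obtain n where n: "(LINT \<xi>|lborel. cmod (f \<xi> - g n \<xi>)) < e / 2"
    by (auto simp: eventually_sequentially)
  have "(fourier_int (g n) \<longlongrightarrow> 0) at_infinity"
    by (rule L2_lipschitz_tendsto_0[OF fourier_int_square_integrable[OF g g2] fourier_int_lipschitz[OF g g1]])
  then have "eventually (\<lambda>x. dist (fourier_int (g n) x) 0 < e / 2) at_infinity"
    by (rule tendstoD) (use e in simp)
  then show "eventually (\<lambda>x. dist (fourier_int f x) 0 < e) at_infinity"
  proof eventually_elim
    fix x assume "dist (fourier_int (g n) x) 0 < e / 2"
    moreover have "fourier_int (\<lambda>\<xi>. f \<xi> - g n \<xi>) x = fourier_int f x - fourier_int (g n) x"
      unfolding fourier_int_def left_diff_distrib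
      by (intro Bochner_Integration.integral_diff integrable_mult_cis f g)
    ultimately show "dist (fourier_int f x) 0 < e"
      using n norm_fourier_int_le[of "\<lambda>\<xi>. f \<xi> - g n \<xi>" x] norm_triangle_ineq2[of "fourier_int f x" "fourier_int (g n) x"]
      by simp
  qed
qed

section \<open>Pairings in L_2 and Fourier inversion\<close>

lemma L2_pairing_bound:
  fixes d h :: "'a \<Rightarrow> complex"
  assumes d: "integrable M (\<lambda>x. (cmod (d x))\<^sup>2)" and h: "integrable M (\<lambda>x. (cmod (h x))\<^sup>2)"
    and \<delta>: "\<delta> > 0"
  shows "cmod (LINT x|M. d x * h x) \<le> (LINT x|M. (cmod (d x))\<^sup>2) / \<delta> + \<delta> * (LINT x|M. (cmod (h x))\<^sup>2)"
proof -
  have "cmod (LINT x|M. d x * h x) \<le> (LINT x|M. cmod (d x * h x))"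
    by (rule integral_norm_bound)
  also have "\<dots> \<le> (LINT x|M. (cmod (d x))\<^sup>2 / \<delta> + \<delta> * (cmod (h x))\<^sup>2)"
  proof (rule integral_mono')
    fix x
    \<comment> \<open>A weighted square in place of the Cauchy-Schwarz inequality: the factor in
      front of the integral of |h|^2 can be made small first, before the integral of |d|^2 is sent
      to 0.\<close>
    have "0 \<le> (cmod (d x) - \<delta> * cmod (h x))\<^sup>2" by simp
    then have "2 * (\<delta> * (cmod (d x) * cmod (h x))) \<le> (cmod (d x))\<^sup>2 + \<delta>\<^sup>2 * (cmod (h x))\<^sup>2"
      by (simp add: power2_diff power_mult_distrib mult_ac)
    moreover have "0 \<le> \<delta> * (cmod (d x) * cmod (h x))" using \<delta> by simp
    ultimately have "\<delta> * (cmod (d x) * cmod (h x)) \<le> (cmod (d x))\<^sup>2 + \<delta>\<^sup>2 * (cmod (h x))\<^sup>2" by linarith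
    then show "cmod (d x * h x) \<le> (cmod (d x))\<^sup>2 / \<delta> + \<delta> * (cmod (h x))\<^sup>2"
      using \<delta> by (simp add: norm_mult field_simps power2_eq_square)
  qed (use d h \<delta> in auto)
  finally show ?thesis using d h by simp
qed

lemma L2_pairing_tendsto_0:
  fixes d :: "'b \<Rightarrow> 'a \<Rightarrow> complex"
  assumes d: "\<And>R. integrable M (\<lambda>x. (cmod (d R x))\<^sup>2)" and h: "integrable M (\<lambda>x. (cmod (h x))\<^sup>2)"
    and lim: "((\<lambda>R. LINT x|M. (cmod (d R x))\<^sup>2) \<longlongrightarrow> 0) F"
  shows "((\<lambda>R. LINT x|M. d R x * h x) \<longlongrightarrow> 0) F"
proof (rule tendstoI)
  fix e :: real assume e: "e > 0"
  define b where "b = (LINT x|M. (cmod (h x))\<^sup>2)"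
  have b: "b \<ge> 0" by (simp add: b_def)
  define \<delta> where "\<delta> = e / (2 * (b + 1))"
  have \<delta>: "\<delta> > 0" using e b by (simp add: \<delta>_def)
  have "\<delta> * b \<le> \<delta> * (b + 1)" using \<delta> by simp
  also have "\<dots> = e / 2" using b by (simp add: \<delta>_def field_simps)
  finally have db: "\<delta> * b \<le> e / 2" .
  have "eventually (\<lambda>R. (LINT x|M. (cmod (d R x))\<^sup>2) < \<delta> * (e / 2)) F"
    using lim \<delta> e by (intro order_tendstoD(2)) auto
  then show "eventually (\<lambda>R. dist (LINT x|M. d R x * h x) 0 < e) F"
  proof eventually_elim
    fix R assume "(LINT x|M. (cmod (d R x))\<^sup>2) < \<delta> * (e / 2)"
    then have "(LINT x|M. (cmod (d R x))\<^sup>2) / \<delta> < e / 2" using \<delta> by (simp add: field_simps)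
    then show "dist (LINT x|M. d R x * h x) 0 < e"
      using L2_pairing_bound[OF d h \<delta>, of R] db[unfolded b_def] by (simp only: dist_norm diff_0_right)
  qed
qed

lemma integrable_mult_L2:
  fixes f h :: "'a \<Rightarrow> complex"
  assumes [measurable]: "f \<in> borel_measurable M" "h \<in> borel_measurable M"
    and "integrable M (\<lambda>x. (cmod (f x))\<^sup>2)" "integrable M (\<lambda>x. (cmod (h x))\<^sup>2)"
  shows "integrable M (\<lambda>x. f x * h x)"
proof (rule Bochner_Integration.integrable_bound)
  show "integrable M (\<lambda>x. (cmod (f x))\<^sup>2 + (cmod (h x))\<^sup>2)" using assms by auto
  show "AE x in M. norm (f x * h x) \<le> norm ((cmod (f x))\<^sup>2 + (cmod (h x))\<^sup>2)"
  proof (rule AE_I2)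
    fix x
    have "2 * (cmod (f x) * cmod (h x)) \<le> (cmod (f x))\<^sup>2 + (cmod (h x))\<^sup>2"
      using sum_squares_bound[of "cmod (f x)" "cmod (h x)"] by simp
    moreover have "0 \<le> cmod (f x) * cmod (h x)" by simp
    ultimately have "cmod (f x) * cmod (h x) \<le> (cmod (f x))\<^sup>2 + (cmod (h x))\<^sup>2" by linarith
    then show "norm (f x * h x) \<le> norm ((cmod (f x))\<^sup>2 + (cmod (h x))\<^sup>2)"
      by (simp add: norm_mult)
  qed
qed measurable


text \<open>Testing against Gaussians modulated by characters shows that \<open>(\<phi> - fourier_int g) * gauss\<close> has
  vanishing Fourier transform.\<close>
lemma L2_fourier_inversion:
  fixes \<phi> g :: "real^'n \<Rightarrow> complex"
  assumes L2\<phi>: "L2 \<phi>" and F: "is_fourier_L2 \<phi> g" and g: "integrable lborel g"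
  shows "AE x in lborel. fourier_int g x = \<phi> x"
proof -
  let ?N = "CARD('n)"
  let ?G = "\<lambda>x::real^'n. complex_of_real (gauss x)"
  let ?c = "complex_of_real (sqrt (2 * pi) ^ ?N)"
  have [measurable]: "\<phi> \<in> borel_measurable borel" and \<phi>2: "integrable lborel (\<lambda>x. (cmod (\<phi> x))\<^sup>2)"
    using L2\<phi> by (auto simp: L2_def)
  have [measurable]: "g \<in> borel_measurable borel" and g2: "integrable lborel (\<lambda>x. (cmod (g x))\<^sup>2)"
    using F by (auto simp: L2_def is_fourier_L2_def)
  have [measurable]: "fourier_int g \<in> borel_measurable borel" by (rule fourier_int_measurable[OF g])
  have G: "integrable lborel ?G" by (intro integrable_of_real integrable_gauss)
  have Gsq: "integrable lborel (\<lambda>x::real^'n. (cmod (?G x * cis (y \<bullet> x)))\<^sup>2)" for y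
  proof (rule Bochner_Integration.integrable_bound[OF integrable_gauss])
    show "AE x in lborel. norm ((cmod (?G x * cis (y \<bullet> x)))\<^sup>2) \<le> norm (gauss x)"
    proof (rule AE_I2)
      fix x :: "real^'n"
      show "norm ((cmod (?G x * cis (y \<bullet> x)))\<^sup>2) \<le> norm (gauss x)"
        using gauss_pos[of x] gauss_le_1[of x] by (simp add: norm_mult power2_eq_square mult_left_le)
    qed
  qed measurable
  \<comment> \<open>On a ball an L_2 function is integrable, so the truncation has a pointwise
    transform, which agrees with \<open>fourier_trunc\<close> up to reflection and a
    constant.\<close>
  define \<phi>R where "\<phi>R R x = indicator (cball 0 R) x *\<^sub>R \<phi> x" for R and x :: "real^'n"
  have [measurable]: "\<phi>R R \<in> borel_measurable borel" for R
    unfolding \<phi>R_def by (intro borel_measurable_scaleR borel_measurable_indicator) auto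
  have \<phi>R2: "integrable lborel (\<lambda>x. (cmod (\<phi>R R x))\<^sup>2)" for R
    by (rule Bochner_Integration.integrable_bound[OF \<phi>2]) (auto simp: \<phi>R_def indicator_def)
  have \<phi>R1: "integrable lborel (\<phi>R R)" for R
  proof -
    have [measurable]: "cball (0::real^'n) R \<in> sets borel" by simp
    have "emeasure lborel (cball (0::real^'n) R) < \<infinity>" by (rule emeasure_bounded_finite[OF bounded_cball])
    then have "integrable lborel (indicator (cball (0::real^'n) R) :: _ \<Rightarrow> real)"
      by (intro integrable_real_indicator) auto
    then have "integrable lborel (\<lambda>x::real^'n. (cmod (complex_of_real (indicator (cball 0 R) x)))\<^sup>2)"
      by (rule Bochner_Integration.integrable_bound) (auto simp: indicator_def)
    then have "integrable lborel (\<lambda>x. complex_of_real (indicator (cball 0 R) x) * \<phi> x)"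
      using \<phi>2 by (intro integrable_mult_L2 borel_measurable_of_real) auto
    then show ?thesis by (simp add: \<phi>R_def[abs_def] scaleR_conv_of_real)
  qed
  let ?T = "fourier_trunc \<phi>"
  have T: "?T R \<xi> = complex_of_real ((2 * pi) powr (- real ?N)) * fourier_int (\<phi>R R) (- \<xi>)" for R \<xi>
    unfolding fourier_trunc_def fourier_int_def set_lebesgue_integral_def \<phi>R_def
    by (simp add: scaleR_conv_of_real inner_commute mult.assoc)
  have [measurable]: "fourier_int (\<phi>R R) \<in> borel_measurable borel" for R
    by (rule fourier_int_measurable[OF \<phi>R1])
  have Tm [measurable]: "?T R \<in> borel_measurable borel" for R unfolding T by measurable
  have T2: "integrable lborel (\<lambda>\<xi>. (cmod (?T R \<xi>))\<^sup>2)" for R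
  proof -
    have "integrable lborel (\<lambda>\<xi>. (cmod (fourier_int (\<phi>R R) (0 + (- 1) *\<^sub>R \<xi>)))\<^sup>2)"
      by (rule integrable_lborel_affine[OF fourier_int_square_integrable[OF \<phi>R1 \<phi>R2]]) simp
    then show ?thesis unfolding T by (simp add: norm_mult power_mult_distrib)
  qed
  \<comment> \<open>This gives the limit in \<open>is_fourier_L2\<close> its content: for a
    difference that is not square integrable the integral would be 0 by convention.\<close>
  have d2: "integrable lborel (\<lambda>\<xi>. (cmod (g \<xi> - ?T R \<xi>))\<^sup>2)" for R
  proof (rule Bochner_Integration.integrable_bound)
    show "integrable lborel (\<lambda>\<xi>. 2 * (cmod (g \<xi>))\<^sup>2 + 2 * (cmod (?T R \<xi>))\<^sup>2)" using g2 T2 by auto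
    show "AE \<xi> in lborel. norm ((cmod (g \<xi> - ?T R \<xi>))\<^sup>2) \<le> norm (2 * (cmod (g \<xi>))\<^sup>2 + 2 * (cmod (?T R \<xi>))\<^sup>2)"
    proof (rule AE_I2)
      fix \<xi>
      have "(cmod (g \<xi> - ?T R \<xi>))\<^sup>2 \<le> (cmod (g \<xi>) + cmod (?T R \<xi>))\<^sup>2"
        by (intro power_mono norm_triangle_ineq4) auto
      also have "\<dots> \<le> 2 * (cmod (g \<xi>))\<^sup>2 + 2 * (cmod (?T R \<xi>))\<^sup>2"
        using sum_squares_bound[of "cmod (g \<xi>)" "cmod (?T R \<xi>)"] by (simp add: power2_sum)
      finally show "norm ((cmod (g \<xi> - ?T R \<xi>))\<^sup>2) \<le> norm (2 * (cmod (g \<xi>))\<^sup>2 + 2 * (cmod (?T R \<xi>))\<^sup>2)" by simp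
    qed
  qed measurable
  have lim0: "((\<lambda>R. LINT \<xi>|lborel. (cmod (g \<xi> - ?T R \<xi>))\<^sup>2) \<longlongrightarrow> 0) at_top"
    using F by (simp add: is_fourier_L2_def)

  \<comment> \<open>The Gaussian factor makes the difference of an L_2 function and a bounded one
    integrable; being positive, it can be cancelled at the end.\<close>
  define w where "w x = (\<phi> x - fourier_int g x) * ?G x" for x
  have \<phi>G: "integrable lborel (\<lambda>x. \<phi> x * (?G x * cis (\<eta> \<bullet> x)))" for \<eta>
    using \<phi>2 Gsq[of \<eta>] by (intro integrable_mult_L2) auto
  have gG: "integrable lborel (\<lambda>x. ?G x * fourier_int g x)"
    by (rule integrable_mult_bounded[OF G _ norm_fourier_int_le]) auto
  have w: "integrable lborel w"
    unfolding w_def[abs_def] using Bochner_Integration.integrable_diff[OF \<phi>G[of 0] gG] by (simp add: algebra_simps)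
  have "fourier_int w \<eta> = 0" for \<eta>
  proof -
    let ?\<psi> = "\<lambda>x. ?G x * cis (\<eta> \<bullet> x)"
    \<comment> \<open>Up to the constant \<open>?c\<close> this is the transform of
      \<open>?\<psi>\<close>; transforming once more returns \<open>?\<psi>\<close> reflected, which
      evaluates the pairing with the truncated transforms.\<close>
    let ?h = "\<lambda>\<xi>. ?G (\<xi> + \<eta>)"
    have \<psi>: "integrable lborel ?\<psi>" by (rule integrable_gauss_cis)
    have F\<psi>: "fourier_int ?\<psi> \<xi> = ?c * ?h \<xi>" for \<xi>
    proof -
      have "fourier_int ?\<psi> \<xi> = fourier_int ?G (\<xi> + \<eta>)"
        unfolding fourier_int_def by (simp add: mult.assoc cis_mult inner_add_left add.commute)
      then show ?thesis by (simp add: fourier_int_gauss)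
    qed
    have h: "integrable lborel ?h"
      using integrable_lborel_affine[OF G, of 1 \<eta>] by (simp add: add.commute)
    have h2: "integrable lborel (\<lambda>\<xi>. (cmod (?h \<xi>))\<^sup>2)"
      using integrable_lborel_affine[OF Gsq[of 0], of 1 \<eta>] by (simp add: add.commute)
    have Fh: "fourier_int ?h x = ?c * (?G x * cis (- (\<eta> \<bullet> x)))" for x
    proof -
      have "fourier_int ?h x = (LINT \<xi>|lborel. ?h (- \<eta> + 1 *\<^sub>R \<xi>) * cis (x \<bullet> (- \<eta> + 1 *\<^sub>R \<xi>)))"
        unfolding fourier_int_def
        using integral_lborel_affine[OF integrable_mult_cis[OF h], of 1 x "- \<eta>"] by simp
      also have "\<dots> = (LINT \<xi>|lborel. cis (- (\<eta> \<bullet> x)) * (?G \<xi> * cis (x \<bullet> \<xi>)))"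
        by (intro Bochner_Integration.integral_cong refl)
           (simp add: inner_diff_right inner_commute[of x \<eta>] cis_mult mult.left_commute)
      also have "\<dots> = cis (- (\<eta> \<bullet> x)) * fourier_int ?G x" unfolding fourier_int_def by (rule integral_mult_right_zero)
      finally show ?thesis by (simp add: fourier_int_gauss mult_ac)
    qed
    have TR: "(LINT \<xi>|lborel. ?T R \<xi> * ?h \<xi>) =
        complex_of_real ((2 * pi) powr (- real ?N)) * (?c * (LINT x|lborel. \<phi>R R x * ?\<psi> x))" for R
    proof -
      have hm: "integrable lborel (\<lambda>\<xi>. ?h (- \<xi>))"
        using integrable_lborel_affine[OF h, of "-1" 0] by simp
      have i: "integrable lborel (\<lambda>\<xi>. ?h \<xi> * fourier_int (\<phi>R R) (- \<xi>))"
        by (rule integrable_mult_bounded[OF h _ norm_fourier_int_le]) auto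
      have "(LINT \<xi>|lborel. ?h \<xi> * fourier_int (\<phi>R R) (- \<xi>)) = (LINT \<xi>|lborel. ?h (- \<xi>) * fourier_int (\<phi>R R) \<xi>)"
        using integral_lborel_affine[OF i, of "-1" 0] by simp
      also have "\<dots> = (LINT x|lborel. \<phi>R R x * fourier_int (\<lambda>\<xi>. ?h (- \<xi>)) x)"
        by (rule fourier_int_multiplication[OF hm \<phi>R1])
      also have "\<dots> = (LINT x|lborel. \<phi>R R x * fourier_int ?h (- x))"
      proof -
        have "fourier_int (\<lambda>\<xi>. ?h (- \<xi>)) x = fourier_int ?h (- x)" for x
          unfolding fourier_int_def
          using integral_lborel_affine[OF integrable_mult_cis[OF h, of "- x"], of "-1" 0] by simp
        then show ?thesis by simp
      qed
      also have "\<dots> = (LINT x|lborel. ?c * (\<phi>R R x * ?\<psi> x))"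
        unfolding Fh by (simp add: gauss_minus mult_ac)
      also have "\<dots> = ?c * (LINT x|lborel. \<phi>R R x * ?\<psi> x)" by (rule integral_mult_right_zero)
      finally have 1: "(LINT \<xi>|lborel. ?h \<xi> * fourier_int (\<phi>R R) (- \<xi>)) = ?c * (LINT x|lborel. \<phi>R R x * ?\<psi> x)" .
      have "(LINT \<xi>|lborel. ?T R \<xi> * ?h \<xi>) =
         (LINT \<xi>|lborel. complex_of_real ((2 * pi) powr (- real ?N)) * (?h \<xi> * fourier_int (\<phi>R R) (- \<xi>)))"
        unfolding T by (simp only: mult_ac)
      also have "\<dots> = complex_of_real ((2 * pi) powr (- real ?N)) * (LINT \<xi>|lborel. ?h \<xi> * fourier_int (\<phi>R R) (- \<xi>))"
        by (rule integral_mult_right_zero)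
      finally show ?thesis unfolding 1 .
    qed
    \<comment> \<open>The pairing of the truncated transforms with \<open>?h\<close> has two limits,
      one from L_2 convergence to g and one from dominated convergence of the truncations of \<phi>.
      Equating them is Parseval's identity for this test function.\<close>
    have "((\<lambda>R. LINT \<xi>|lborel. (g \<xi> - ?T R \<xi>) * ?h \<xi>) \<longlongrightarrow> 0) at_top"
      by (rule L2_pairing_tendsto_0[OF d2 h2 lim0])
    moreover have "(LINT \<xi>|lborel. (g \<xi> - ?T R \<xi>) * ?h \<xi>) = (LINT \<xi>|lborel. g \<xi> * ?h \<xi>) - (LINT \<xi>|lborel. ?T R \<xi> * ?h \<xi>)" for R
      unfolding left_diff_distrib using g2 T2[of R] h2
      by (intro Bochner_Integration.integral_diff integrable_mult_L2) auto
    ultimately have "((\<lambda>R. (LINT \<xi>|lborel. g \<xi> * ?h \<xi>) - (LINT \<xi>|lborel. ?T R \<xi> * ?h \<xi>)) \<longlongrightarrow> 0) at_top" by simp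
    then have l1: "((\<lambda>R. LINT \<xi>|lborel. ?T R \<xi> * ?h \<xi>) \<longlongrightarrow> (LINT \<xi>|lborel. g \<xi> * ?h \<xi>)) at_top"
      using tendsto_diff[OF tendsto_const[of "LINT \<xi>|lborel. g \<xi> * ?h \<xi>"]] by fastforce
    have "((\<lambda>R. LINT x|lborel. \<phi>R R x * ?\<psi> x) \<longlongrightarrow> (LINT x|lborel. \<phi> x * ?\<psi> x)) at_top"
    proof (rule integral_dominated_convergence_at_top[where w="\<lambda>x. cmod (\<phi> x * ?\<psi> x)"])
      show "integrable lborel (\<lambda>x. cmod (\<phi> x * ?\<psi> x))" using \<phi>G[of \<eta>] by (rule integrable_norm)
      show "AE x in lborel. ((\<lambda>R. \<phi>R R x * ?\<psi> x) \<longlongrightarrow> \<phi> x * ?\<psi> x) at_top"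
      proof (rule AE_I2)
        fix x :: "real^'n"
        have "eventually (\<lambda>R. \<phi>R R x * ?\<psi> x = \<phi> x * ?\<psi> x) at_top"
          using eventually_ge_at_top[of "norm x"] by eventually_elim (auto simp: \<phi>R_def)
        then show "((\<lambda>R. \<phi>R R x * ?\<psi> x) \<longlongrightarrow> \<phi> x * ?\<psi> x) at_top" by (rule tendsto_eventually)
      qed
      show "\<forall>\<^sub>F R in at_top. AE x in lborel. norm (\<phi>R R x * ?\<psi> x) \<le> cmod (\<phi> x * ?\<psi> x)"
        by (intro always_eventually allI AE_I2) (auto simp: \<phi>R_def norm_mult indicator_def)
    qed measurable
    then have l2: "((\<lambda>R. LINT \<xi>|lborel. ?T R \<xi> * ?h \<xi>) \<longlongrightarrow>
        complex_of_real ((2 * pi) powr (- real ?N)) * (?c * (LINT x|lborel. \<phi> x * ?\<psi> x))) at_top"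
      unfolding TR by (intro tendsto_intros)
    have gh: "(LINT \<xi>|lborel. g \<xi> * ?h \<xi>) = complex_of_real ((2 * pi) powr (- real ?N)) * (?c * (LINT x|lborel. \<phi> x * ?\<psi> x))"
      by (rule tendsto_unique[OF _ l1 l2]) simp
    have "(LINT x|lborel. ?\<psi> x * fourier_int g x) = (LINT \<xi>|lborel. g \<xi> * fourier_int ?\<psi> \<xi>)"
      by (rule fourier_int_multiplication[OF \<psi> g])
    also have "\<dots> = (LINT \<xi>|lborel. ?c * (g \<xi> * ?h \<xi>))" unfolding F\<psi> by (simp only: mult_ac)
    also have "\<dots> = ?c * (LINT \<xi>|lborel. g \<xi> * ?h \<xi>)" by (rule integral_mult_right_zero)
    also have "\<dots> = (?c * ?c * complex_of_real ((2 * pi) powr (- real ?N))) * (LINT x|lborel. \<phi> x * ?\<psi> x)"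
      unfolding gh by (simp only: mult_ac)
    \<comment> \<open>Two Gaussian transforms give (2 pi)^N, which cancels the normalising factor of
      the forward transform.\<close>
    also have "?c * ?c * complex_of_real ((2 * pi) powr (- real ?N)) = 1"
    proof -
      have "sqrt (2 * pi) ^ ?N * sqrt (2 * pi) ^ ?N = (2 * pi) ^ ?N"
        by (simp only: power_mult_distrib[symmetric] real_sqrt_mult_self) simp
      moreover have "(2 * pi) powr (- real ?N) = inverse ((2 * pi) ^ ?N)"
        using powr_realpow[of "2 * pi" ?N] by (simp only: powr_minus) simp
      moreover have "(2 * pi) ^ ?N * inverse ((2 * pi) ^ ?N) = 1" by (rule right_inverse) simp
      ultimately have "sqrt (2 * pi) ^ ?N * sqrt (2 * pi) ^ ?N * (2 * pi) powr (- real ?N) = 1" by (simp only:)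
      then show ?thesis unfolding of_real_mult[symmetric] by simp
    qed
    finally have eq: "(LINT x|lborel. ?\<psi> x * fourier_int g x) = (LINT x|lborel. \<phi> x * ?\<psi> x)" by simp
    have "fourier_int w \<eta> = (LINT x|lborel. \<phi> x * ?\<psi> x - ?\<psi> x * fourier_int g x)"
      unfolding fourier_int_def[of w] w_def by (simp add: algebra_simps)
    also have "\<dots> = (LINT x|lborel. \<phi> x * ?\<psi> x) - (LINT x|lborel. ?\<psi> x * fourier_int g x)"
    proof (rule Bochner_Integration.integral_diff)
      show "integrable lborel (\<lambda>x. ?\<psi> x * fourier_int g x)"
        by (rule integrable_mult_bounded[OF \<psi> _ norm_fourier_int_le]) auto
    qed (rule \<phi>G)
    finally show ?thesis using eq by simp
  qed
  from fourier_int_eq_0_imp_AE_eq_0[OF w this]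
  show ?thesis
  proof eventually_elim
    fix x assume "w x = 0"
    then show "fourier_int g x = \<phi> x" using gauss_pos[of x] by (simp add: w_def)
  qed
qed

section \<open>Integrability and differentiation under the integral\<close>

text \<open>Comparison with (1 + |x|)^(-2 s), which has an elementary antiderivative on the
  half-line, through (1 + |x|)^2 \<le> 2 (1 + x^2). The left half-line is obtained by
  reflection.\<close>

lemma integrable_one_plus_square_powr:
  fixes s :: real
  assumes s: "s > 1 / 2"
  shows "integrable lborel (\<lambda>x::real. (1 + x\<^sup>2) powr (- s))"
proof -
  let ?h = "\<lambda>x::real. indicator {0..} x * (1 + x) powr (- 2 * s)"
  have h: "integrable lborel ?h"
  proof (rule integrableI_nonneg)
    let ?F = "\<lambda>x::real. - ((1 + x) powr (1 - 2 * s)) / (2 * s - 1)"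
    let ?f = "\<lambda>x::real. (1 + \<bar>x\<bar>) powr (- 2 * s)"
    have "(\<integral>\<^sup>+x. ennreal (?f x) * indicator {0..} x \<partial>lborel) = ennreal (0 - ?F 0)"
    proof (rule nn_integral_FTC_atLeast)
      fix x :: real assume x: "0 \<le> x"
      have "(?F has_real_derivative - ((1 - 2 * s) * (1 + x) powr (1 - 2 * s - 1)) / (2 * s - 1)) (at x)"
        using x s by (auto intro!: derivative_eq_intros)
      also have "- ((1 - 2 * s) * (1 + x) powr (1 - 2 * s - 1)) / (2 * s - 1) = ?f x"
      proof -
        have "2 * s - 1 \<noteq> 0" using s by simp
        then have "- ((1 - 2 * s) * P) / (2 * s - 1) = P" for P by (simp add: divide_eq_eq algebra_simps)
        then show ?thesis using x by simp
      qed
      finally show "(?F has_real_derivative ?f x) (at x)" .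
    next
      show "(?F \<longlongrightarrow> 0) at_top" using s by real_asymp
    qed auto
    then have "(\<integral>\<^sup>+x. ennreal (?h x) \<partial>lborel) = ennreal (0 - ?F 0)"
      by (subst (asm) nn_integral_cong[of _ _ "\<lambda>x. ennreal (?h x)"]) (auto simp: indicator_def)
    then show "(\<integral>\<^sup>+x. ennreal (?h x) \<partial>lborel) < \<infinity>" by simp
  qed auto
  have "integrable lborel (\<lambda>x. ?h (0 + (- 1) * x))"
    by (rule lborel_integrable_real_affine[OF h]) simp
  with h have "integrable lborel (\<lambda>x. 2 powr s * (?h x + ?h (0 + (- 1) * x)))"
    by (intro integrable_mult_right Bochner_Integration.integrable_add) auto
  then show ?thesis
  proof (rule Bochner_Integration.integrable_bound)
    show "AE x in lborel. norm ((1 + x\<^sup>2) powr (- s)) \<le> norm (2 powr s * (?h x + ?h (0 + (- 1) * x)))"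
    proof (rule AE_I2)
      fix x :: real
      have "(1 + \<bar>x\<bar>)\<^sup>2 \<le> 2 * (1 + x\<^sup>2)"
        using sum_squares_bound[of 1 "\<bar>x\<bar>"] by (simp add: power2_sum)
      then have "(2 * (1 + x\<^sup>2)) powr (- s) \<le> ((1 + \<bar>x\<bar>)\<^sup>2) powr (- s)"
        using s by (intro powr_mono2') auto
      also have "((1 + \<bar>x\<bar>)\<^sup>2) powr (- s) = (1 + \<bar>x\<bar>) powr (- 2 * s)"
        by (simp add: powr_powr flip: powr_numeral)
      also have "(2 * (1 + x\<^sup>2)) powr (- s) = 2 powr (- s) * (1 + x\<^sup>2) powr (- s)"
        by (rule powr_mult) 
      finally have "2 powr s * (2 powr (- s) * (1 + x\<^sup>2) powr (- s)) \<le> 2 powr s * (1 + \<bar>x\<bar>) powr (- 2 * s)"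
        by (intro mult_left_mono) auto
      then have "(1 + x\<^sup>2) powr (- s) \<le> 2 powr s * (1 + \<bar>x\<bar>) powr (- 2 * s)"
        by (simp add: mult.assoc[symmetric] flip: powr_add)
      also have "\<dots> \<le> 2 powr s * (?h x + ?h (0 + (- 1) * x))"
        by (intro mult_left_mono) (auto simp: indicator_def)
      finally show "norm ((1 + x\<^sup>2) powr (- s)) \<le> norm (2 powr s * (?h x + ?h (0 + (- 1) * x)))" by simp
    qed
  qed measurable
qed

text \<open>The exponent is shared equally among the N coordinates, and in each factor |x|^2 is
  lowered to one squared coordinate. The share \<tau> / N exceeds 1 / 2 exactly when \<tau> > N /
  2.\<close>

lemma integrable_one_plus_norm_square_powr:
  fixes \<tau> :: real
  assumes \<tau>: "\<tau> > real DIM('a) / 2"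
  shows "integrable lborel (\<lambda>x::'a::euclidean_space. (1 + (norm x)\<^sup>2) powr (- \<tau>))"
proof -
  let ?s = "\<tau> / real DIM('a)"
  have N: "real DIM('a) > 0" by simp
  have s: "?s > 1 / 2" using \<tau> N by (simp add: field_simps)
  have \<tau>0: "\<tau> > 0" using \<tau> N by (smt (verit) divide_pos_pos)
  have "integrable lborel (\<lambda>x::'a. \<Prod>b\<in>Basis. (1 + (x \<bullet> b)\<^sup>2) powr (- ?s))"
    by (rule integrable_lborel_prod_Basis) (rule integrable_one_plus_square_powr[OF s])
  then show ?thesis
  proof (rule Bochner_Integration.integrable_bound)
    show "AE x::'a in lborel. norm ((1 + (norm x)\<^sup>2) powr (- \<tau>)) \<le> norm (\<Prod>b\<in>Basis. (1 + (x \<bullet> b)\<^sup>2) powr (- ?s))"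
    proof (rule AE_I2)
      fix x :: 'a
      have "(1 + (norm x)\<^sup>2) powr (- \<tau>) = (\<Prod>b\<in>(Basis::'a set). (1 + (norm x)\<^sup>2) powr (- ?s))"
      proof -
        have "((1 + (norm x)\<^sup>2) powr (- ?s)) ^ DIM('a) = ((1 + (norm x)\<^sup>2) powr (- ?s)) powr real DIM('a)"
          using power_not_zero[of "norm x" 2] by (intro powr_realpow[symmetric]) (simp add: add_nonneg_eq_0_iff)
        also have "\<dots> = (1 + (norm x)\<^sup>2) powr (- \<tau>)" using N by (simp add: powr_powr)
        finally show ?thesis by simp
      qed
      also have "\<dots> \<le> (\<Prod>b\<in>Basis. (1 + (x \<bullet> b)\<^sup>2) powr (- ?s))"
      proof (rule prod_mono)
        fix b :: 'a assume "b \<in> Basis"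
        then have "\<bar>x \<bullet> b\<bar>\<^sup>2 \<le> (norm x)\<^sup>2" by (intro power_mono Basis_le_norm) auto
        then show "0 \<le> (1 + (norm x)\<^sup>2) powr (- ?s) \<and> (1 + (norm x)\<^sup>2) powr (- ?s) \<le> (1 + (x \<bullet> b)\<^sup>2) powr (- ?s)"
          using s by (auto intro!: powr_mono2' add_pos_nonneg)
      qed
      finally show "norm ((1 + (norm x)\<^sup>2) powr (- \<tau>)) \<le> norm (\<Prod>b\<in>Basis. (1 + (x \<bullet> b)\<^sup>2) powr (- ?s))" by simp
    qed
  qed measurable
qed

text \<open>The inequality a b \<le> a^2 + b^2 for non-negative a and b, with a = (1 +
  |\<xi>|^2)^(\<tau> / 2) |g| and b = (1 + |\<xi>|^2)^(- \<tau> / 2), plays the role of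
  Cauchy-Schwarz.\<close>

lemma sobolev_L2_imp_integrable:
  fixes \<phi> g :: "real^'n \<Rightarrow> complex"
  assumes \<tau>: "\<tau> > real CARD('n) / 2" and S: "sobolev_L2 \<tau> \<phi> g"
  shows "integrable lborel g"
proof (rule Bochner_Integration.integrable_bound)
  have [measurable]: "g \<in> borel_measurable borel"
    using S by (simp add: sobolev_L2_def is_fourier_L2_def L2_def)
  then show "g \<in> borel_measurable lborel" by simp
  show "integrable lborel (\<lambda>\<xi>. (1 + (norm \<xi>)\<^sup>2) powr \<tau> * (cmod (g \<xi>))\<^sup>2 + (1 + (norm \<xi>)\<^sup>2) powr (- \<tau>))"
    using S \<tau> integrable_one_plus_norm_square_powr[of \<tau>, where 'a="real^'n"]
    by (intro Bochner_Integration.integrable_add) (auto simp: sobolev_L2_def)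
  show "AE \<xi> in lborel. norm (g \<xi>) \<le> norm ((1 + (norm \<xi>)\<^sup>2) powr \<tau> * (cmod (g \<xi>))\<^sup>2 + (1 + (norm \<xi>)\<^sup>2) powr (- \<tau>))"
  proof (rule AE_I2)
    fix \<xi> :: "real^'n"
    let ?a = "(1 + (norm \<xi>)\<^sup>2) powr (\<tau> / 2)" and ?b = "(1 + (norm \<xi>)\<^sup>2) powr (- \<tau> / 2)"
    have p: "1 + (norm \<xi>)\<^sup>2 > 0" by (simp add: add_pos_nonneg)
    have ab: "?a * ?b = 1" using p by (simp flip: powr_add)
    have a2: "?a\<^sup>2 = (1 + (norm \<xi>)\<^sup>2) powr \<tau>" and b2: "?b\<^sup>2 = (1 + (norm \<xi>)\<^sup>2) powr (- \<tau>)"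
      by (simp_all add: power2_eq_square flip: powr_add)
    have "cmod (g \<xi>) = (?a * cmod (g \<xi>)) * ?b" using ab by (simp add: mult_ac)
    also have "\<dots> \<le> (?a * cmod (g \<xi>))\<^sup>2 + ?b\<^sup>2"
    proof -
      have "0 \<le> (?a * cmod (g \<xi>)) * ?b" by (intro mult_nonneg_nonneg) auto
      then show ?thesis using sum_squares_bound[of "?a * cmod (g \<xi>)" ?b] unfolding mult.assoc by linarith
    qed
    finally show "norm (g \<xi>) \<le> norm ((1 + (norm \<xi>)\<^sup>2) powr \<tau> * (cmod (g \<xi>))\<^sup>2 + (1 + (norm \<xi>)\<^sup>2) powr (- \<tau>))"
      unfolding power_mult_distrib a2 b2 by simp
  qed
qed

section \<open>Differentiation under the integral sign\<close>

lemma has_vector_derivative_iff_tendsto_slope: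
  "(f has_vector_derivative D) (at t) \<longleftrightarrow> ((\<lambda>s. inverse (s - t) *\<^sub>R (f s - f t)) \<longlongrightarrow> D) (at t)"
proof -
  have eq: "norm (f s - f t - (s - t) *\<^sub>R D) / norm (s - t) = norm (inverse (s - t) *\<^sub>R (f s - f t) - D)"
    if "s \<noteq> t" for s
  proof -
    have "inverse (s - t) *\<^sub>R (f s - f t) - D = inverse (s - t) *\<^sub>R (f s - f t - (s - t) *\<^sub>R D)"
      using that by (simp add: scaleR_diff_right)
    then show ?thesis by (simp add: divide_inverse mult.commute)
  qed
  have "(f has_vector_derivative D) (at t) \<longleftrightarrow> ((\<lambda>s. norm (f s - f t - (s - t) *\<^sub>R D) / norm (s - t)) \<longlongrightarrow> 0) (at t)"
    by (simp add: has_vector_derivative_def has_derivative_iff_norm bounded_linear_scaleR_left)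
  also have "\<dots> \<longleftrightarrow> ((\<lambda>s. norm (inverse (s - t) *\<^sub>R (f s - f t) - D)) \<longlongrightarrow> 0) (at t)"
    by (rule Lim_cong_within) (use eq in auto)
  also have "\<dots> \<longleftrightarrow> ((\<lambda>s. inverse (s - t) *\<^sub>R (f s - f t)) \<longlongrightarrow> D) (at t)"
    by (simp add: tendsto_norm_zero_iff LIM_zero_iff)
  finally show ?thesis .
qed

text \<open>The mean value inequality on the whole neighbourhood turns the bound on f' into the same
  bound on the difference quotients, and dominated convergence applies along every sequence.\<close>

lemma has_vector_derivative_integral_dominated:
  fixes f :: "real \<Rightarrow> 'a \<Rightarrow> 'b::{banach, second_countable_topology}"
  assumes e: "e > 0"
    and int: "\<And>s. \<bar>s - t\<bar> < e \<Longrightarrow> integrable M (f s)"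
    and der: "\<And>s x. \<bar>s - t\<bar> < e \<Longrightarrow> ((\<lambda>s. f s x) has_vector_derivative f' s x) (at s)"
    and bound: "\<And>s x. \<bar>s - t\<bar> < e \<Longrightarrow> norm (f' s x) \<le> w x"
    and meas: "f' t \<in> borel_measurable M"
    and w: "integrable M w"
  shows "((\<lambda>s. LINT x|M. f s x) has_vector_derivative (LINT x|M. f' t x)) (at t)"
proof -
  have lip: "norm (f s x - f t x) \<le> w x * \<bar>s - t\<bar>" if s: "\<bar>s - t\<bar> < e" for s x
  proof -
    have "norm (f s x - f t x) \<le> w x * norm (s - t)"
    proof (rule differentiable_bound[where S="{t - e<..<t + e}" and f'="\<lambda>s h. h *\<^sub>R f' s x"])
      fix y assume "y \<in> {t - e<..<t + e}"
      then have y: "\<bar>y - t\<bar> < e" by auto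
      show "((\<lambda>s. f s x) has_derivative (\<lambda>h. h *\<^sub>R f' y x)) (at y within {t - e<..<t + e})"
        using der[OF y, of x] by (simp add: has_vector_derivative_def has_derivative_at_withinI)
      show "onorm (\<lambda>h. h *\<^sub>R f' y x) \<le> w x"
        using bound[OF y, of x] onorm_scaleR_left[OF bounded_linear_ident, of "f' y x"] by (simp add: onorm_id)
    qed (use s e in auto)
    then show ?thesis by simp
  qed
  have "((\<lambda>s. inverse (s - t) *\<^sub>R ((LINT x|M. f s x) - (LINT x|M. f t x))) \<longlongrightarrow> (LINT x|M. f' t x)) (at t)"
    unfolding tendsto_at_iff_sequentially comp_def
  proof safe
    fix X :: "nat \<Rightarrow> real" assume X: "\<forall>i. X i \<in> UNIV - {t}" "X \<longlonglongrightarrow> t"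
    have "eventually (\<lambda>i. dist (X i) t < e) sequentially" using X(2) e by (rule tendstoD)
    then obtain N where N: "\<And>i. i \<ge> N \<Longrightarrow> \<bar>X i - t\<bar> < e"
      by (auto simp: eventually_sequentially dist_real_def)
    \<comment> \<open>Dominated convergence asks for the bound at every index, so the finitely many
      initial members are dropped.\<close>
    define Y where "Y i = X (i + N)" for i
    have Y: "Y i \<noteq> t" "\<bar>Y i - t\<bar> < e" for i using X(1) N by (auto simp: Y_def)
    have Yl: "Y \<longlonglongrightarrow> t" unfolding Y_def using X(2) by (rule LIMSEQ_ignore_initial_segment)
    have "(\<lambda>i. LINT x|M. inverse (Y i - t) *\<^sub>R (f (Y i) x - f t x)) \<longlonglongrightarrow> (LINT x|M. f' t x)"
    proof (rule integral_dominated_convergence[OF meas _ w])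
      show "(\<lambda>x. inverse (Y i - t) *\<^sub>R (f (Y i) x - f t x)) \<in> borel_measurable M" for i
        using int[OF Y(2)] int[of t] e by (intro borel_measurable_scaleR borel_measurable_diff) auto
      show "AE x in M. (\<lambda>i. inverse (Y i - t) *\<^sub>R (f (Y i) x - f t x)) \<longlonglongrightarrow> f' t x"
      proof (rule AE_I2)
        fix x
        have "((\<lambda>s. f s x) has_vector_derivative f' t x) (at t)" using e by (intro der) simp
        then have "((\<lambda>s. inverse (s - t) *\<^sub>R (f s x - f t x)) \<longlongrightarrow> f' t x) (at t)"
          by (simp add: has_vector_derivative_iff_tendsto_slope)
        then show "(\<lambda>i. inverse (Y i - t) *\<^sub>R (f (Y i) x - f t x)) \<longlonglongrightarrow> f' t x"
          unfolding tendsto_at_iff_sequentially comp_def using Y Yl by auto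
      qed
      show "AE x in M. norm (inverse (Y i - t) *\<^sub>R (f (Y i) x - f t x)) \<le> w x" for i
      proof (rule AE_I2)
        fix x show "norm (inverse (Y i - t) *\<^sub>R (f (Y i) x - f t x)) \<le> w x"
          using lip[OF Y(2), of i x] Y(1)[of i]
          by (simp add: pos_divide_le_eq divide_inverse_commute[symmetric])
      qed
    qed
    moreover have "(LINT x|M. inverse (Y i - t) *\<^sub>R (f (Y i) x - f t x)) =
        inverse (Y i - t) *\<^sub>R ((LINT x|M. f (Y i) x) - (LINT x|M. f t x))" for i
      using int[OF Y(2), of i] int[of t] e by (subst integral_scaleR_right) simp
    ultimately have "(\<lambda>i. inverse (Y i - t) *\<^sub>R ((LINT x|M. f (Y i) x) - (LINT x|M. f t x))) \<longlonglongrightarrow> (LINT x|M. f' t x)"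
      by (simp only:)
    then show "(\<lambda>i. inverse (X i - t) *\<^sub>R ((LINT x|M. f (X i) x) - (LINT x|M. f t x))) \<longlonglongrightarrow> (LINT x|M. f' t x)"
      unfolding Y_def by (rule LIMSEQ_offset)
  qed
  then show ?thesis by (simp add: has_vector_derivative_iff_tendsto_slope)
qed

section \<open>The symbol and spatial derivatives\<close>

lemma continuous_on_symbA: "continuous_on S (symbA a m)"
  unfolding symbA_def by (intro continuous_intros)

lemma symbA_scaleR: "symbA a m (c *\<^sub>R \<xi>) = c ^ m * symbA a m \<xi>"
  unfolding symbA_def sum_distrib_left
proof (rule sum.cong[OF refl])
  fix \<alpha> :: "'a \<Rightarrow> nat" assume "\<alpha> \<in> {\<alpha>. mi_order \<alpha> = m}"
  then have "(\<Prod>i\<in>UNIV. c ^ \<alpha> i) = c ^ m" by (simp add: mi_order_def flip: power_sum)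
  then show "a \<alpha> * (\<Prod>i\<in>UNIV. ((c *\<^sub>R \<xi>) $ i) ^ \<alpha> i) = c ^ m * (a \<alpha> * (\<Prod>i\<in>UNIV. (\<xi> $ i) ^ \<alpha> i))"
    by (simp add: power_mult_distrib prod.distrib mult_ac)
qed

text \<open>By homogeneity it suffices to compare on the unit sphere, where the continuous symbol
  attains a positive minimum; C is its reciprocal.\<close>

lemma symbA_coercive:
  fixes a :: "('n::finite \<Rightarrow> nat) \<Rightarrow> real"
  assumes elliptic: "\<And>\<xi>. \<xi> \<noteq> 0 \<Longrightarrow> symbA a m \<xi> > 0"
  obtains C where "C > 0" "\<And>\<xi>. norm \<xi> ^ m \<le> C * symbA a m \<xi>"
proof -
  have ne: "sphere (0::real^'n) 1 \<noteq> {}" by simp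
  obtain \<eta> :: "real^'n" where \<eta>: "\<eta> \<in> sphere 0 1" "\<And>\<xi>. \<xi> \<in> sphere 0 1 \<Longrightarrow> symbA a m \<eta> \<le> symbA a m \<xi>"
    using continuous_attains_inf[OF compact_sphere ne continuous_on_symbA] by blast
  have c: "symbA a m \<eta> > 0" using \<eta>(1) by (intro elliptic) auto
  have "norm \<xi> ^ m \<le> (1 / symbA a m \<eta>) * symbA a m \<xi>" for \<xi>
  proof -
    obtain \<zeta> where \<zeta>: "\<zeta> \<in> sphere 0 1" "\<xi> = norm \<xi> *\<^sub>R \<zeta>"
    proof (cases "\<xi> = 0")
      case True
      then show ?thesis using that[of \<eta>] \<eta>(1) by simp
    next
      case False
      then show ?thesis using that[of "\<xi> /\<^sub>R norm \<xi>"] by simp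
    qed
    have "symbA a m \<xi> = norm \<xi> ^ m * symbA a m \<zeta>" by (subst \<zeta>(2)) (rule symbA_scaleR)
    moreover have "norm \<xi> ^ m * symbA a m \<eta> \<le> norm \<xi> ^ m * symbA a m \<zeta>"
      by (intro mult_left_mono \<eta> \<zeta>) auto
    ultimately show ?thesis using c by (simp add: field_simps)
  qed
  with c show ?thesis by (intro that[of "1 / symbA a m \<eta>"]) auto
qed

definition monomial :: "('n::finite \<Rightarrow> nat) \<Rightarrow> real^'n \<Rightarrow> real" where
  "monomial \<alpha> \<xi> = (\<Prod>i\<in>UNIV. (\<xi> $ i) ^ \<alpha> i)"

lemma monomial_measurable [measurable]: "monomial \<alpha> \<in> borel_measurable borel"
  unfolding monomial_def by (intro borel_measurable_continuous_onI continuous_intros)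

lemma abs_monomial_le: "\<bar>monomial \<alpha> \<xi>\<bar> \<le> norm \<xi> ^ mi_order \<alpha>"
proof -
  have "\<bar>monomial \<alpha> \<xi>\<bar> = (\<Prod>i\<in>UNIV. \<bar>\<xi> $ i\<bar> ^ \<alpha> i)"
    unfolding monomial_def by (simp add: abs_prod power_abs)
  also have "\<dots> \<le> (\<Prod>i\<in>UNIV. norm \<xi> ^ \<alpha> i)"
    by (intro prod_mono conjI power_mono component_le_norm_cart) auto
  also have "\<dots> = norm \<xi> ^ mi_order \<alpha>" by (simp add: mi_order_def power_sum)
  finally show ?thesis .
qed

text \<open>The factor - \<i> in \<open>dpart\<close> cancels the \<i> from differentiating cis, so
  a derivative multiplies the density by the real coordinate \<open>\<xi> $ j\<close>.\<close>

lemma dpart_fourier_int: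
  fixes w :: "real^'n \<Rightarrow> complex"
  assumes w: "integrable lborel w" and w1: "integrable lborel (\<lambda>\<xi>. complex_of_real (\<xi> $ j) * w \<xi>)"
  shows "(\<lambda>s. fourier_int w (x + s *\<^sub>R axis j 1)) differentiable (at 0)"
    and "dpart j (fourier_int w) x = fourier_int (\<lambda>\<xi>. complex_of_real (\<xi> $ j) * w \<xi>) x"
proof -
  let ?e = "axis j 1 :: real^'n"
  have e: "?e \<bullet> \<xi> = \<xi> $ j" for \<xi> by (simp add: inner_commute cart_eq_inner_axis)
  have "((\<lambda>s. LINT \<xi>|lborel. w \<xi> * cis ((x + s *\<^sub>R ?e) \<bullet> \<xi>)) has_vector_derivative
      (LINT \<xi>|lborel. w \<xi> * (\<i> * complex_of_real (\<xi> $ j) * cis ((x + 0 *\<^sub>R ?e) \<bullet> \<xi>)))) (at 0)"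
  proof (rule has_vector_derivative_integral_dominated[where e=1 and w="\<lambda>\<xi>. cmod (complex_of_real (\<xi> $ j) * w \<xi>)"
        and f'="\<lambda>s \<xi>. w \<xi> * (\<i> * complex_of_real (\<xi> $ j) * cis ((x + s *\<^sub>R ?e) \<bullet> \<xi>))"])
    show "integrable lborel (\<lambda>\<xi>. w \<xi> * cis ((x + s *\<^sub>R ?e) \<bullet> \<xi>))" for s by (rule integrable_mult_cis[OF w])
    show "((\<lambda>s. w \<xi> * cis ((x + s *\<^sub>R ?e) \<bullet> \<xi>)) has_vector_derivative
       w \<xi> * (\<i> * complex_of_real (\<xi> $ j) * cis ((x + s *\<^sub>R ?e) \<bullet> \<xi>))) (at s)" for s \<xi>
    proof -
      have "((\<lambda>s. cis (x \<bullet> \<xi> + s * (\<xi> $ j))) has_vector_derivative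
         \<i> * complex_of_real (\<xi> $ j) * cis (x \<bullet> \<xi> + s * (\<xi> $ j))) (at s)"
        unfolding has_vector_derivative_def
        by (auto intro!: derivative_eq_intros simp: scaleR_conv_of_real mult_ac)
      from has_vector_derivative_mult_right[OF this, of "w \<xi>"] show ?thesis
        by (simp add: inner_add_left e)
    qed
    show "norm (w \<xi> * (\<i> * complex_of_real (\<xi> $ j) * cis ((x + s *\<^sub>R ?e) \<bullet> \<xi>)))
       \<le> cmod (complex_of_real (\<xi> $ j) * w \<xi>)" for s \<xi>
      by (simp add: norm_mult)
    have [measurable]: "w \<in> borel_measurable borel" using borel_measurable_integrable[OF w] by simp
    show "(\<lambda>\<xi>. w \<xi> * (\<i> * complex_of_real (\<xi> $ j) * cis ((x + 0 *\<^sub>R ?e) \<bullet> \<xi>))) \<in> borel_measurable lborel"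
      unfolding e[symmetric] by measurable
    show "integrable lborel (\<lambda>\<xi>. cmod (complex_of_real (\<xi> $ j) * w \<xi>))" using w1 by (rule integrable_norm)
  qed simp
  also have "(LINT \<xi>|lborel. w \<xi> * (\<i> * complex_of_real (\<xi> $ j) * cis ((x + 0 *\<^sub>R ?e) \<bullet> \<xi>))) =
     \<i> * fourier_int (\<lambda>\<xi>. complex_of_real (\<xi> $ j) * w \<xi>) x"
    unfolding fourier_int_def integral_mult_right_zero[symmetric] by (simp add: mult_ac)
  finally have d: "((\<lambda>s. fourier_int w (x + s *\<^sub>R ?e)) has_vector_derivative
      \<i> * fourier_int (\<lambda>\<xi>. complex_of_real (\<xi> $ j) * w \<xi>) x) (at 0)"
    by (simp add: fourier_int_def)
  show "(\<lambda>s. fourier_int w (x + s *\<^sub>R axis j 1)) differentiable (at 0)"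
    using d by (rule differentiableI_vector)
  show "dpart j (fourier_int w) x = fourier_int (\<lambda>\<xi>. complex_of_real (\<xi> $ j) * w \<xi>) x"
    unfolding dpart_def vector_derivative_at[OF d] by simp
qed

text \<open>Induction along the recursion of \<open>mderiv\<close>, which lowers the entry chosen by
  \<open>SOME\<close>. The lower monomials must be integrable against w too, since every
  intermediate derivative is itself a Fourier integral.\<close>

lemma mderiv_fourier_int:
  fixes w :: "real^'n \<Rightarrow> complex"
  assumes w: "\<And>\<alpha>. mi_order \<alpha> \<le> m \<Longrightarrow> integrable lborel (\<lambda>\<xi>. complex_of_real (monomial \<alpha> \<xi>) * w \<xi>)"
    and "k \<le> m" "mi_order \<alpha> = k"
  shows "(\<forall>x. mderiv_exists k \<alpha> (fourier_int w) x) \<and>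
    mderiv k \<alpha> (fourier_int w) = fourier_int (\<lambda>\<xi>. complex_of_real (monomial \<alpha> \<xi>) * w \<xi>)"
  using assms(2,3)
proof (induction k arbitrary: \<alpha>)
  case 0
  then have "\<alpha> = (\<lambda>_. 0)" by (auto simp: mi_order_def)
  then show ?case by (simp add: monomial_def)
next
  case (Suc k)
  define j where "j = (SOME j. \<alpha> j \<noteq> 0)"
  have "\<exists>j. \<alpha> j \<noteq> 0"
  proof (rule ccontr)
    assume "\<not> (\<exists>j. \<alpha> j \<noteq> 0)"
    then show False using Suc.prems(2) by (simp add: mi_order_def)
  qed
  then have j: "\<alpha> j \<noteq> 0" unfolding j_def by (rule someI_ex)
  define \<beta> where "\<beta> = \<alpha>(j := \<alpha> j - 1)"
  have "mi_order \<alpha> = \<alpha> j + (\<Sum>i\<in>UNIV - {j}. \<alpha> i)" "mi_order \<beta> = \<beta> j + (\<Sum>i\<in>UNIV - {j}. \<beta> i)"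
    unfolding mi_order_def by (auto intro: sum.remove)
  moreover have "(\<Sum>i\<in>UNIV - {j}. \<beta> i) = (\<Sum>i\<in>UNIV - {j}. \<alpha> i)"
    by (intro sum.cong) (auto simp: \<beta>_def)
  ultimately have \<beta>k: "mi_order \<beta> = k" using j Suc.prems(2) by (simp add: \<beta>_def)
  have mon: "monomial \<alpha> \<xi> = \<xi> $ j * monomial \<beta> \<xi>" for \<xi>
  proof -
    have "monomial \<alpha> \<xi> = (\<xi> $ j) ^ \<alpha> j * (\<Prod>i\<in>UNIV - {j}. (\<xi> $ i) ^ \<alpha> i)"
      "monomial \<beta> \<xi> = (\<xi> $ j) ^ \<beta> j * (\<Prod>i\<in>UNIV - {j}. (\<xi> $ i) ^ \<beta> i)"
      unfolding monomial_def by (auto intro: prod.remove)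
    moreover have "(\<Prod>i\<in>UNIV - {j}. (\<xi> $ i) ^ \<beta> i) = (\<Prod>i\<in>UNIV - {j}. (\<xi> $ i) ^ \<alpha> i)"
      by (intro prod.cong) (auto simp: \<beta>_def)
    moreover have "(\<xi> $ j) ^ \<alpha> j = \<xi> $ j * (\<xi> $ j) ^ \<beta> j" using j by (simp add: \<beta>_def power_eq_if)
    ultimately show ?thesis by simp
  qed
  have IH: "\<forall>x. mderiv_exists k \<beta> (fourier_int w) x"
      "mderiv k \<beta> (fourier_int w) = fourier_int (\<lambda>\<xi>. complex_of_real (monomial \<beta> \<xi>) * w \<xi>)"
    using Suc.IH[OF _ \<beta>k] Suc.prems(1) by auto
  have wb: "integrable lborel (\<lambda>\<xi>. complex_of_real (monomial \<beta> \<xi>) * w \<xi>)"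
    using \<beta>k Suc.prems by (intro w) auto
  have eq: "complex_of_real (\<xi> $ j) * (complex_of_real (monomial \<beta> \<xi>) * w \<xi>) = complex_of_real (monomial \<alpha> \<xi>) * w \<xi>" for \<xi>
    by (simp add: mon)
  have wa: "integrable lborel (\<lambda>\<xi>. complex_of_real (\<xi> $ j) * (complex_of_real (monomial \<beta> \<xi>) * w \<xi>))"
    unfolding eq using Suc.prems by (intro w) auto
  note D = dpart_fourier_int[OF wb wa, unfolded eq]
  show ?case
    unfolding mderiv.simps mderiv_exists.simps Let_def j_def[symmetric] \<beta>_def[symmetric] IH(2)
    using IH(1) D by (auto simp: fun_eq_iff)
qed

section \<open>The solution of the forward problem\<close>

lemma symbA_measurable [measurable]: "symbA a m \<in> borel_measurable borel"
  by (rule borel_measurable_continuous_onI[OF continuous_on_symbA])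

lemma mittag_leffler2_measurable:
  assumes "b > 0" "0 < r" "r < 1"
  shows "mittag_leffler2 r b \<in> borel_measurable borel"
  by (rule borel_measurable_continuous_onI[OF continuous_on_mittag_leffler2[OF assms]])

text \<open>Because |cis| = 1, the error is at most the integral of |w| outside the ball, and that
  bound does not depend on x.\<close>

lemma uniform_limit_fourier_int_cball:
  fixes w :: "'a::euclidean_space \<Rightarrow> complex"
  assumes w: "integrable lborel w"
  shows "uniform_limit UNIV (\<lambda>R x. LINT \<xi>:cball 0 R|lborel. w \<xi> * cis (x \<bullet> \<xi>)) (fourier_int w) at_top"
proof (rule uniform_limitI)
  fix e :: real assume e: "e > 0"
  have "integrable lborel (\<lambda>\<xi>. cmod (w \<xi>))" using w by (rule integrable_norm)
  from order_tendstoD(2)[OF integral_outside_ball_tendsto_0[OF this] e]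
  show "\<forall>\<^sub>F R in at_top. \<forall>x\<in>UNIV. dist (LINT \<xi>:cball 0 R|lborel. w \<xi> * cis (x \<bullet> \<xi>)) (fourier_int w x) < e"
  proof eventually_elim
    fix R assume R: "(LINT \<xi>|lborel. indicator (- cball 0 R) \<xi> * cmod (w \<xi>)) < e"
    show "\<forall>x\<in>UNIV. dist (LINT \<xi>:cball 0 R|lborel. w \<xi> * cis (x \<bullet> \<xi>)) (fourier_int w x) < e"
    proof
      fix x
      have i: "integrable lborel (\<lambda>\<xi>. indicator (cball 0 R) \<xi> *\<^sub>R (w \<xi> * cis (x \<bullet> \<xi>)))"
        by (intro integrable_mult_indicator integrable_mult_cis w) auto
      have "fourier_int w x - (LINT \<xi>:cball 0 R|lborel. w \<xi> * cis (x \<bullet> \<xi>)) =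
          (LINT \<xi>|lborel. w \<xi> * cis (x \<bullet> \<xi>) - indicator (cball 0 R) \<xi> *\<^sub>R (w \<xi> * cis (x \<bullet> \<xi>)))"
        unfolding fourier_int_def set_lebesgue_integral_def
        by (rule Bochner_Integration.integral_diff[OF integrable_mult_cis[OF w] i, symmetric])
      also have "cmod \<dots> \<le> (LINT \<xi>|lborel. cmod (w \<xi> * cis (x \<bullet> \<xi>) - indicator (cball 0 R) \<xi> *\<^sub>R (w \<xi> * cis (x \<bullet> \<xi>))))"
        by (rule integral_norm_bound)
      also have "\<dots> = (LINT \<xi>|lborel. indicator (- cball 0 R) \<xi> * cmod (w \<xi>))"
        by (intro Bochner_Integration.integral_cong refl) (auto simp: indicator_def norm_mult)
      finally show "dist (LINT \<xi>:cball 0 R|lborel. w \<xi> * cis (x \<bullet> \<xi>)) (fourier_int w x) < e"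
        using R by (simp add: dist_norm norm_minus_commute)
    qed
  qed
qed

context
  fixes a :: "('n::finite \<Rightarrow> nat) \<Rightarrow> real" and l :: nat and \<rho> C :: real
    and g :: "real^'n \<Rightarrow> complex"
  assumes rho: "0 < \<rho>" "\<rho> < 1"
    and C: "C > 0" "\<And>\<xi>. norm \<xi> ^ (2 * l) \<le> C * symbA a (2 * l) \<xi>"
    and g: "integrable lborel g"
begin

private abbreviation (input) "A \<equiv> symbA a (2 * l)"
text \<open>E is the Fourier multiplier of the solution; G enters through its time derivative -
  A(\<xi>) t^(\<rho> - 1) G.\<close>

private definition "E t \<xi> = mittag_leffler \<rho> (- A \<xi> * t powr \<rho>)"
private definition "G t \<xi> = mittag_leffler2 \<rho> \<rho> (- A \<xi> * t powr \<rho>)"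
private abbreviation (input) "sol \<equiv> \<lambda>t \<xi>. complex_of_real (E t \<xi>) * g \<xi>"
private abbreviation (input) "Asol \<equiv> \<lambda>t \<xi>. complex_of_real (A \<xi> * E t \<xi>) * g \<xi>"
private abbreviation (input) "dsol \<equiv> \<lambda>t \<xi>. complex_of_real (A \<xi> * (t powr (\<rho> - 1) * G t \<xi>)) * g \<xi>"

private lemma A_nonneg: "A \<xi> \<ge> 0"
  using C(1) C(2)[of \<xi>] zero_le_power[of "norm \<xi>" "2 * l"]
  by (metis norm_ge_zero order_trans zero_le_mult_iff not_less)

private lemma g_meas [measurable]: "g \<in> borel_measurable borel"
  using borel_measurable_integrable[OF g] by simp

private lemma E_meas [measurable]: "E t \<in> borel_measurable borel"
proof -
  have [measurable]: "mittag_leffler \<rho> \<in> borel_measurable borel"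
    using mittag_leffler2_measurable[of 1 \<rho>] rho by (simp add: mittag_leffler2_1)
  show ?thesis unfolding E_def by measurable
qed

text \<open>Joint measurability in \<xi> and time, for Fubini's theorem in the Caputo
  integral.\<close>

private lemma G_meas_pair [measurable]: "(\<lambda>p. G (snd p) (fst p)) \<in> borel_measurable (borel \<Otimes>\<^sub>M borel)"
proof -
  have [measurable]: "mittag_leffler2 \<rho> \<rho> \<in> borel_measurable borel"
    using mittag_leffler2_measurable[of \<rho> \<rho>] rho by simp
  show ?thesis unfolding G_def by measurable
qed

private lemma G_meas [measurable]: "G t \<in> borel_measurable borel"
proof -
  have [measurable]: "mittag_leffler2 \<rho> \<rho> \<in> borel_measurable borel"
    using mittag_leffler2_measurable[of \<rho> \<rho>] rho by simp
  show ?thesis unfolding G_def by measurable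
qed

private lemma E_bounds: "0 \<le> E t \<xi>" "E t \<xi> \<le> 1"
  using mittag_leffler_neg_nonneg[OF rho, of "A \<xi> * t powr \<rho>"]
    mittag_leffler_neg_le_1[OF rho, of "A \<xi> * t powr \<rho>"] A_nonneg[of \<xi>] by (auto simp: E_def)

private lemma G_nonneg: "0 \<le> G t \<xi>"
  using mittag_leffler2_neg_pos[OF rho, of "A \<xi> * t powr \<rho>"] A_nonneg[of \<xi>] by (auto simp: G_def)

text \<open>Smoothing for positive times: the factor A(\<xi>) costs t^(- \<rho>) but no decay of g.
  It pays for the 2 l derivatives in x although g is merely integrable.\<close>

private lemma AE_bound:
  assumes "t > 0"
  shows "A \<xi> * E t \<xi> \<le> Gamma (\<rho> + 1) * t powr (- \<rho>)"
proof -
  have "(A \<xi> * t powr \<rho>) * E t \<xi> \<le> Gamma (\<rho> + 1)"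
    using times_mittag_leffler_neg_le[OF rho, of "A \<xi> * t powr \<rho>"] A_nonneg[of \<xi>] by (simp add: E_def)
  then have "(A \<xi> * t powr \<rho>) * E t \<xi> * t powr (- \<rho>) \<le> Gamma (\<rho> + 1) * t powr (- \<rho>)"
    by (intro mult_right_mono) auto
  moreover have "t powr \<rho> * t powr (- \<rho>) = 1" using assms by (simp flip: powr_add)
  ultimately show ?thesis by (simp add: mult_ac) (simp add: mult.assoc[symmetric])
qed

private lemma AG_bound:
  assumes "t > 0"
  shows "A \<xi> * (t powr (\<rho> - 1) * G t \<xi>) \<le> \<rho> / t"
proof -
  have "(A \<xi> * t powr \<rho>) * G t \<xi> \<le> \<rho>"
    using times_mittag_leffler2_neg_le[OF rho, of "A \<xi> * t powr \<rho>"] A_nonneg[of \<xi>] by (simp add: G_def)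
  moreover have "t powr (\<rho> - 1) = t powr \<rho> / t" using assms by (simp add: powr_diff)
  ultimately show ?thesis using assms by (simp add: divide_right_mono mult_ac)
qed

private lemma sol_bound: "cmod (sol t \<xi>) \<le> cmod (g \<xi>)"
  using E_bounds[of t \<xi>] by (simp add: norm_mult mult_left_le_one_le)

private lemma integrable_sol: "integrable lborel (sol t)"
  by (rule Bochner_Integration.integrable_bound[OF g]) (use sol_bound in auto)

private lemma Asol_bound:
  assumes "t > 0"
  shows "cmod (Asol t \<xi>) \<le> Gamma (\<rho> + 1) * t powr (- \<rho>) * cmod (g \<xi>)"
  using AE_bound[OF assms, of \<xi>] E_bounds[of t \<xi>] A_nonneg[of \<xi>]
  by (auto simp: norm_mult abs_mult intro: mult_right_mono)

private lemma integrable_Asol: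
  assumes "t > 0"
  shows "integrable lborel (Asol t)"
proof (rule Bochner_Integration.integrable_bound)
  show "integrable lborel (\<lambda>\<xi>. Gamma (\<rho> + 1) * t powr (- \<rho>) * cmod (g \<xi>))" using g by auto
  show "AE \<xi> in lborel. norm (Asol t \<xi>) \<le> norm (Gamma (\<rho> + 1) * t powr (- \<rho>) * cmod (g \<xi>))"
    using Asol_bound[OF assms] by (intro AE_I2) (metis abs_ge_self order_trans real_norm_def)
qed measurable

private lemma integrable_monomial_sol:
  assumes t: "t > 0" and \<alpha>: "mi_order \<alpha> \<le> 2 * l"
  shows "integrable lborel (\<lambda>\<xi>. complex_of_real (monomial \<alpha> \<xi>) * sol t \<xi>)"
proof (rule Bochner_Integration.integrable_bound)
  \<comment> \<open>A monomial of order at most 2 l is bounded by 1 + |\<xi>|^(2 l) \<le> 1 + C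
    A(\<xi>); the two summands bound E and C A(\<xi>) E.\<close>
  let ?K = "1 + C * (Gamma (\<rho> + 1) * t powr (- \<rho>))"
  show "integrable lborel (\<lambda>\<xi>. ?K * cmod (g \<xi>))" using g by auto
  show "AE \<xi> in lborel. norm (complex_of_real (monomial \<alpha> \<xi>) * sol t \<xi>) \<le> norm (?K * cmod (g \<xi>))"
  proof (rule AE_I2)
    fix \<xi> :: "real^'n"
    have "\<bar>monomial \<alpha> \<xi>\<bar> \<le> norm \<xi> ^ mi_order \<alpha>" by (rule abs_monomial_le)
    also have "\<dots> \<le> 1 + norm \<xi> ^ (2 * l)"
    proof (cases "norm \<xi> \<le> 1")
      case True
      then have "norm \<xi> ^ mi_order \<alpha> \<le> 1" by (intro power_le_one) auto
      then show ?thesis by (meson add_increasing2 norm_ge_zero zero_le_power)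
    next
      case False
      then have "norm \<xi> ^ mi_order \<alpha> \<le> norm \<xi> ^ (2 * l)" using \<alpha> by (intro power_increasing) auto
      then show ?thesis by simp
    qed
    also have "\<dots> \<le> 1 + C * A \<xi>" using C(2) by simp
    finally have "\<bar>monomial \<alpha> \<xi>\<bar> * E t \<xi> \<le> (1 + C * A \<xi>) * E t \<xi>"
      using E_bounds(1) by (rule mult_right_mono)
    also have "\<dots> = E t \<xi> + C * (A \<xi> * E t \<xi>)" by (simp add: algebra_simps)
    also have "\<dots> \<le> ?K" using E_bounds(2) AE_bound[OF t] C(1) by (intro add_mono mult_left_mono) auto
    finally have "\<bar>monomial \<alpha> \<xi>\<bar> * E t \<xi> * cmod (g \<xi>) \<le> ?K * cmod (g \<xi>)"
      by (rule mult_right_mono) simp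
    then show "norm (complex_of_real (monomial \<alpha> \<xi>) * sol t \<xi>) \<le> norm (?K * cmod (g \<xi>))"
      using E_bounds(1)[of t \<xi>] by (simp add: norm_mult mult.assoc)
  qed
qed measurable

private lemma Dmi_sol:
  assumes "t > 0" "mi_order \<alpha> \<le> 2 * l"
  shows "Dmi_exists \<alpha> (fourier_int (sol t)) x"
    and "Dmi \<alpha> (fourier_int (sol t)) = fourier_int (\<lambda>\<xi>. complex_of_real (monomial \<alpha> \<xi>) * sol t \<xi>)"
  using mderiv_fourier_int[of "2 * l" "sol t" "mi_order \<alpha>" \<alpha>] integrable_monomial_sol[OF assms(1)] assms(2)
  by (auto simp: Dmi_exists_def Dmi_def)

private lemma opA_sol:
  assumes t: "t > 0"
  shows "opA a (2 * l) (fourier_int (sol t)) x = fourier_int (Asol t) x"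
proof -
  let ?I = "{\<alpha> :: 'n \<Rightarrow> nat. mi_order \<alpha> = 2 * l}"
  have "opA a (2 * l) (fourier_int (sol t)) x =
      (\<Sum>\<alpha>\<in>?I. LINT \<xi>|lborel. complex_of_real (a \<alpha>) * (complex_of_real (monomial \<alpha> \<xi>) * sol t \<xi> * cis (x \<bullet> \<xi>)))"
    unfolding opA_def by (intro sum.cong refl) (use Dmi_sol(2)[OF t] in \<open>simp add: fourier_int_def\<close>)
  also have "\<dots> = (LINT \<xi>|lborel. (\<Sum>\<alpha>\<in>?I. complex_of_real (a \<alpha>) * (complex_of_real (monomial \<alpha> \<xi>) * sol t \<xi> * cis (x \<bullet> \<xi>))))"
    by (intro Bochner_Integration.integral_sum[symmetric] integrable_mult_right integrable_mult_cis integrable_monomial_sol[OF t]) simp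
  also have "\<dots> = fourier_int (Asol t) x"
    unfolding fourier_int_def
    by (intro Bochner_Integration.integral_cong refl)
       (simp add: symbA_def monomial_def sum_distrib_right sum_distrib_left of_real_sum mult_ac)
  finally show ?thesis .
qed

private lemma E_tendsto:
  assumes "X \<longlonglongrightarrow> t" "\<And>n::nat. X n \<ge> 0" "t \<ge> 0"
  shows "(\<lambda>n. E (X n) \<xi>) \<longlonglongrightarrow> E t \<xi>"
proof -
  have "continuous_on {0..} (\<lambda>t::real. t powr \<rho>)"
    using rho by (intro continuous_on_powr' continuous_intros) auto
  then have "(\<lambda>n. X n powr \<rho>) \<longlonglongrightarrow> t powr \<rho>"
    using assms unfolding continuous_on_sequentially comp_def by auto
  then have "(\<lambda>n. - A \<xi> * X n powr \<rho>) \<longlonglongrightarrow> - A \<xi> * t powr \<rho>" by (intro tendsto_mult tendsto_const)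
  moreover have "isCont (mittag_leffler \<rho>) (- A \<xi> * t powr \<rho>)"
    by (rule DERIV_isCont[OF mittag_leffler_has_real_derivative[OF rho]])
  ultimately show ?thesis unfolding E_def by (rule isCont_tendsto_compose[rotated])
qed

private lemma continuous_on_sol: "continuous_on {0..T} (\<lambda>t. fourier_int (sol t) x)"
  unfolding continuous_on_sequentially comp_def
proof safe
  fix X t assume X: "\<forall>n::nat. X n \<in> {0..T}" and t: "t \<in> {0..T}" and lim: "X \<longlonglongrightarrow> t"
  show "(\<lambda>n. fourier_int (sol (X n)) x) \<longlonglongrightarrow> fourier_int (sol t) x"
    unfolding fourier_int_def
  proof (rule integral_dominated_convergence[where w="\<lambda>\<xi>. cmod (g \<xi>)"])
    show "AE \<xi> in lborel. (\<lambda>n. sol (X n) \<xi> * cis (x \<bullet> \<xi>)) \<longlonglongrightarrow> sol t \<xi> * cis (x \<bullet> \<xi>)"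
      using X t by (intro AE_I2 tendsto_mult tendsto_const tendsto_of_real E_tendsto lim) auto
    show "AE \<xi> in lborel. norm (sol (X n) \<xi> * cis (x \<bullet> \<xi>)) \<le> cmod (g \<xi>)" for n
    proof (rule AE_I2)
      fix \<xi> show "norm (sol (X n) \<xi> * cis (x \<bullet> \<xi>)) \<le> cmod (g \<xi>)"
        using sol_bound[of "X n" \<xi>] by (simp only: norm_mult[of _ "cis _"] norm_cis mult_1_right)
    qed
  qed (use g in auto)
qed

private lemma continuous_on_Asol: "continuous_on (UNIV \<times> {0<..T}) (\<lambda>(x, t). fourier_int (Asol t) x)"
  unfolding continuous_on_sequentially comp_def
proof safe
  fix X :: "nat \<Rightarrow> (real^'n) \<times> real" and x t
  assume X: "\<forall>n. X n \<in> UNIV \<times> {0<..T}" and t: "t \<in> {0<..T}" and lim: "X \<longlonglongrightarrow> (x, t)"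
  have l1: "(\<lambda>n. fst (X n)) \<longlonglongrightarrow> x" using tendsto_fst[OF lim] by simp
  have l2: "(\<lambda>n. snd (X n)) \<longlonglongrightarrow> t" using tendsto_snd[OF lim] by simp
  have pos: "snd (X n) > 0" for n using X[rule_format, of n] by (auto simp: mem_Times_iff)
  \<comment> \<open>The bound t^(- \<rho>) on the integrand blows up at 0, so the sequence is cut to
    times above t / 2.\<close>
  have "eventually (\<lambda>n. snd (X n) > t / 2) sequentially"
    using l2 t by (intro order_tendstoD(1)) auto
  then obtain N where N: "\<And>n. n \<ge> N \<Longrightarrow> snd (X n) > t / 2" by (auto simp: eventually_sequentially)
  define Y where "Y n = X (n + N)" for n
  have Y1: "(\<lambda>n. fst (Y n)) \<longlonglongrightarrow> x" and Y2: "(\<lambda>n. snd (Y n)) \<longlonglongrightarrow> t"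
    unfolding Y_def by (rule LIMSEQ_ignore_initial_segment[OF l1], rule LIMSEQ_ignore_initial_segment[OF l2])
  have Ypos: "snd (Y n) > t / 2" "snd (Y n) > 0" for n using N pos by (auto simp: Y_def)
  let ?K = "Gamma (\<rho> + 1) * (t / 2) powr (- \<rho>)"
  have G0: "Gamma (\<rho> + 1) > 0" using rho by (intro Gamma_real_pos) auto
  have "(\<lambda>n. fourier_int (Asol (snd (Y n))) (fst (Y n))) \<longlonglongrightarrow> fourier_int (Asol t) x"
    unfolding fourier_int_def
  proof (rule integral_dominated_convergence[where w="\<lambda>\<xi>. ?K * cmod (g \<xi>)"])
    show "AE \<xi> in lborel. (\<lambda>n. Asol (snd (Y n)) \<xi> * cis (fst (Y n) \<bullet> \<xi>)) \<longlonglongrightarrow> Asol t \<xi> * cis (x \<bullet> \<xi>)"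
      using Ypos t by (intro AE_I2 tendsto_intros E_tendsto Y1 Y2) (auto intro: less_imp_le)
    show "AE \<xi> in lborel. norm (Asol (snd (Y n)) \<xi> * cis (fst (Y n) \<bullet> \<xi>)) \<le> ?K * cmod (g \<xi>)" for n
    proof (rule AE_I2)
      fix \<xi>
      have "snd (Y n) powr (- \<rho>) \<le> (t / 2) powr (- \<rho>)"
        using Ypos[of n] t rho by (intro powr_mono2') auto
      then have "Gamma (\<rho> + 1) * snd (Y n) powr (- \<rho>) * cmod (g \<xi>) \<le> ?K * cmod (g \<xi>)"
        using G0 by (intro mult_right_mono mult_left_mono) auto
      with Asol_bound[OF Ypos(2)[of n], of \<xi>]
      show "norm (Asol (snd (Y n)) \<xi> * cis (fst (Y n) \<bullet> \<xi>)) \<le> ?K * cmod (g \<xi>)"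
        by (simp only: norm_mult[of _ "cis _"] norm_cis mult_1_right)
    qed
  qed (use g in auto)
  then have "(\<lambda>n. fourier_int (Asol (snd (X n))) (fst (X n))) \<longlonglongrightarrow> fourier_int (Asol t) x"
    unfolding Y_def by (rule LIMSEQ_offset)
  then show "(\<lambda>n. case X n of (x, t) \<Rightarrow> fourier_int (Asol t) x) \<longlonglongrightarrow> fourier_int (Asol t) x"
    by (simp add: case_prod_beta)
qed

private lemma E_has_derivative:
  assumes "s > 0"
  shows "((\<lambda>s. E s \<xi>) has_real_derivative - (A \<xi> * (s powr (\<rho> - 1) * G s \<xi>))) (at s)"
proof -
  have "((\<lambda>s. - A \<xi> * s powr \<rho>) has_real_derivative - A \<xi> * (\<rho> * s powr (\<rho> - 1))) (at s)"
    using assms by (auto intro!: derivative_eq_intros)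
  from DERIV_chain2[OF mittag_leffler_has_real_derivative[OF rho] this]
  show ?thesis using rho by (simp add: E_def G_def mult_ac)
qed

private lemma sol_has_vector_derivative:
  assumes t: "t > 0"
  shows "((\<lambda>s. fourier_int (sol s) x) has_vector_derivative - fourier_int (dsol t) x) (at t)"
proof -
  let ?d = "\<lambda>s \<xi>. complex_of_real (- (A \<xi> * (s powr (\<rho> - 1) * G s \<xi>))) * (g \<xi> * cis (x \<bullet> \<xi>))"
  have "((\<lambda>s. LINT \<xi>|lborel. sol s \<xi> * cis (x \<bullet> \<xi>)) has_vector_derivative (LINT \<xi>|lborel. ?d t \<xi>)) (at t)"
  \<comment> \<open>For times s above t / 2 the bound \<rho> / s from \<open>AG_bound\<close> is at
    most 2 \<rho> / t.\<close>
  proof (rule has_vector_derivative_integral_dominated[where e="t / 2" and w="\<lambda>\<xi>. 2 * \<rho> / t * cmod (g \<xi>)" and f'="?d"])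
    show "t / 2 > 0" using t by simp
    show "integrable lborel (\<lambda>\<xi>. sol s \<xi> * cis (x \<bullet> \<xi>))" for s
      by (rule integrable_mult_cis[OF integrable_sol])
    fix s \<xi> assume "\<bar>s - t\<bar> < t / 2"
    then have s: "s > t / 2" "s > 0" using t by linarith+
    have "((\<lambda>s. complex_of_real (E s \<xi>) * (g \<xi> * cis (x \<bullet> \<xi>))) has_vector_derivative ?d s \<xi>) (at s)"
      by (intro has_vector_derivative_mult_left has_vector_derivative_of_real)
         (use E_has_derivative[OF s(2)] in \<open>simp add: has_real_derivative_iff_has_vector_derivative\<close>)
    then show "((\<lambda>s. sol s \<xi> * cis (x \<bullet> \<xi>)) has_vector_derivative ?d s \<xi>) (at s)" by (simp add: mult.assoc)
    have "A \<xi> * (s powr (\<rho> - 1) * G s \<xi>) \<le> \<rho> / s" by (rule AG_bound[OF s(2)])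
    also have "\<dots> \<le> \<rho> / (t / 2)" using s t rho by (intro divide_left_mono) auto
    finally have "A \<xi> * (s powr (\<rho> - 1) * G s \<xi>) * cmod (g \<xi>) \<le> 2 * \<rho> / t * cmod (g \<xi>)"
      by (intro mult_right_mono) (auto simp: mult_ac)
    moreover have "cmod (?d s \<xi>) = A \<xi> * (s powr (\<rho> - 1) * G s \<xi>) * cmod (g \<xi>)"
      using A_nonneg[of \<xi>] G_nonneg[of s \<xi>] by (simp add: norm_mult)
    ultimately show "norm (?d s \<xi>) \<le> 2 * \<rho> / t * cmod (g \<xi>)" by simp
  next
    show "?d t \<in> borel_measurable lborel" by measurable
    show "integrable lborel (\<lambda>\<xi>. 2 * \<rho> / t * cmod (g \<xi>))" using g by auto
  qed
  also have "(LINT \<xi>|lborel. ?d t \<xi>) = - fourier_int (dsol t) x"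
    unfolding fourier_int_def by (simp add: mult.assoc)
  finally show ?thesis by (simp add: fourier_int_def)
qed

text \<open>The pointwise bound \<rho> / s for the time derivative is not integrable at s = 0.
  Fubini's theorem is therefore based on the exact kernel integral: k is non-negative with integral
  Gamma(1 - \<rho>) E, and A E |g| is integrable for t > 0.\<close>

private lemma caputo_sol:
  assumes t: "t > 0"
  shows "caputo_exists \<rho> (\<lambda>s. fourier_int (sol s) x) t"
    and "caputo \<rho> (\<lambda>s. fourier_int (sol s) x) t = - fourier_int (Asol t) x"
proof -
  define k where "k \<xi> s = indicator {0<..<t} s * ((t - s) powr (- \<rho>) * (s powr (\<rho> - 1) * G s \<xi>))" for \<xi> s
  have k0: "k \<xi> s \<ge> 0" for \<xi> s unfolding k_def using G_nonneg by (intro mult_nonneg_nonneg) auto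
  have hb: "has_bochner_integral lborel (k \<xi>) (Gamma (1 - \<rho>) * E t \<xi>)" for \<xi>
    unfolding k_def E_def G_def by (rule has_bochner_integral_mittag_leffler[OF rho t])
  define F where "F = (\<lambda>p. complex_of_real (A (fst p)) * g (fst p) * cis (x \<bullet> fst p) * complex_of_real (k (fst p) (snd p)))"
  have [measurable]: "(\<lambda>p. k (fst p) (snd p)) \<in> borel_measurable (borel \<Otimes>\<^sub>M borel)"
    unfolding k_def by measurable
  have Gp: "Gamma (1 - \<rho>) > 0" using rho by (intro Gamma_real_pos) auto
  have FI: "integrable (lborel \<Otimes>\<^sub>M lborel) F"
  proof (rule lborel_pair.Fubini_integrable)
    show "F \<in> borel_measurable (lborel \<Otimes>\<^sub>M lborel)" unfolding F_def by measurable
    have "(LINT s|lborel. norm (F (\<xi>, s))) = Gamma (1 - \<rho>) * cmod (Asol t \<xi>)" for \<xi>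
    proof -
      have "(LINT s|lborel. norm (F (\<xi>, s))) = (LINT s|lborel. (A \<xi> * cmod (g \<xi>)) * k \<xi> s)"
        using A_nonneg[of \<xi>] k0[of \<xi>] by (simp add: F_def norm_mult)
      also have "\<dots> = (A \<xi> * cmod (g \<xi>)) * (Gamma (1 - \<rho>) * E t \<xi>)"
        using hb[of \<xi>] by (simp add: has_bochner_integral_iff)
      finally show ?thesis using A_nonneg[of \<xi>] E_bounds(1)[of t \<xi>] by (simp add: norm_mult)
    qed
    then show "integrable lborel (\<lambda>\<xi>. LINT s|lborel. norm (F (\<xi>, s)))"
      using integrable_norm[OF integrable_Asol[OF t]] by (simp only: integrable_mult_right)
    show "AE \<xi> in lborel. integrable lborel (\<lambda>s. F (\<xi>, s))"
    proof (rule AE_I2)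
      fix \<xi>
      have "integrable lborel (\<lambda>s. complex_of_real (k \<xi> s))"
        using hb[of \<xi>] by (intro integrable_of_real) (simp add: has_bochner_integral_iff)
      then show "integrable lborel (\<lambda>s. F (\<xi>, s))" unfolding F_def by simp
    qed
  qed
  then have FI': "integrable (lborel \<Otimes>\<^sub>M lborel) (\<lambda>(\<xi>, s). F (\<xi>, s))" by simp
  have vd: "vector_derivative (\<lambda>s. fourier_int (sol s) x) (at s) = - fourier_int (dsol s) x" if "s > 0" for s
    by (rule vector_derivative_at[OF sol_has_vector_derivative[OF that]])
  \<comment> \<open>Both sides vanish off the open interval, which turns the integral behind
    \<open>caputo\<close> into one over the whole line, ready for Fubini's theorem; the kernel
    exponent reduces to - \<rho>.\<close>
  have eq: "indicator {0<..<t} s *\<^sub>R ((t - s) powr (- (\<rho> - 1) - 1) *\<^sub>R vector_derivative (\<lambda>s. fourier_int (sol s) x) (at s))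
     = - (LINT \<xi>|lborel. F (\<xi>, s))" for s
  proof (cases "s \<in> {0<..<t}")
    case True
    have "(LINT \<xi>|lborel. F (\<xi>, s)) = (LINT \<xi>|lborel. complex_of_real ((t - s) powr (- \<rho>)) * (dsol s \<xi> * cis (x \<bullet> \<xi>)))"
      using True by (simp add: F_def k_def mult_ac)
    also have "\<dots> = (t - s) powr (- \<rho>) *\<^sub>R fourier_int (dsol s) x"
      unfolding fourier_int_def scaleR_conv_of_real by (rule integral_mult_right_zero)
    finally show ?thesis using True vd[of s] by simp
  next
    case False
    then show ?thesis by (simp add: F_def k_def)
  qed
  have "integrable lborel (\<lambda>s. LINT \<xi>|lborel. F (\<xi>, s))"
    by (rule lborel_pair.integrable_snd[OF FI'])
  then have "rl_integral_exists (\<rho> - 1) (\<lambda>s. vector_derivative (\<lambda>s. fourier_int (sol s) x) (at s)) t"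
    unfolding rl_integral_exists_def set_integrable_def eq by simp
  moreover have "(\<lambda>s. fourier_int (sol s) x) differentiable (at s)" if "s > 0" for s
    by (rule differentiableI_vector[OF sol_has_vector_derivative[OF that]])
  ultimately show "caputo_exists \<rho> (\<lambda>s. fourier_int (sol s) x) t"
    by (simp add: caputo_exists_def)
  have "(LINT s|lborel. LINT \<xi>|lborel. F (\<xi>, s)) = (LINT \<xi>|lborel. LINT s|lborel. F (\<xi>, s))"
    by (rule lborel_pair.Fubini_integral[OF FI'])
  also have "\<dots> = (LINT \<xi>|lborel. complex_of_real (Gamma (1 - \<rho>)) * (Asol t \<xi> * cis (x \<bullet> \<xi>)))"
  proof (intro Bochner_Integration.integral_cong refl)
    fix \<xi>
    have "(LINT s|lborel. F (\<xi>, s)) =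
        complex_of_real (A \<xi>) * g \<xi> * cis (x \<bullet> \<xi>) * complex_of_real (LINT s|lborel. k \<xi> s)"
      unfolding F_def fst_conv snd_conv by (simp only: integral_mult_right_zero integral_complex_of_real)
    also have "(LINT s|lborel. k \<xi> s) = Gamma (1 - \<rho>) * E t \<xi>"
      using hb[of \<xi>] by (rule has_bochner_integral_integral_eq)
    finally show "(LINT s|lborel. F (\<xi>, s)) = complex_of_real (Gamma (1 - \<rho>)) * (Asol t \<xi> * cis (x \<bullet> \<xi>))"
      by (simp add: mult_ac)
  qed
  also have "\<dots> = complex_of_real (Gamma (1 - \<rho>)) * fourier_int (Asol t) x"
    unfolding fourier_int_def by (rule integral_mult_right_zero)
  finally have I: "(LINT s|lborel. LINT \<xi>|lborel. F (\<xi>, s)) = complex_of_real (Gamma (1 - \<rho>)) * fourier_int (Asol t) x" .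
  have "1 - \<rho> = - (\<rho> - 1)" by simp
  then show "caputo \<rho> (\<lambda>s. fourier_int (sol s) x) t = - fourier_int (Asol t) x"
    unfolding caputo_def rl_integral_def set_lebesgue_integral_def eq
    using I Gp by (simp add: scaleR_conv_of_real)
qed

lemma mittag_leffler_fourier_solution:
  assumes T: "T > 0" and init: "AE x in lborel. fourier_int g x = \<phi> x"
  shows "classical_solution \<rho> a l T \<phi>
      (\<lambda>x t. fourier_int (\<lambda>\<xi>. complex_of_real (mittag_leffler \<rho> (- symbA a (2 * l) \<xi> * t powr \<rho>)) * g \<xi>) x)"
    and "integrable lborel (\<lambda>\<xi>. complex_of_real (mittag_leffler \<rho> (- symbA a (2 * l) \<xi> * t powr \<rho>)) * g \<xi>)"
  unfolding E_def[symmetric]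
proof -
  show "integrable lborel (sol t)" by (rule integrable_sol)
  \<comment> \<open>Because \<open>0 powr \<rho> = 0\<close>, the multiplier at t = 0 is E_\<rho>(0)
    = 1.\<close>
  have "AE x in lborel. fourier_int (sol 0) x = \<phi> x"
    using init by (simp add: E_def mittag_leffler_0[OF rho])
  moreover have "continuous_on (UNIV \<times> {0<..T}) (\<lambda>(x, t). caputo \<rho> (\<lambda>s. fourier_int (sol s) x) t)"
  proof (rule continuous_on_eq)
    show "continuous_on (UNIV \<times> {0<..T}) (\<lambda>p. - (case p of (x, t) \<Rightarrow> fourier_int (Asol t) x))"
      by (intro continuous_on_minus continuous_on_Asol)
  qed (auto simp: caputo_sol(2))
  moreover have "continuous_on (UNIV \<times> {0<..T}) (\<lambda>(x, t). opA a (2 * l) (\<lambda>y. fourier_int (sol t) y) x)"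
    by (rule continuous_on_eq[OF continuous_on_Asol]) (auto simp: opA_sol)
  moreover have "((\<lambda>x. Dmi \<alpha> (\<lambda>y. fourier_int (sol t) y) x) \<longlongrightarrow> 0) at_infinity"
    if "t \<in> {0<..T}" "mi_order \<alpha> + 1 \<le> l" for t \<alpha>
  proof -
    have "mi_order \<alpha> \<le> 2 * l" "t > 0" using that by auto
    then show ?thesis using Riemann_Lebesgue[OF integrable_monomial_sol] Dmi_sol(2) by simp
  qed
  ultimately show "classical_solution \<rho> a l T \<phi> (\<lambda>x t. fourier_int (sol t) x)"
    unfolding classical_solution_def
    using continuous_on_sol Dmi_sol(1) caputo_sol opA_sol by auto
qed

end

theorem theorem1:
  fixes a :: "('n::finite \<Rightarrow> nat) \<Rightarrow> real"
    and l :: nat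
    and \<tau> \<rho> T :: real
    and \<phi> \<phi>_hat :: "real^'n \<Rightarrow> complex"
    and u :: "real^'n \<Rightarrow> real \<Rightarrow> complex"
  assumes elliptic: "\<And>\<xi>. \<xi> \<noteq> 0 \<Longrightarrow> symbA a (2 * l) \<xi> > 0"
    and tau: "\<tau> > real CARD('n) / 2"
    and sobolev: "sobolev_L2 \<tau> \<phi> \<phi>_hat"
    and rho: "0 < \<rho>" "\<rho> < 1"
    and T: "T > 0"
    and u_def: "\<And>x t. u x t =
          (LINT \<xi>|lborel. complex_of_real (mittag_leffler \<rho> (- symbA a (2 * l) \<xi> * t powr \<rho>))
                              * \<phi>_hat \<xi> * cis (x \<bullet> \<xi>))"
  shows "classical_solution \<rho> a l T \<phi> u \<and>
         (\<forall>t\<in>{0<..T}.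
            (\<forall>x. integrable lborel (\<lambda>\<xi>. complex_of_real (mittag_leffler \<rho> (- symbA a (2 * l) \<xi> * t powr \<rho>))
                              * \<phi>_hat \<xi> * cis (x \<bullet> \<xi>))) \<and>
            uniform_limit UNIV
              (\<lambda>R x. LINT \<xi>:cball 0 R|lborel.
                        complex_of_real (mittag_leffler \<rho> (- symbA a (2 * l) \<xi> * t powr \<rho>))
                          * \<phi>_hat \<xi> * cis (x \<bullet> \<xi>))
              (\<lambda>x. u x t) at_top)"
proof -
  obtain C where C: "C > 0" "\<And>\<xi>. norm \<xi> ^ (2 * l) \<le> C * symbA a (2 * l) \<xi>"
    using symbA_coercive[OF elliptic] by blast
  have g: "integrable lborel \<phi>_hat" by (rule sobolev_L2_imp_integrable[OF tau sobolev])
  have init: "AE x in lborel. fourier_int \<phi>_hat x = \<phi> x"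
    using sobolev g by (intro L2_fourier_inversion) (auto simp: sobolev_L2_def)
  have u: "u = (\<lambda>x t. fourier_int (\<lambda>\<xi>. complex_of_real (mittag_leffler \<rho> (- symbA a (2 * l) \<xi> * t powr \<rho>)) * \<phi>_hat \<xi>) x)"
    by (intro ext) (simp only: u_def fourier_int_def)
  note sol = mittag_leffler_fourier_solution[OF rho C g T init]
  show ?thesis
    unfolding u
    using sol(1) integrable_mult_cis[OF sol(2)] uniform_limit_fourier_int_cball[OF sol(2)] by blast
qed

end
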